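(* Let $K$ be an AEC with the amalgamation property and let $\kappa>LS(K)$. If $K$ is categorical in a cardinal $\lambda$ satisfying $\lambda=\lambda^{<\kappa}$, then every model in $K$ of size at least $\chi$ is $\kappa$-saturated, where $\chi=\min\{\lambda,\ \sup_{\mu<\kappa}\beth_{(2^\mu)^+}\}$.
   Context: $K$ is an abstract elementary class with strong substructure $\prec$ and Löwenheim–Skolem number $LS(K)$. Galois types are defined in the usual way using amalgamation: for $N\prec M$ and $a\in M$, $tp(a/N;M)=tp(a'/N;M')$ iff there are $K$-embeddings of $M$ and $M'$ over $N$ into a common model sending $a$ and $a'$ to the same element. A model $M$ is $\kappa$-saturated iff for every $N\prec M$ with $\|N\|<\kappa$, every Galois type (of a single element) over $N$ is realized in $M$. $K$ is categorical in $\lambda$ iff it has exactly one model of size $\lambda$ up to isomorphism. *)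

theory Defs
  imports Main
begin

unbundle cardinal_syntax

section \<open>Cardinal arithmetic\<close>

text \<open>Cardinals are cardinal orders. Since every cardinal below a cardinal order \<open>\<kappa>\<close> is
  order-isomorphic to one on the type of \<open>\<kappa>\<close>, quantifying over cardinal orders of that type
  loses nothing.\<close>

definition cards_below :: "'k rel \<Rightarrow> 'k rel set" where
  "cards_below \<kappa> = {\<mu>. Card_order \<mu> \<and> \<mu> <o \<kappa>}"

definition is_card_Sup :: "'c rel set \<Rightarrow> 'd rel \<Rightarrow> bool" where
  "is_card_Sup X s \<longleftrightarrow> Card_order s \<and> (\<forall>x\<in>X. x \<le>o s) \<and>
     (\<forall>s' :: 'd rel. Card_order s' \<and> (\<forall>x\<in>X. x \<le>o s') \<longrightarrow> s \<le>o s')"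

text \<open>\<open>is_weak_power lam \<kappa> \<nu>\<close>: the cardinal \<open>\<nu>\<close> is \<open>lam\<close> to the power \<open>< \<kappa>\<close>, the supremum of all
  \<open>lam ^c \<mu>\<close> for cardinals \<open>\<mu> < \<kappa>\<close>.\<close>

definition is_weak_power :: "'l rel \<Rightarrow> 'k rel \<Rightarrow> 'd rel \<Rightarrow> bool" where
  "is_weak_power lam \<kappa> \<nu> \<longleftrightarrow> is_card_Sup ((\<lambda>\<mu>. lam ^c \<mu>) ` cards_below \<kappa>) \<nu>"

text \<open>\<open>is_beth r c\<close>: the cardinal order \<open>c\<close> is \<open>\<beth>\<^sub>\<alpha>\<close>, where \<open>\<alpha>\<close> is the order type of the well-order
  \<open>r\<close>. The ordinals below \<open>\<alpha>\<close> are the proper initial segments of \<open>r\<close>; \<open>\<alpha>\<close> is a successor iff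
  \<open>r\<close> has a greatest element. This is a relation and not a function because \<open>\<beth>\<^sub>\<alpha>\<close> need not fit
  into the type of \<open>c\<close>.\<close>

inductive is_beth :: "'i rel \<Rightarrow> 'c rel \<Rightarrow> bool" where
  zero: "\<lbrakk>Well_order r; Field r = {}; Card_order c; c =o natLeq\<rbrakk> \<Longrightarrow> is_beth r c"
| succ: "\<lbrakk>Well_order r; j \<in> Field r; \<forall>i\<in>Field r. (i, j) \<in> r;
          is_beth (Restr r (underS r j)) d; Card_order c; c =o ctwo ^c d\<rbrakk> \<Longrightarrow> is_beth r c"
| limit: "\<lbrakk>Well_order r; Field r \<noteq> {}; \<forall>i\<in>Field r. \<exists>j\<in>Field r. (i, j) \<in> r \<and> i \<noteq> j;
          \<forall>i\<in>Field r. is_beth (Restr r (underS r i)) (F i);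
          is_card_Sup (F ` Field r) c\<rbrakk> \<Longrightarrow> is_beth r c"

text \<open>\<open>is_beth_Sup \<kappa> s\<close>: \<open>s\<close> is the supremum over all cardinals \<open>\<mu> < \<kappa>\<close> of \<open>\<beth>\<close> at \<open>(2\<^sup>\<mu>)\<^sup>+\<close>.\<close>

definition is_beth_Sup :: "'k rel \<Rightarrow> 'c rel \<Rightarrow> bool" where
  "is_beth_Sup \<kappa> s \<longleftrightarrow>
     (\<exists>B :: 'k rel \<Rightarrow> 'c rel. (\<forall>\<mu>\<in>cards_below \<kappa>. is_beth (cardSuc (ctwo ^c \<mu>)) (B \<mu>)) \<and>
          is_card_Sup (B ` cards_below \<kappa>) s)"

text \<open>\<open>is_threshold \<kappa> lam \<chi>\<close>: \<open>\<chi>\<close> is the minimum of \<open>lam\<close> and the supremum above. If that supremum does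
  not exist on the type of \<open>lam\<close>, then it exceeds \<open>lam\<close>, and the minimum is \<open>lam\<close>.\<close>

definition is_threshold :: "'k rel \<Rightarrow> 'l rel \<Rightarrow> 'l rel \<Rightarrow> bool" where
  "is_threshold \<kappa> lam \<chi> \<longleftrightarrow>
     (is_beth_Sup \<kappa> \<chi> \<and> \<chi> <o lam) \<or>
     (\<chi> = lam \<and> \<not> (\<exists>s :: 'l rel. is_beth_Sup \<kappa> s \<and> s <o lam))"


section \<open>Structures\<close>

record ('f, 'r) vocabulary =
  fsyms :: "'f set"
  rsyms :: "'r set"
  farity :: "'f \<Rightarrow> nat"
  rarity :: "'r \<Rightarrow> nat"

record ('u, 'f, 'r) struc =
  univ :: "'u set"
  fint :: "'f \<Rightarrow> 'u list \<Rightarrow> 'u"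
  rint :: "'r \<Rightarrow> 'u list \<Rightarrow> bool"

definition fargs :: "('f, 'r) vocabulary \<Rightarrow> 'f \<Rightarrow> 'u set \<Rightarrow> 'u list set" where
  "fargs \<tau> f A = {xs. length xs = farity \<tau> f \<and> set xs \<subseteq> A}"

definition rargs :: "('f, 'r) vocabulary \<Rightarrow> 'r \<Rightarrow> 'u set \<Rightarrow> 'u list set" where
  "rargs \<tau> R A = {xs. length xs = rarity \<tau> R \<and> set xs \<subseteq> A}"

text \<open>The last two conjuncts fix the irrelevant values of the interpretations, so that equality of
  records is equality of structures.\<close>

definition structure_of :: "('f, 'r) vocabulary \<Rightarrow> ('u, 'f, 'r) struc \<Rightarrow> bool" where
  "structure_of \<tau> M \<longleftrightarrow> univ M \<noteq> {} \<and>
     (\<forall>f\<in>fsyms \<tau>. \<forall>xs\<in>fargs \<tau> f (univ M). fint M f xs \<in> univ M) \<and>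
     (\<forall>f xs. \<not> (f \<in> fsyms \<tau> \<and> xs \<in> fargs \<tau> f (univ M)) \<longrightarrow> fint M f xs = undefined) \<and>
     (\<forall>R xs. rint M R xs \<longrightarrow> R \<in> rsyms \<tau> \<and> xs \<in> rargs \<tau> R (univ M))"

definition substructure ::
  "('f, 'r) vocabulary \<Rightarrow> ('u, 'f, 'r) struc \<Rightarrow> ('u, 'f, 'r) struc \<Rightarrow> bool" where
  "substructure \<tau> M N \<longleftrightarrow> structure_of \<tau> M \<and> structure_of \<tau> N \<and> univ M \<subseteq> univ N \<and>
     (\<forall>f\<in>fsyms \<tau>. \<forall>xs\<in>fargs \<tau> f (univ M). fint M f xs = fint N f xs) \<and>
     (\<forall>R\<in>rsyms \<tau>. \<forall>xs\<in>rargs \<tau> R (univ M). rint M R xs \<longleftrightarrow> rint N R xs)"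

definition is_iso ::
  "('f, 'r) vocabulary \<Rightarrow> ('u \<Rightarrow> 'u) \<Rightarrow> ('u, 'f, 'r) struc \<Rightarrow> ('u, 'f, 'r) struc \<Rightarrow> bool" where
  "is_iso \<tau> h M N \<longleftrightarrow> structure_of \<tau> M \<and> structure_of \<tau> N \<and> bij_betw h (univ M) (univ N) \<and>
     (\<forall>f\<in>fsyms \<tau>. \<forall>xs\<in>fargs \<tau> f (univ M). h (fint M f xs) = fint N f (map h xs)) \<and>
     (\<forall>R\<in>rsyms \<tau>. \<forall>xs\<in>rargs \<tau> R (univ M). rint M R xs \<longleftrightarrow> rint N R (map h xs))"

definition isomorphic ::
  "('f, 'r) vocabulary \<Rightarrow> ('u, 'f, 'r) struc \<Rightarrow> ('u, 'f, 'r) struc \<Rightarrow> bool" where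
  "isomorphic \<tau> M N \<longleftrightarrow> (\<exists>h. is_iso \<tau> h M N)"

text \<open>The union of a chain of structures \<open>M i\<close>, \<open>i \<in> I\<close>.\<close>

definition Union_struc ::
  "('f, 'r) vocabulary \<Rightarrow> 'i set \<Rightarrow> ('i \<Rightarrow> ('u, 'f, 'r) struc) \<Rightarrow> ('u, 'f, 'r) struc" where
  "Union_struc \<tau> I M =
     \<lparr>univ = (\<Union>i\<in>I. univ (M i)),
      fint = (\<lambda>f xs. if f \<in> fsyms \<tau> \<and> xs \<in> fargs \<tau> f (\<Union>i\<in>I. univ (M i))
                 then (THE y. \<exists>i\<in>I. set xs \<subseteq> univ (M i) \<and> y = fint (M i) f xs)
                 else undefined),
      rint = (\<lambda>R xs. \<exists>i\<in>I. rint (M i) R xs)\<rparr>"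


section \<open>Abstract elementary classes\<close>

text \<open>An increasing continuous chain indexed by a nonempty well-order. Well-orders on the type of
  elements suffice as index sets: a chain without repetitions of substructures on that type
  has no longer length (unless the type is finite).\<close>

definition continuous_chain ::
  "('f, 'r) vocabulary \<Rightarrow> (('u, 'f, 'r) struc \<Rightarrow> ('u, 'f, 'r) struc \<Rightarrow> bool) \<Rightarrow>
   'u rel \<Rightarrow> ('u \<Rightarrow> ('u, 'f, 'r) struc) \<Rightarrow> bool" where
  "continuous_chain \<tau> prec r M \<longleftrightarrow> Well_order r \<and> Field r \<noteq> {} \<and>
     (\<forall>(i, j)\<in>r. prec (M i) (M j)) \<and>
     (\<forall>i\<in>Field r. underS r i \<noteq> {} \<and> (\<forall>j\<in>underS r i. \<exists>k\<in>underS r i. (j, k) \<in> r \<and> j \<noteq> k) \<longrightarrow>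
        M i = Union_struc \<tau> (underS r i) M)"

definition LS_property ::
  "('f, 'r) vocabulary \<Rightarrow> ('u, 'f, 'r) struc set \<Rightarrow>
   (('u, 'f, 'r) struc \<Rightarrow> ('u, 'f, 'r) struc \<Rightarrow> bool) \<Rightarrow> 's rel \<Rightarrow> bool" where
  "LS_property \<tau> K prec \<mu> \<longleftrightarrow> Card_order \<mu> \<and> natLeq \<le>o \<mu> \<and> |fsyms \<tau> <+> rsyms \<tau>| \<le>o \<mu> \<and>
     (\<forall>M\<in>K. \<forall>A \<subseteq> univ M. \<exists>N. prec N M \<and> A \<subseteq> univ N \<and> |univ N| \<le>o |A| +c \<mu>)"

text \<open>HOL has no proper class of all sets. The sets of the ambient universe are rendered as the
  subsets of the type \<open>'u\<close> of cardinality less than \<open>\<theta>\<close>, and \<open>K\<close> is a class of structures on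
  such sets. For \<open>\<theta> = |UNIV :: 'u set|\<close> inaccessible this is a Grothendieck universe; for
  \<open>\<theta> = cardSuc |UNIV :: 'u set|\<close> every subset of \<open>'u\<close> is admitted. The bound says that members of \<open>K\<close> are
  sets of the universe, that only chains whose union is a set of the universe have to have a union
  in \<open>K\<close>, and that the Loewenheim-Skolem number is a cardinal of the universe.\<close>

locale aec =
  fixes \<tau> :: "('f, 'r) vocabulary"
    and K :: "('u, 'f, 'r) struc set"
    and prec :: "('u, 'f, 'r) struc \<Rightarrow> ('u, 'f, 'r) struc \<Rightarrow> bool"
    and \<theta> :: "'t rel"
  assumes bound: "Card_order \<theta>"
    and structures: "M \<in> K \<Longrightarrow> structure_of \<tau> M"
    and small: "M \<in> K \<Longrightarrow> |univ M| <o \<theta>"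
    and prec_K: "prec M N \<Longrightarrow> M \<in> K \<and> N \<in> K"
    and prec_substructure: "prec M N \<Longrightarrow> substructure \<tau> M N"
    and prec_refl: "M \<in> K \<Longrightarrow> prec M M"
    and prec_antisym: "\<lbrakk>prec M N; prec N M\<rbrakk> \<Longrightarrow> M = N"
    and prec_trans: "\<lbrakk>prec M N; prec N P\<rbrakk> \<Longrightarrow> prec M P"
    and K_iso: "\<lbrakk>M \<in> K; is_iso \<tau> h M M'\<rbrakk> \<Longrightarrow> M' \<in> K"
    and prec_iso: "\<lbrakk>prec N M; is_iso \<tau> h M M'; is_iso \<tau> h N N'\<rbrakk> \<Longrightarrow> prec N' M'"
    and coherence: "\<lbrakk>prec M\<^sub>0 M\<^sub>2; prec M\<^sub>1 M\<^sub>2; substructure \<tau> M\<^sub>0 M\<^sub>1\<rbrakk> \<Longrightarrow> prec M\<^sub>0 M\<^sub>1"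
    and chain_Union: "\<lbrakk>continuous_chain \<tau> prec r Ms; |\<Union>i\<in>Field r. univ (Ms i)| <o \<theta>\<rbrakk> \<Longrightarrow>
          Union_struc \<tau> (Field r) Ms \<in> K"
    and chain_upper: "\<lbrakk>continuous_chain \<tau> prec r Ms; |\<Union>i\<in>Field r. univ (Ms i)| <o \<theta>;
          i \<in> Field r\<rbrakk> \<Longrightarrow> prec (Ms i) (Union_struc \<tau> (Field r) Ms)"
    and chain_least: "\<lbrakk>continuous_chain \<tau> prec r Ms; N \<in> K; \<forall>i\<in>Field r. prec (Ms i) N\<rbrakk> \<Longrightarrow>
          prec (Union_struc \<tau> (Field r) Ms) N"
    and LS_ex: "\<exists>\<mu> :: 't rel. \<mu> <o \<theta> \<and> LS_property \<tau> K prec \<mu>"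

definition is_LS_number ::
  "('f, 'r) vocabulary \<Rightarrow> ('u, 'f, 'r) struc set \<Rightarrow>
   (('u, 'f, 'r) struc \<Rightarrow> ('u, 'f, 'r) struc \<Rightarrow> bool) \<Rightarrow> 's rel \<Rightarrow> bool" where
  "is_LS_number \<tau> K prec \<mu> \<longleftrightarrow> LS_property \<tau> K prec \<mu> \<and>
     (\<forall>\<mu>' :: 's rel. LS_property \<tau> K prec \<mu>' \<longrightarrow> \<mu> \<le>o \<mu>')"

definition K_embedding ::
  "('f, 'r) vocabulary \<Rightarrow> (('u, 'f, 'r) struc \<Rightarrow> ('u, 'f, 'r) struc \<Rightarrow> bool) \<Rightarrow>
   ('u \<Rightarrow> 'u) \<Rightarrow> ('u, 'f, 'r) struc \<Rightarrow> ('u, 'f, 'r) struc \<Rightarrow> bool" where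
  "K_embedding \<tau> prec h M N \<longleftrightarrow> (\<exists>M'. is_iso \<tau> h M M' \<and> prec M' N)"

definition amalgamation_property ::
  "('f, 'r) vocabulary \<Rightarrow> ('u, 'f, 'r) struc set \<Rightarrow>
   (('u, 'f, 'r) struc \<Rightarrow> ('u, 'f, 'r) struc \<Rightarrow> bool) \<Rightarrow> bool" where
  "amalgamation_property \<tau> K prec \<longleftrightarrow>
     (\<forall>M\<^sub>0 M\<^sub>1 M\<^sub>2. prec M\<^sub>0 M\<^sub>1 \<and> prec M\<^sub>0 M\<^sub>2 \<longrightarrow>
        (\<exists>N\<in>K. \<exists>h\<^sub>1 h\<^sub>2. K_embedding \<tau> prec h\<^sub>1 M\<^sub>1 N \<and> K_embedding \<tau> prec h\<^sub>2 M\<^sub>2 N \<and>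
           (\<forall>x\<in>univ M\<^sub>0. h\<^sub>1 x = h\<^sub>2 x)))"

definition categorical_in ::
  "('f, 'r) vocabulary \<Rightarrow> ('u, 'f, 'r) struc set \<Rightarrow> 'l rel \<Rightarrow> bool" where
  "categorical_in \<tau> K lam \<longleftrightarrow> (\<exists>M\<in>K. |univ M| =o lam) \<and>
     (\<forall>M\<in>K. \<forall>N\<in>K. |univ M| =o lam \<and> |univ N| =o lam \<longrightarrow> isomorphic \<tau> M N)"

text \<open>\<open>gtp \<tau> K prec a N M\<close> is the Galois type \<open>tp(a/N; M)\<close>, as the class of all \<open>(a', M')\<close> that realize
  it. Under amalgamation this is an equivalence class.\<close>

definition gtp ::
  "('f, 'r) vocabulary \<Rightarrow> ('u, 'f, 'r) struc set \<Rightarrow>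
   (('u, 'f, 'r) struc \<Rightarrow> ('u, 'f, 'r) struc \<Rightarrow> bool) \<Rightarrow>
   'u \<Rightarrow> ('u, 'f, 'r) struc \<Rightarrow> ('u, 'f, 'r) struc \<Rightarrow> ('u \<times> ('u, 'f, 'r) struc) set" where
  "gtp \<tau> K prec a N M =
     {(a', M'). prec N M' \<and> a' \<in> univ M' \<and>
        (\<exists>C\<in>K. \<exists>h h'. K_embedding \<tau> prec h M C \<and> K_embedding \<tau> prec h' M' C \<and>
           (\<forall>x\<in>univ N. h x = x \<and> h' x = x) \<and> h a = h' a')}"

definition gtypes ::
  "('f, 'r) vocabulary \<Rightarrow> ('u, 'f, 'r) struc set \<Rightarrow>
   (('u, 'f, 'r) struc \<Rightarrow> ('u, 'f, 'r) struc \<Rightarrow> bool) \<Rightarrow>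
   ('u, 'f, 'r) struc \<Rightarrow> ('u \<times> ('u, 'f, 'r) struc) set set" where
  "gtypes \<tau> K prec N = {gtp \<tau> K prec a N M | a M. prec N M \<and> a \<in> univ M}"

definition saturated ::
  "('f, 'r) vocabulary \<Rightarrow> ('u, 'f, 'r) struc set \<Rightarrow>
   (('u, 'f, 'r) struc \<Rightarrow> ('u, 'f, 'r) struc \<Rightarrow> bool) \<Rightarrow> 'k rel \<Rightarrow> ('u, 'f, 'r) struc \<Rightarrow> bool" where
  "saturated \<tau> K prec \<kappa> M \<longleftrightarrow>
     (\<forall>N. prec N M \<and> |univ N| <o \<kappa> \<longrightarrow>
        (\<forall>p\<in>gtypes \<tau> K prec N. \<exists>b\<in>univ M. gtp \<tau> K prec b N M = p))"

end

theory Submission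
  imports Defs
begin

text \<open>Over \<open>lam\<close> with \<open>lam = lam\<^sup><\<^sup>\<kappa>\<close> there are only \<open>lam\<close> types over small submodels of a model of size
  \<open>lam\<close>, so amalgamation yields a \<open>\<kappa>\<close>-saturated model of size \<open>lam\<close>, and by categoricity every model
  of that size is \<open>\<kappa>\<close>-saturated. Larger models inherit this from their submodels of size \<open>lam\<close>. If a
  model \<open>M\<close> of size at least \<open>\<beth>\<close> at \<open>(2\<^sup>\<mu>)\<^sup>+\<close> omitted a type over \<open>N\<close>, where \<open>N\<close> has size at most \<open>\<mu>\<close>,
  then Morley's omitting types argument would give a model of size \<open>lam\<close> omitting the same type: attach
  to the finite subsets of \<open>M\<close> an increasing system of submodels containing \<open>N\<close>, colour the finite
  subsets by the isomorphism types of their systems, find coherent homogeneous colours by Erdos--Rado,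
  and glue pieces of these colours along an order of size \<open>lam\<close>. Each piece of the resulting model is
  isomorphic over \<open>N\<close> to a submodel of \<open>M\<close>, so no piece realizes the type.\<close>

section \<open>Structures and embeddings\<close>

text \<open>The universe is a fixed type, so there may be no room to rename an amalgam over a given
  \<open>N\<close>. The argument therefore uses \<open>sim\<close>, where the two embeddings need
  only agree on \<open>N\<close>, and \<open>rich\<close>, the matching form of saturation; for
  \<open>N\<close> smaller than the type, \<open>sim\<close> is equality of \<open>gtp\<close>, and
  \<open>rich\<close> then yields \<open>saturated\<close>. The axioms give unions only of
  well-ordered chains indexed by elements, while linearly ordered families (for Zorn's lemma) and
  systems indexed by finite sets (for gluing) are needed; these are reduced to chains first. On the
  index \<open>(2^\<mu>)^+\<close>: colours are sets of data from a stock of size at most \<mu>, so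
  there are at most \<open>2^\<mu>\<close> of them. Homogeneity for one length of finite sets costs
  finitely many levels of \<beth>, which a limit index can afford at every level. Choosing one
  colour that works at all levels needs a regular cardinal above the number of colours, hence the
  successor. The homogeneous sets for different lengths need not be nested; only their colours
  cohere, and this suffices because the colours take the place of Skolem terms.\<close>

lemma fargs_image: "fargs \<tau> f (h ` A) = map h ` fargs \<tau> f A"
proof
  show "fargs \<tau> f (h ` A) \<subseteq> map h ` fargs \<tau> f A"
  proof
    fix xs assume a: "xs \<in> fargs \<tau> f (h ` A)"
    then have "xs \<in> lists (h ` A)" by (auto simp: fargs_def)
    then obtain ys where "ys \<in> lists A" "xs = map h ys" by (auto simp: lists_image)
    with a show "xs \<in> map h ` fargs \<tau> f A" by (auto simp: fargs_def)
  qed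
qed (use image_eqI in \<open>fastforce simp: fargs_def\<close>)

lemma rargs_image: "rargs \<tau> R (h ` A) = map h ` rargs \<tau> R A"
proof
  show "rargs \<tau> R (h ` A) \<subseteq> map h ` rargs \<tau> R A"
  proof
    fix xs assume a: "xs \<in> rargs \<tau> R (h ` A)"
    then have "xs \<in> lists (h ` A)" by (auto simp: rargs_def)
    then obtain ys where "ys \<in> lists A" "xs = map h ys" by (auto simp: lists_image)
    with a show "xs \<in> map h ` rargs \<tau> R A" by (auto simp: rargs_def)
  qed
qed (use image_eqI in \<open>fastforce simp: rargs_def\<close>)

lemma fargs_mono: "A \<subseteq> B \<Longrightarrow> xs \<in> fargs \<tau> f A \<Longrightarrow> xs \<in> fargs \<tau> f B"
  by (auto simp: fargs_def)

lemma rargs_mono: "A \<subseteq> B \<Longrightarrow> xs \<in> rargs \<tau> R A \<Longrightarrow> xs \<in> rargs \<tau> R B"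
  by (auto simp: rargs_def)

text \<open>\<open>structure_of\<close> fixes all values outside the argument lists compared here,
  so agreement on these already makes the records equal.\<close>

lemma struc_eqI:
  fixes M N :: "('u, 'f, 'r) struc"
  assumes M: "structure_of \<tau> M" and N: "structure_of \<tau> N" and u: "univ M = univ N"
    and f: "\<And>f xs. f \<in> fsyms \<tau> \<Longrightarrow> xs \<in> fargs \<tau> f (univ M) \<Longrightarrow> fint M f xs = fint N f xs"
    and r: "\<And>R xs. R \<in> rsyms \<tau> \<Longrightarrow> xs \<in> rargs \<tau> R (univ M) \<Longrightarrow> rint M R xs = rint N R xs"
  shows "M = N"
proof -
  have "fint M f xs = fint N f xs" for f xs
    using M N u f unfolding structure_of_def by metis
  moreover have "rint M R xs = rint N R xs" for R xs
    using M N u r unfolding structure_of_def by metis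
  ultimately show ?thesis using u by (intro struc.equality) (auto simp: fun_eq_iff)
qed

lemma iso_structure: "is_iso \<tau> h M N \<Longrightarrow> structure_of \<tau> M \<and> structure_of \<tau> N"
  by (simp add: is_iso_def)

lemma iso_univ: "is_iso \<tau> h M N \<Longrightarrow> univ N = h ` univ M"
  by (auto simp: is_iso_def bij_betw_def)

lemma iso_inj: "is_iso \<tau> h M N \<Longrightarrow> inj_on h (univ M)"
  by (auto simp: is_iso_def bij_betw_def)

lemma iso_fint:
  "is_iso \<tau> h M N \<Longrightarrow> f \<in> fsyms \<tau> \<Longrightarrow> xs \<in> fargs \<tau> f (univ M) \<Longrightarrow>
    fint N f (map h xs) = h (fint M f xs)"
  by (simp add: is_iso_def)

lemma iso_rint:
  "is_iso \<tau> h M N \<Longrightarrow> R \<in> rsyms \<tau> \<Longrightarrow> xs \<in> rargs \<tau> R (univ M) \<Longrightarrow>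
    rint N R (map h xs) = rint M R xs"
  by (simp add: is_iso_def)

text \<open>Surjectivity lifts every argument list of the target to one of \<open>M\<close>, where
  the map dictates the value. Hence \<open>img\<close> below is the only target of an isomorphism
  with a given map (\<open>iso_eq_img\<close>).\<close>

lemma iso_unique:
  assumes 1: "is_iso \<tau> h M N\<^sub>1" and 2: "is_iso \<tau> h M N\<^sub>2"
  shows "N\<^sub>1 = N\<^sub>2"
proof (rule struc_eqI[of \<tau>])
  show "structure_of \<tau> N\<^sub>1" "structure_of \<tau> N\<^sub>2" using 1 2 iso_structure by auto
  show "univ N\<^sub>1 = univ N\<^sub>2" using 1 2 iso_univ by metis
  show "fint N\<^sub>1 f xs = fint N\<^sub>2 f xs" if "f \<in> fsyms \<tau>" "xs \<in> fargs \<tau> f (univ N\<^sub>1)" for f xs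
    using that 1 2 by (auto simp: iso_univ[OF 1] fargs_image iso_fint)
  show "rint N\<^sub>1 R xs = rint N\<^sub>2 R xs" if "R \<in> rsyms \<tau>" "xs \<in> rargs \<tau> R (univ N\<^sub>1)" for R xs
    using that 1 2 by (auto simp: iso_univ[OF 1] rargs_image iso_rint)
qed

lemma iso_cong:
  assumes "is_iso \<tau> h M N" "\<And>x. x \<in> univ M \<Longrightarrow> k x = h x"
  shows "is_iso \<tau> k M N"
proof -
  have 1: "map k xs = map h xs" if "set xs \<subseteq> univ M" for xs
    using that assms(2) by (auto intro: map_cong)
  have 2: "fint M f xs \<in> univ M" if "f \<in> fsyms \<tau>" "xs \<in> fargs \<tau> f (univ M)" for f xs
    using assms(1) that by (simp add: is_iso_def structure_of_def)
  have 3: "bij_betw k (univ M) (univ N)"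
    using assms by (simp add: is_iso_def cong: bij_betw_cong)
  show ?thesis
    using assms(1) 1 2 3 assms(2)[OF 2]
    by (simp add: is_iso_def fargs_def rargs_def del: map_eq_conv)
qed

lemma iso_id: "structure_of \<tau> M \<Longrightarrow> is_iso \<tau> id M M"
  by (simp add: is_iso_def)

lemma iso_id_on: "structure_of \<tau> M \<Longrightarrow> (\<And>x. x \<in> univ M \<Longrightarrow> h x = x) \<Longrightarrow> is_iso \<tau> h M M"
  by (rule iso_cong[OF iso_id]) auto

lemma iso_comp:
  assumes 1: "is_iso \<tau> h M N" and 2: "is_iso \<tau> k N P"
  shows "is_iso \<tau> (k \<circ> h) M P"
  unfolding is_iso_def
proof (intro conjI ballI)
  show "structure_of \<tau> M" "structure_of \<tau> P" using 1 2 iso_structure by auto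
  show "bij_betw (k \<circ> h) (univ M) (univ P)" using 1 2 bij_betw_trans unfolding is_iso_def by blast
  fix f xs assume f: "f \<in> fsyms \<tau>" and xs: "xs \<in> fargs \<tau> f (univ M)"
  then have "map h xs \<in> fargs \<tau> f (univ N)" by (simp add: iso_univ[OF 1] fargs_image)
  then show "(k \<circ> h) (fint M f xs) = fint P f (map (k \<circ> h) xs)"
    using iso_fint[OF 2 f] iso_fint[OF 1 f xs] by (simp flip: map_map)
next
  fix R xs assume f: "R \<in> rsyms \<tau>" and xs: "xs \<in> rargs \<tau> R (univ M)"
  then have "map h xs \<in> rargs \<tau> R (univ N)" by (simp add: iso_univ[OF 1] rargs_image)
  then show "rint M R xs \<longleftrightarrow> rint P R (map (k \<circ> h) xs)"
    using iso_rint[OF 2 f] iso_rint[OF 1 f xs] by (simp flip: map_map)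
qed

lemma iso_inv:
  assumes 1: "is_iso \<tau> h M N" and k: "\<And>x. x \<in> univ M \<Longrightarrow> k (h x) = x"
  shows "is_iso \<tau> k N M"
  unfolding is_iso_def
proof (intro conjI ballI)
  show "structure_of \<tau> M" "structure_of \<tau> N" using 1 iso_structure by auto
  have u: "univ N = h ` univ M" using iso_univ[OF 1] .
  show "bij_betw k (univ N) (univ M)"
    unfolding u by (rule bij_betw_byWitness[of _ h]) (auto simp: k)
  have m: "map (k \<circ> h) xs = xs" if "set xs \<subseteq> univ M" for xs
    using that k by (intro map_idI) auto
  fix f xs assume f: "f \<in> fsyms \<tau>" and xs: "xs \<in> fargs \<tau> f (univ N)"
  then obtain ys where ys: "ys \<in> fargs \<tau> f (univ M)" "xs = map h ys" by (auto simp: u fargs_image)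
  have "fint M f ys \<in> univ M"
    using iso_structure[OF 1] f ys(1) by (simp add: structure_of_def)
  then show "k (fint N f xs) = fint M f (map k xs)"
    using ys iso_fint[OF 1 f ys(1)] m[of ys] by (simp add: k fargs_def)
next
  have u: "univ N = h ` univ M" using iso_univ[OF 1] .
  have m: "map (k \<circ> h) xs = xs" if "set xs \<subseteq> univ M" for xs
    using that k by (intro map_idI) auto
  fix R xs assume f: "R \<in> rsyms \<tau>" and xs: "xs \<in> rargs \<tau> R (univ N)"
  then obtain ys where ys: "ys \<in> rargs \<tau> R (univ M)" "xs = map h ys" by (auto simp: u rargs_image)
  then show "rint N R xs \<longleftrightarrow> rint M R (map k xs)"
    using iso_rint[OF 1 f ys(1)] m[of ys] by (simp add: rargs_def)
qed

text \<open>Transport of structure along \<open>h\<close>, meaningful when \<open>h\<close> is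
  injective on the universe. Naming the target removes the existential quantifier from
  \<open>K_embedding\<close> (\<open>kemb_iff\<close>).\<close>

definition img ::
  "('f, 'r) vocabulary \<Rightarrow> ('u \<Rightarrow> 'u) \<Rightarrow> ('u, 'f, 'r) struc \<Rightarrow> ('u, 'f, 'r) struc" where
  "img \<tau> h M =
     \<lparr>univ = h ` univ M,
      fint = (\<lambda>f xs. if f \<in> fsyms \<tau> \<and> xs \<in> fargs \<tau> f (h ` univ M)
                then h (fint M f (map (inv_into (univ M) h) xs)) else undefined),
      rint = (\<lambda>R xs. R \<in> rsyms \<tau> \<and> xs \<in> rargs \<tau> R (h ` univ M) \<and>
                rint M R (map (inv_into (univ M) h) xs))\<rparr>"

lemma univ_img [simp]: "univ (img \<tau> h M) = h ` univ M"
  by (simp add: img_def)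

lemma iso_img:
  assumes M: "structure_of \<tau> M" and h: "inj_on h (univ M)"
  shows "is_iso \<tau> h M (img \<tau> h M)"
proof -
  have m: "map (inv_into (univ M) h \<circ> h) xs = xs" if "set xs \<subseteq> univ M" for xs
    using that h by (intro map_idI) auto
  have mf: "map (inv_into (univ M) h \<circ> h) xs = xs" if "xs \<in> fargs \<tau> f (univ M)" for f xs
    using that by (intro m) (auto simp: fargs_def)
  have mr: "map (inv_into (univ M) h \<circ> h) xs = xs" if "xs \<in> rargs \<tau> f (univ M)" for f xs
    using that by (intro m) (auto simp: rargs_def)
  have cl: "fint M f xs \<in> univ M" if "f \<in> fsyms \<tau>" "xs \<in> fargs \<tau> f (univ M)" for f xs
    using M that by (simp add: structure_of_def)
  have "structure_of \<tau> (img \<tau> h M)"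
    using M cl unfolding structure_of_def by (auto simp: img_def fargs_image mf)
  then show ?thesis
    using M h by (auto simp: is_iso_def bij_betw_def img_def fargs_image rargs_image mf mr)
qed

lemma iso_eq_img: "is_iso \<tau> h M N \<Longrightarrow> N = img \<tau> h M"
  using iso_img[of \<tau> M h] iso_inj[of \<tau> h M N] iso_structure[of \<tau> h M N] iso_unique[of \<tau> h M N]
  by blast

lemma img_cong:
  assumes "structure_of \<tau> M" "inj_on h (univ M)" "\<And>x. x \<in> univ M \<Longrightarrow> k x = h x"
  shows "img \<tau> k M = img \<tau> h M"
  using iso_eq_img[OF iso_cong[OF iso_img[OF assms(1,2)] assms(3)]] by simp

lemma img_comp:
  assumes "is_iso \<tau> h M N" "inj_on k (univ N)"
  shows "img \<tau> (k \<circ> h) M = img \<tau> k N"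
  using assms iso_comp[OF assms(1) iso_img[OF _ assms(2)]] iso_structure iso_eq_img by metis

lemma img_id: "structure_of \<tau> M \<Longrightarrow> (\<And>x. x \<in> univ M \<Longrightarrow> h x = x) \<Longrightarrow> img \<tau> h M = M"
  using iso_eq_img iso_id_on by metis

lemma substructure_univ: "substructure \<tau> M N \<Longrightarrow> univ M \<subseteq> univ N"
  by (simp add: substructure_def)

lemma substructure_between:
  "substructure \<tau> M P \<Longrightarrow> substructure \<tau> N P \<Longrightarrow> univ M \<subseteq> univ N \<Longrightarrow> substructure \<tau> M N"
  unfolding substructure_def by (metis fargs_mono rargs_mono)

lemma substructure_eq: "substructure \<tau> M N \<Longrightarrow> univ M = univ N \<Longrightarrow> M = N"
  unfolding substructure_def by (intro struc_eqI[of \<tau>]) auto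

lemma iso_restrict:
  assumes N: "substructure \<tau> N M" and h: "is_iso \<tau> h M M'"
  shows "is_iso \<tau> h N (img \<tau> h N)" and "substructure \<tau> (img \<tau> h N) M'"
proof -
  have sub: "univ N \<subseteq> univ M" using N substructure_univ by auto
  show 1: "is_iso \<tau> h N (img \<tau> h N)"
    using N iso_inj[OF h] sub
    by (intro iso_img) (auto simp: substructure_def intro: inj_on_subset)
  show "substructure \<tau> (img \<tau> h N) M'"
    unfolding substructure_def
  proof (intro conjI ballI)
    show "structure_of \<tau> (img \<tau> h N)" "structure_of \<tau> M'" using 1 h iso_structure by auto
    show "univ (img \<tau> h N) \<subseteq> univ M'" using sub iso_univ[OF h] by auto
    fix f xs assume f: "f \<in> fsyms \<tau>" and "xs \<in> fargs \<tau> f (univ (img \<tau> h N))"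
    then obtain ys where ys: "ys \<in> fargs \<tau> f (univ N)" "xs = map h ys" by (auto simp: fargs_image)
    with sub have "ys \<in> fargs \<tau> f (univ M)" by (meson fargs_mono)
    with ys show "fint (img \<tau> h N) f xs = fint M' f xs"
      using N f by (simp add: iso_fint[OF 1] iso_fint[OF h] substructure_def)
  next
    fix R xs assume f: "R \<in> rsyms \<tau>" and "xs \<in> rargs \<tau> R (univ (img \<tau> h N))"
    then obtain ys where ys: "ys \<in> rargs \<tau> R (univ N)" "xs = map h ys" by (auto simp: rargs_image)
    with sub have "ys \<in> rargs \<tau> R (univ M)" by (meson rargs_mono)
    with ys show "rint (img \<tau> h N) R xs = rint M' R xs"
      using N f by (simp add: iso_rint[OF 1] iso_rint[OF h] substructure_def)
  qed
qed

section \<open>Strong substructures and K-embeddings\<close>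

context aec
begin

abbreviation kemb :: "('u \<Rightarrow> 'u) \<Rightarrow> ('u, 'f, 'r) struc \<Rightarrow> ('u, 'f, 'r) struc \<Rightarrow> bool" where
  "kemb \<equiv> K_embedding \<tau> prec"

lemma prec_univ: "prec M N \<Longrightarrow> univ M \<subseteq> univ N"
  using prec_substructure substructure_univ by blast

text \<open>Of two substructures of \<open>P\<close> with nested universes, the smaller is a
  substructure of the larger, which is the premise that coherence asks for.\<close>

lemma prec_between: "prec M P \<Longrightarrow> prec N P \<Longrightarrow> univ M \<subseteq> univ N \<Longrightarrow> prec M N"
  using coherence[of M P N] prec_substructure substructure_between[of \<tau> M P N] by auto

lemma prec_eq: "prec M N \<Longrightarrow> univ M = univ N \<Longrightarrow> M = N"
  using prec_substructure substructure_eq by blast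

lemma iso_imgK: "M \<in> K \<Longrightarrow> inj_on h (univ M) \<Longrightarrow> is_iso \<tau> h M (img \<tau> h M)"
  by (simp add: iso_img structures)

lemma img_K: "M \<in> K \<Longrightarrow> inj_on h (univ M) \<Longrightarrow> img \<tau> h M \<in> K"
  using K_iso iso_imgK by blast

lemma prec_img:
  assumes "prec N M" "inj_on h (univ M)"
  shows "prec (img \<tau> h N) (img \<tau> h M)"
proof -
  have h: "is_iso \<tau> h M (img \<tau> h M)" using prec_K[OF assms(1)] assms(2) iso_imgK by auto
  show ?thesis
    by (rule prec_iso[OF assms(1) h iso_restrict(1)[OF prec_substructure[OF assms(1)] h]])
qed

lemma kemb_iff: "M \<in> K \<Longrightarrow> kemb h M N \<longleftrightarrow> inj_on h (univ M) \<and> prec (img \<tau> h M) N"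
  unfolding K_embedding_def using iso_eq_img[of \<tau> h M] iso_imgK[of M h] iso_inj[of \<tau> h M] by auto

lemma kemb_K: "kemb h M N \<Longrightarrow> M \<in> K \<and> N \<in> K"
proof -
  assume "kemb h M N"
  then obtain M' where M': "is_iso \<tau> h M M'" "prec M' N" by (auto simp: K_embedding_def)
  then have "is_iso \<tau> (inv_into (univ M) h) M' M"
    by (intro iso_inv[OF M'(1)] inv_into_f_f[OF iso_inj[OF M'(1)]])
  then show ?thesis using M' K_iso prec_K by blast
qed

lemma kemb_inj: "kemb h M N \<Longrightarrow> inj_on h (univ M)"
  using kemb_K kemb_iff by blast

lemma kemb_prec_img: "kemb h M N \<Longrightarrow> prec (img \<tau> h M) N"
  using kemb_K kemb_iff by blast

lemma kemb_into: "kemb h M N \<Longrightarrow> x \<in> univ M \<Longrightarrow> h x \<in> univ N"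
  using prec_univ[OF kemb_prec_img[of h M N]] by auto

lemma kemb_id: "prec M N \<Longrightarrow> kemb id M N"
  unfolding K_embedding_def using iso_id prec_K structures by blast

lemma kemb_iso: "is_iso \<tau> h M N \<Longrightarrow> M \<in> K \<Longrightarrow> kemb h M N"
  unfolding K_embedding_def using K_iso prec_refl by blast

lemma kemb_img: "M \<in> K \<Longrightarrow> inj_on h (univ M) \<Longrightarrow> kemb h M (img \<tau> h M)"
  using kemb_iso iso_imgK by blast

lemma kemb_comp:
  assumes "kemb h M N" "kemb k N P"
  shows "kemb (k \<circ> h) M P"
proof -
  have p: "prec (img \<tau> h M) N" "prec (img \<tau> k N) P" "M \<in> K" "inj_on h (univ M)" "inj_on k (univ N)"
    using assms kemb_prec_img kemb_K kemb_inj by auto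
  then have i: "is_iso \<tau> h M (img \<tau> h M)" using iso_imgK by auto
  have j: "inj_on k (univ (img \<tau> h M))" using inj_on_subset[OF p(5) prec_univ[OF p(1)]] .
  have "img \<tau> (k \<circ> h) M = img \<tau> k (img \<tau> h M)" using img_comp[OF i j] .
  moreover have "prec (img \<tau> k (img \<tau> h M)) P" using prec_img[OF p(1,5)] p(2) prec_trans by blast
  moreover have "inj_on (k \<circ> h) (univ M)" using comp_inj_on[of h "univ M" k] p(4) j by simp
  ultimately show ?thesis using p kemb_iff by auto
qed

lemma kemb_restrict: "prec M N \<Longrightarrow> kemb h N P \<Longrightarrow> kemb h M P"
  using kemb_comp[OF kemb_id] by simp

lemma kemb_extend: "kemb h M N \<Longrightarrow> prec N P \<Longrightarrow> kemb h M P"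
  using kemb_comp[OF _ kemb_id] by (metis id_comp)

lemma kemb_prec: "kemb h M N \<Longrightarrow> (\<And>x. x \<in> univ M \<Longrightarrow> h x = x) \<Longrightarrow> prec M N"
  using kemb_prec_img[of h M N] kemb_K[of h M N] img_id[of \<tau> M h] structures by metis

lemma kemb_inv_img:
  assumes "kemb h M N" "\<And>x. x \<in> univ M \<Longrightarrow> k (h x) = x"
  shows "kemb k (img \<tau> h M) M"
proof -
  have M: "M \<in> K" "inj_on h (univ M)" using assms kemb_K kemb_inj by auto
  show ?thesis
    by (rule kemb_iso[OF iso_inv[OF iso_imgK[OF M] assms(2)] img_K[OF M]])
qed

end

section \<open>Directed unions\<close>

lemma substructure_structure: "substructure \<tau> M N \<Longrightarrow> structure_of \<tau> M \<and> structure_of \<tau> N"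
  by (simp only: substructure_def)

lemma structure_rint:
  "structure_of \<tau> M \<Longrightarrow> rint M R xs \<Longrightarrow> R \<in> rsyms \<tau> \<and> xs \<in> rargs \<tau> R (univ M)"
  unfolding structure_of_def by blast

lemma substructure_rint:
  "substructure \<tau> M N \<Longrightarrow> R \<in> rsyms \<tau> \<Longrightarrow> xs \<in> rargs \<tau> R (univ M) \<Longrightarrow> rint N R xs = rint M R xs"
  unfolding substructure_def by blast

lemma substructure_fint:
  "substructure \<tau> M N \<Longrightarrow> f \<in> fsyms \<tau> \<Longrightarrow> xs \<in> fargs \<tau> f (univ M) \<Longrightarrow> fint N f xs = fint M f xs"
  unfolding substructure_def by metis

lemma univ_Union_struc [simp]: "univ (Union_struc \<tau> I M) = (\<Union>i\<in>I. univ (M i))"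
  by (simp add: Union_struc_def)

definition directed_family ::
  "('f, 'r) vocabulary \<Rightarrow> 'i set \<Rightarrow> ('i \<Rightarrow> ('u, 'f, 'r) struc) \<Rightarrow> bool" where
  "directed_family \<tau> I M \<longleftrightarrow> I \<noteq> {} \<and>
     (\<forall>i\<in>I. \<forall>j\<in>I. \<exists>k\<in>I. substructure \<tau> (M i) (M k) \<and> substructure \<tau> (M j) (M k))"

lemma directed_family_finite:
  assumes d: "directed_family \<tau> I M" and "finite A" "A \<subseteq> (\<Union>i\<in>I. univ (M i))"
  shows "\<exists>i\<in>I. A \<subseteq> univ (M i)"
  using assms(2,3)
proof (induction A rule: finite_induct)
  case empty
  then show ?case using d by (auto simp: directed_family_def)
next
  case (insert x A)
  then obtain i j where ij: "i \<in> I" "A \<subseteq> univ (M i)" "j \<in> I" "x \<in> univ (M j)" by auto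
  then obtain k where "k \<in> I" "substructure \<tau> (M i) (M k)" "substructure \<tau> (M j) (M k)"
    using d unfolding directed_family_def by blast
  then have "k \<in> I" "univ (M i) \<subseteq> univ (M k)" "univ (M j) \<subseteq> univ (M k)"
    using substructure_univ by blast+
  then show ?case using ij by (intro bexI[of _ k]) auto
qed

text \<open>Argument lists are finite, so directedness puts each inside a single member; all members
  containing it agree with \<open>X\<close> there, which makes the \<open>THE\<close> in the union
  well defined. Unions over different index sets are identified this way.\<close>

lemma Union_struc_unique:
  fixes M :: "'i \<Rightarrow> ('u, 'f, 'r) struc"
  assumes d: "directed_family \<tau> I M" and X: "structure_of \<tau> X"
    and u: "univ X = (\<Union>i\<in>I. univ (M i))"
    and s: "\<And>i. i \<in> I \<Longrightarrow> substructure \<tau> (M i) X"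
  shows "Union_struc \<tau> I M = X"
proof (rule struc.equality)
  show "univ (Union_struc \<tau> I M) = univ X" by (simp add: u)
  have f: "fint (M i) f xs = fint X f xs"
    if "i \<in> I" "f \<in> fsyms \<tau>" "length xs = farity \<tau> f" "set xs \<subseteq> univ (M i)" for i f xs
    using substructure_fint[OF s[OF that(1)] that(2), of xs] that by (simp add: fargs_def)
  have "fint (Union_struc \<tau> I M) f xs = fint X f xs" for f xs
  proof (cases "f \<in> fsyms \<tau> \<and> xs \<in> fargs \<tau> f (univ X)")
    case True
    then obtain i where i: "i \<in> I" "set xs \<subseteq> univ (M i)"
      using directed_family_finite[OF d, of "set xs"] by (auto simp: fargs_def u)
    have "(THE y. \<exists>i\<in>I. set xs \<subseteq> univ (M i) \<and> y = fint (M i) f xs) = fint X f xs"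
      using i f True by (intro the_equality) (auto simp: fargs_def)
    then show ?thesis using True by (simp add: Union_struc_def u)
  next
    case False
    then show ?thesis using X by (auto simp: Union_struc_def structure_of_def u)
  qed
  then show "fint (Union_struc \<tau> I M) = fint X" by blast
  have "rint (Union_struc \<tau> I M) R xs = rint X R xs" for R xs
  proof
    assume "rint (Union_struc \<tau> I M) R xs"
    then obtain i where i: "i \<in> I" "rint (M i) R xs" by (auto simp: Union_struc_def)
    then have "R \<in> rsyms \<tau> \<and> xs \<in> rargs \<tau> R (univ (M i))"
      using substructure_structure[OF s[OF i(1)]] structure_rint[OF _ i(2)] by blast
    then show "rint X R xs" using substructure_rint[OF s[OF i(1)]] i by blast
  next
    assume r: "rint X R xs"
    then have R: "R \<in> rsyms \<tau>" "xs \<in> rargs \<tau> R (univ X)" using structure_rint[OF X r] by auto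
    then obtain i where i: "i \<in> I" "set xs \<subseteq> univ (M i)"
      using directed_family_finite[OF d, of "set xs"] by (auto simp: rargs_def u)
    then have "rint (M i) R xs"
      using substructure_rint[OF s[OF i(1)] R(1), of xs] R r by (simp add: rargs_def)
    then show "rint (Union_struc \<tau> I M) R xs" using i by (auto simp: Union_struc_def)
  qed
  then show "rint (Union_struc \<tau> I M) = rint X" by blast
qed simp

lemma wellorder_finite_underS:
  assumes r: "Well_order r" and "A \<subseteq> Field r" "A \<noteq> {}"
    and lim: "\<And>j. j \<in> A \<Longrightarrow> \<exists>k\<in>A. (j, k) \<in> r \<and> j \<noteq> k"
    and "finite w" "w \<subseteq> A"
  shows "\<exists>k\<in>A. w \<subseteq> underS r k"
  using assms(5,6)
proof (induction w rule: finite_induct)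
  case empty
  then show ?case using assms(3) by auto
next
  case (insert x w)
  then obtain k where k: "k \<in> A" "w \<subseteq> underS r k" "x \<in> A" by auto
  have T: "trans r" "antisym r" "total_on (Field r) r" "refl_on (Field r) r"
    using r by (auto simp: well_order_on_def linear_order_on_def partial_order_on_def
        preorder_on_def)
  obtain m where m: "m \<in> A" "(k, m) \<in> r" "(x, m) \<in> r"
    using k T(3,4) assms(2) unfolding total_on_def refl_on_def by (metis subsetD)
  obtain l where l: "l \<in> A" "(m, l) \<in> r" "m \<noteq> l" using lim[OF m(1)] by auto
  have "y \<in> underS r l" if "(y, m) \<in> r" for y
    using that l T by (auto simp: underS_def dest: transD antisymD)
  moreover have "(y, m) \<in> r" if "y \<in> w" for y
    using that k m T(1) by (auto simp: underS_def dest: transD)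
  ultimately show ?case using l m by blast
qed

context aec
begin

text \<open>Induction on the cardinality of \<open>J\<close>. A finite \<open>J\<close> has a top
  structure \<open>G J\<close>. For infinite \<open>J\<close>, well-ordered in its least order type,
  the unions over the finite subsets of initial segments form a continuous chain with the same
  union, and each initial segment is smaller than \<open>J\<close>. The last conjunct, leastness,
  carries the induction: it makes the chain increasing. \<open>J\<close> lives on the element type
  because the chain axioms index chains there.\<close>

lemma finite_subset_union:
  fixes G :: "'u set \<Rightarrow> ('u, 'f, 'r) struc"
  assumes "\<And>u w. finite w \<Longrightarrow> w \<subseteq> J \<Longrightarrow> u \<subseteq> w \<Longrightarrow> prec (G u) (G w)"
    and "|\<Union>w\<in>Fpow J. univ (G w)| <o \<theta>"
  shows "Union_struc \<tau> (Fpow J) G \<in> K \<and> (\<forall>w\<in>Fpow J. prec (G w) (Union_struc \<tau> (Fpow J) G)) \<and>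
    (\<forall>P\<in>K. (\<forall>w\<in>Fpow J. prec (G w) P) \<longrightarrow> prec (Union_struc \<tau> (Fpow J) G) P)"
  using assms
proof (induction J rule: wf_induct_rule[OF wf_inv_image[OF wf_ordLess, of card_of]])
  case (1 J)
  note mono = 1(2) and small = 1(3)
  have dir: "directed_family \<tau> (Fpow J') G" if J': "J' \<subseteq> J" for J'
    unfolding directed_family_def
  proof (intro conjI ballI)
    fix u w assume "u \<in> Fpow J'" "w \<in> Fpow J'"
    then have "u \<union> w \<in> Fpow J'" "prec (G u) (G (u \<union> w))" "prec (G w) (G (u \<union> w))"
      using J' by (auto simp: Fpow_def intro!: mono)
    then show "\<exists>k\<in>Fpow J'. substructure \<tau> (G u) (G k) \<and> substructure \<tau> (G w) (G k)"
      using prec_substructure by blast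
  qed (auto simp: Fpow_def)
  show ?case
  proof (cases "finite J")
    case True
    have GJ: "prec (G w) (G J)" if "w \<in> Fpow J" for w
      using that True by (auto simp: Fpow_def intro!: mono)
    have GJK: "G J \<in> K" using mono[of J J] True prec_K[of "G J" "G J"] by simp
    have "Union_struc \<tau> (Fpow J) G = G J"
    proof (rule Union_struc_unique[OF dir])
      show "structure_of \<tau> (G J)" by (rule structures[OF GJK])
      have "J \<in> Fpow J" using True by (simp add: Fpow_def)
      then show "univ (G J) = (\<Union>i\<in>Fpow J. univ (G i))"
        using prec_univ[OF GJ] by blast
      show "substructure \<tau> (G i) (G J)" if "i \<in> Fpow J" for i
        using GJ[OF that] prec_substructure by blast
    qed simp
    then show ?thesis using GJ True GJK by (simp add: Fpow_def)
  next
    case False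
    define M where "M i = Union_struc \<tau> (Fpow (underS |J| i)) G" for i
    have W: "Well_order |J|" by (rule card_of_Well_order)
    have T: "trans |J|" "antisym |J|"
      using W by (auto simp: well_order_on_def linear_order_on_def partial_order_on_def
          preorder_on_def)
    \<comment> \<open>An infinite cardinal is a limit ordinal, so every finite subset of
      \<open>J\<close> lies in a proper initial segment and the chain exhausts the system.\<close>
    have lim: "\<exists>k\<in>J. (j, k) \<in> |J| \<and> j \<noteq> k" if "j \<in> J" for j
      using infinite_Card_order_limit[OF card_of_Card_order, of J j] that False
      by (auto simp: Field_card_of)
    have sub: "underS |J| i \<subseteq> J" for i
      by (auto simp: underS_def dest: FieldI1 simp: Field_card_of)
    have IH: "M i \<in> K" "w \<in> Fpow (underS |J| i) \<Longrightarrow> prec (G w) (M i)"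
      "P \<in> K \<Longrightarrow> (\<And>w. w \<in> Fpow (underS |J| i) \<Longrightarrow> prec (G w) P) \<Longrightarrow> prec (M i) P"
      if i: "i \<in> J" for i w P
    proof -
      have "|underS |J| i| <o |J|"
        using card_of_underS[OF card_of_Card_order, of i J] i by (simp add: Field_card_of)
      moreover have "|\<Union>w\<in>Fpow (underS |J| i). univ (G w)| <o \<theta>"
        using sub[of i] by (intro ordLeq_ordLess_trans[OF card_of_mono1 small])
          (auto simp: Fpow_def)
      moreover have "prec (G u) (G w)" if "finite w" "w \<subseteq> underS |J| i" "u \<subseteq> w" for u w
        using that sub[of i] by (intro mono) auto
      ultimately have *: "M i \<in> K \<and> (\<forall>w\<in>Fpow (underS |J| i). prec (G w) (M i)) \<and>
          (\<forall>P\<in>K. (\<forall>w\<in>Fpow (underS |J| i). prec (G w) P) \<longrightarrow> prec (M i) P)"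
        unfolding M_def using "1.IH"[of "underS |J| i"] by (simp add: in_inv_image)
      show "M i \<in> K" "w \<in> Fpow (underS |J| i) \<Longrightarrow> prec (G w) (M i)"
        "P \<in> K \<Longrightarrow> (\<And>w. w \<in> Fpow (underS |J| i) \<Longrightarrow> prec (G w) P) \<Longrightarrow> prec (M i) P"
        using * by blast+
    qed
    \<comment> \<open>\<open>M j\<close> is an upper bound of all structures whose union is
      \<open>M i\<close>; leastness from the induction hypothesis puts \<open>M i\<close> strongly
      below it.\<close>
    have inc: "prec (M i) (M j)" if ij: "(i, j) \<in> |J|" for i j
    proof -
      have J: "i \<in> J" "j \<in> J" using ij by (auto dest: FieldI1 FieldI2 simp: Field_card_of)
      have "underS |J| i \<subseteq> underS |J| j"
        using ij T by (auto simp: underS_def dest: transD antisymD)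
      then have "prec (G w) (M j)" if "w \<in> Fpow (underS |J| i)" for w
        using that IH(2)[OF J(2)] by (auto simp: Fpow_def)
      then show ?thesis using IH(3)[OF J(1) IH(1)[OF J(2)]] by blast
    qed
    have cover: "w \<in> Fpow A \<Longrightarrow> \<exists>k\<in>A. w \<in> Fpow (underS |J| k)"
      if "A \<subseteq> J" "A \<noteq> {}" "\<And>j. j \<in> A \<Longrightarrow> \<exists>k\<in>A. (j, k) \<in> |J| \<and> j \<noteq> k" for A w
      using wellorder_finite_underS[OF W, of A w] that by (auto simp: Fpow_def Field_card_of)
    have dirM: "directed_family \<tau> A M" if A: "A \<subseteq> J" "A \<noteq> {}" for A
      unfolding directed_family_def
    proof (intro conjI ballI A)
      fix i j assume ij: "i \<in> A" "j \<in> A"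
      have "(i, j) \<in> |J| \<or> (j, i) \<in> |J|"
        using W ij A(1) card_of_refl unfolding well_order_on_def linear_order_on_def total_on_def
          partial_order_on_def preorder_on_def refl_on_def Field_card_of by (metis subsetD)
      then have "prec (M i) (M j) \<or> prec (M j) (M i)" using inc by blast
      moreover have "prec (M i) (M i)" "prec (M j) (M j)" using ij A IH(1) prec_refl by auto
      ultimately show "\<exists>k\<in>A. substructure \<tau> (M i) (M k) \<and> substructure \<tau> (M j) (M k)"
        using ij prec_substructure by blast
    qed
    have chain: "continuous_chain \<tau> prec |J| M"
      unfolding continuous_chain_def
    proof (intro conjI ballI impI)
      show "Well_order |J|" by (rule W)
      show "Field |J| \<noteq> {}" using False by (auto simp: Field_card_of)
      show "case ij of (i, j) \<Rightarrow> prec (M i) (M j)" if "ij \<in> |J|" for ij using that inc by auto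
      fix i assume "i \<in> Field |J|"
      then have i: "i \<in> J" by (simp add: Field_card_of)
      let ?A = "underS |J| i"
      assume l: "?A \<noteq> {} \<and> (\<forall>j\<in>?A. \<exists>k\<in>?A. (j, k) \<in> |J| \<and> j \<noteq> k)"
      have lt: "prec (M k) (M i)" if "k \<in> ?A" for k using that by (auto simp: underS_def intro: inc)
      show "M i = Union_struc \<tau> ?A M"
      proof (rule Union_struc_unique[symmetric])
        show "directed_family \<tau> ?A M" using dirM[OF sub] l by blast
        show "structure_of \<tau> (M i)" using IH(1)[OF i] structures by blast
        show "substructure \<tau> (M k) (M i)" if "k \<in> ?A" for k using lt[OF that] prec_substructure by blast
        \<comment> \<open>Continuity: at a limit \<open>i\<close>, a finite set of predecessors of
          \<open>i\<close> already lies below some \<open>k\<close> before \<open>i\<close>.\<close>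
        show "univ (M i) = (\<Union>k\<in>?A. univ (M k))"
        proof
          show "univ (M i) \<subseteq> (\<Union>k\<in>?A. univ (M k))"
          proof
            fix x assume "x \<in> univ (M i)"
            then obtain w where w: "w \<in> Fpow ?A" "x \<in> univ (G w)" by (auto simp: M_def)
            obtain k where "k \<in> ?A" "w \<in> Fpow (underS |J| k)" using cover[OF sub _ _ w(1)] l by blast
            then show "x \<in> (\<Union>k\<in>?A. univ (M k))" using w(2) by (auto simp: M_def)
          qed
          show "(\<Union>k\<in>?A. univ (M k)) \<subseteq> univ (M i)" using lt prec_univ by blast
        qed
      qed
    qed
    have ne: "J \<noteq> {}" using False by auto
    have eq: "(\<Union>i\<in>J. univ (M i)) = (\<Union>w\<in>Fpow J. univ (G w))"
    proof
      show "(\<Union>i\<in>J. univ (M i)) \<subseteq> (\<Union>w\<in>Fpow J. univ (G w))"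
        using Fpow_mono[OF sub] by (auto simp: M_def)
      show "(\<Union>w\<in>Fpow J. univ (G w)) \<subseteq> (\<Union>i\<in>J. univ (M i))"
      proof (rule UN_least)
        fix w assume "w \<in> Fpow J"
        then obtain k where "k \<in> J" "w \<in> Fpow (underS |J| k)" using cover[of J w] ne lim by auto
        then show "univ (G w) \<subseteq> (\<Union>i\<in>J. univ (M i))" by (auto simp: M_def)
      qed
    qed
    have sm: "|\<Union>i\<in>Field |J|. univ (M i)| <o \<theta>" using small by (simp add: Field_card_of eq)
    let ?U = "Union_struc \<tau> J M"
    have U: "?U \<in> K" "\<And>i. i \<in> J \<Longrightarrow> prec (M i) ?U"
      using chain_Union[OF chain sm] chain_upper[OF chain sm] by (auto simp: Field_card_of)
    have GU: "prec (G w) ?U" if w: "w \<in> Fpow J" for w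
    proof -
      obtain k where "k \<in> J" "w \<in> Fpow (underS |J| k)" using cover[of J w] ne lim w by auto
      then show ?thesis using U(2) IH(2) prec_trans by blast
    qed
    have FU: "Union_struc \<tau> (Fpow J) G = ?U"
      using U(1) structures GU prec_substructure eq by (intro Union_struc_unique[OF dir]) auto
    show ?thesis
      unfolding FU
    proof (intro conjI ballI impI U(1) GU)
      fix P assume P: "P \<in> K" "\<forall>w\<in>Fpow J. prec (G w) P"
      have "prec (M i) P" if "i \<in> J" for i
      proof (rule IH(3)[OF that P(1)])
        fix w assume "w \<in> Fpow (underS |J| i)"
        then have "w \<in> Fpow J" using sub[of i] by (auto simp: Fpow_def)
        then show "prec (G w) P" using P(2) by blast
      qed
      then show "prec ?U P" using chain_least[OF chain P(1)] by (simp add: Field_card_of)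
    qed
  qed
qed

text \<open>\<open>D\<close> need not be well-ordered or indexed by elements. Instead each element
  \<open>x\<close> of the union picks a member \<open>d x\<close> containing it, and a finite set of
  elements gets the largest of the members picked. This system is indexed by finite sets of
  elements, so \<open>finite_subset_union\<close> applies.\<close>

lemma linear_union:
  assumes ne: "D \<noteq> {}" and lin: "\<And>A B. A \<in> D \<Longrightarrow> B \<in> D \<Longrightarrow> prec A B \<or> prec B A"
    and small: "|\<Union>(univ ` D)| <o \<theta>"
  shows "\<exists>U\<in>K. univ U = \<Union>(univ ` D) \<and> (\<forall>A\<in>D. prec A U)"
proof -
  obtain A\<^sub>0 where A0: "A\<^sub>0 \<in> D" using ne by auto
  define J where "J = \<Union>(univ ` D)"
  have DK: "A \<in> K" if "A \<in> D" for A using lin[OF that that] prec_K[of A A] by blast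
  have "\<exists>A\<in>D. prec A\<^sub>0 A \<and> x \<in> univ A" if x: "x \<in> J" for x
  proof -
    obtain B where B: "B \<in> D" "x \<in> univ B" using x unfolding J_def by blast
    then consider "prec A\<^sub>0 B" | "prec B A\<^sub>0" using lin A0 by blast
    then show ?thesis
    proof cases
      case 2
      then show ?thesis using A0 B(2) prec_refl[OF DK[OF A0]] prec_univ[OF 2] by blast
    qed (use B in blast)
  qed
  then obtain d where d: "\<And>x. x \<in> J \<Longrightarrow> d x \<in> D \<and> prec A\<^sub>0 (d x) \<and> x \<in> univ (d x)" by metis
  have top: "\<exists>B\<in>insert A\<^sub>0 (d ` w). \<forall>C\<in>insert A\<^sub>0 (d ` w). prec C B" if "finite w" "w \<subseteq> J" for w
    using that
  proof (induction w rule: finite_induct)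
    case empty
    then show ?case using prec_refl[OF DK[OF A0]] by simp
  next
    case (insert x w)
    then obtain B where B: "B \<in> insert A\<^sub>0 (d ` w)" "\<forall>C\<in>insert A\<^sub>0 (d ` w). prec C B" by auto
    have BD: "B \<in> D" "d x \<in> D" using B d A0 insert by auto
    then consider "prec B (d x)" | "prec (d x) B" using lin by blast
    then show ?case
    proof cases
      case 1
      have "prec C (d x)" if C: "C \<in> insert A\<^sub>0 (d ` insert x w)" for C
      proof (cases "C = d x")
        case False
        then have "prec C B" using C B(2) by blast
        then show ?thesis using 1 prec_trans by metis
      qed (use prec_refl[OF DK[OF BD(2)]] in simp)
      then show ?thesis by blast
    next
      case 2
      then have "prec C B" if "C \<in> insert A\<^sub>0 (d ` insert x w)" for C
        using that B(2) by blast
      then show ?thesis using B(1) by blast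
    qed
  qed
  define G where "G w = (SOME B. B \<in> insert A\<^sub>0 (d ` w) \<and> (\<forall>C\<in>insert A\<^sub>0 (d ` w). prec C B))" for w
  have G: "G w \<in> insert A\<^sub>0 (d ` w)" "\<And>C. C \<in> insert A\<^sub>0 (d ` w) \<Longrightarrow> prec C (G w)"
    if "finite w" "w \<subseteq> J" for w
    using someI_ex[of "\<lambda>B. B \<in> insert A\<^sub>0 (d ` w) \<and> (\<forall>C\<in>insert A\<^sub>0 (d ` w). prec C B)"] top[OF that]
    unfolding G_def by blast+
  have GD: "G w \<in> D" if "finite w" "w \<subseteq> J" for w using G(1)[OF that] A0 d that(2) by auto
  have mono: "prec (G u) (G w)" if "finite w" "w \<subseteq> J" "u \<subseteq> w" for u w
    using G(1)[of u] G(2)[OF that(1,2)] that finite_subset[OF that(3,1)] by auto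
  have eq: "(\<Union>w\<in>Fpow J. univ (G w)) = J"
  proof
    show "(\<Union>w\<in>Fpow J. univ (G w)) \<subseteq> J"
      using GD by (force simp: Fpow_def J_def)
    show "J \<subseteq> (\<Union>w\<in>Fpow J. univ (G w))"
    proof
      fix x assume x: "x \<in> J"
      have "prec (d x) (G {x})" using x by (intro G(2)) auto
      then have "x \<in> univ (G {x})" using d[OF x] prec_univ by blast
      then show "x \<in> (\<Union>w\<in>Fpow J. univ (G w))" using x by (auto simp: Fpow_def)
    qed
  qed
  define U where "U = Union_struc \<tau> (Fpow J) G"
  have U: "U \<in> K" "\<And>w. w \<in> Fpow J \<Longrightarrow> prec (G w) U"
    "\<And>P. P \<in> K \<Longrightarrow> (\<And>w. w \<in> Fpow J \<Longrightarrow> prec (G w) P) \<Longrightarrow> prec U P"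
    using finite_subset_union[of J G] mono small[folded J_def] unfolding U_def eq by blast+
  have uU: "univ U = J" by (simp add: U_def eq)
  have "prec A U" if A: "A \<in> D" for A
  \<comment> \<open>A member above the whole system can only be the union itself: leastness gives
    \<open>prec U A\<close>, and the universes coincide.\<close>
  proof (cases "\<exists>w\<in>Fpow J. prec A (G w)")
    case True
    then obtain w where "w \<in> Fpow J" "prec A (G w)" by blast
    then show ?thesis using U(2)[of w] prec_trans[of A "G w" U] by simp
  next
    case False
    have "prec (G w) A" if "w \<in> Fpow J" for w
      using that lin[OF A GD[of w]] False by (auto simp: Fpow_def)
    then have "prec U A" using U(3)[OF DK[OF A]] by blast
    moreover have "univ A \<subseteq> univ U" using A by (auto simp: J_def uU)
    ultimately have "U = A" using prec_eq[of U A] prec_univ[of U A] by (metis subset_antisym)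
    then show ?thesis using prec_refl[OF U(1)] by simp
  qed
  then show ?thesis using U(1) uU unfolding J_def by blast
qed

end

section \<open>Amalgamation and Galois types\<close>

lemma infinite_ordLeq_Diff:
  assumes "infinite B" "|A| <o |B|"
  shows "|B| \<le>o |B - A|"
proof (rule ccontr)
  assume "\<not> |B| \<le>o |B - A|"
  then have "|B - A| <o |B|" by (simp add: card_of_Well_order flip: not_ordLeq_iff_ordLess)
  then have "|A \<union> (B - A)| <o |B|" using card_of_Un_ordLess_infinite[OF assms(1,2)] by blast
  moreover have "|B| \<le>o |A \<union> (B - A)|" by (rule card_of_mono1) auto
  ultimately show False using not_ordLess_ordLeq by blast
qed

text \<open>The renaming device used throughout: the map is prescribed on the old part
  \<open>A\<close>, and the new elements go into a reserved set \<open>V\<close>.\<close>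

lemma inj_on_extend:
  assumes "A \<subseteq> B" "inj_on g A" "|B - A| \<le>o |V|" "V \<inter> g ` A = {}"
  shows "\<exists>k. inj_on k B \<and> (\<forall>x\<in>A. k x = g x) \<and> k ` (B - A) \<subseteq> V"
proof -
  obtain f where f: "inj_on f (B - A)" "f ` (B - A) \<subseteq> V"
    using assms(3) card_of_ordLeq[of "B - A" V] by blast
  let ?k = "\<lambda>x. if x \<in> A then g x else f x"
  have "inj_on ?k B"
  proof (rule inj_onI)
    fix x y assume xy: "x \<in> B" "y \<in> B" "?k x = ?k y"
    have *: "f z \<noteq> g z'" if "z \<in> B - A" "z' \<in> A" for z z'
      using that f(2) assms(4) by blast
    show "x = y"
    proof (cases "x \<in> A"; cases "y \<in> A")
      assume "x \<in> A" "y \<in> A"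
      then show ?thesis using xy inj_onD[OF assms(2)] by simp
    next
      assume "x \<notin> A" "y \<notin> A"
      then show ?thesis using xy inj_onD[OF f(1)] by simp
    qed (use xy *[of x y] *[of y x] in auto)
  qed
  moreover have "\<forall>x\<in>A. ?k x = g x" by simp
  moreover have "?k ` (B - A) \<subseteq> V" using f(2) by (simp add: image_subset_iff)
  ultimately show ?thesis by blast
qed

lemma csum_ordLess:
  assumes "Cinfinite k" "Card_order r" "Card_order s" "r <o k" "s <o k"
  shows "r +c s <o k"
proof -
  have "|Field r| <o k" "|Field s| <o k"
    using assms card_of_Field_ordIso ordIso_ordLess_trans by blast+
  then have "|Field r <+> Field s| <o k"
    using assms(1) card_of_Plus_ordLess_infinite_Field[of k] unfolding cinfinite_def by blast
  then show ?thesis by (simp add: csum_def)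
qed

text \<open>\<open>sim N a M b P\<close> says that \<open>a \<in> M\<close> and \<open>b \<in> P\<close> realize the same Galois type over \<open>N\<close>. Unlike in
  \<open>gtp\<close>, the amalgam need not contain \<open>N\<close> as a subset, which is what survives in a universe
  where there may be no room for moving the amalgam.\<close>

definition (in aec) sim ::
  "('u, 'f, 'r) struc \<Rightarrow> 'u \<Rightarrow> ('u, 'f, 'r) struc \<Rightarrow> 'u \<Rightarrow> ('u, 'f, 'r) struc \<Rightarrow> bool" where
  "sim N a M b P \<longleftrightarrow> (\<exists>C h h'. kemb h M C \<and> kemb h' P C \<and>
     (\<forall>x\<in>univ N. h x = h' x) \<and> h a = h' b)"

text \<open>Saturation with \<open>sim\<close> in place of equality of Galois types. Restricting
  \<open>P\<close> to size below \<open>\<kappa>\<close> loses nothing, by Loewenheim--Skolem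
  (\<open>rich_imp_saturated\<close>), and it bounds the number of tasks in
  \<open>exists_rich\<close>.\<close>

definition (in aec) rich :: "'k rel \<Rightarrow> ('u, 'f, 'r) struc \<Rightarrow> bool" where
  "rich \<kappa> M \<longleftrightarrow> (\<forall>N P a. prec N M \<and> prec N P \<and> |univ P| <o \<kappa> \<and> a \<in> univ P \<longrightarrow>
     (\<exists>b\<in>univ M. sim N b M a P))"

context aec
begin

lemma sim_sym: "sim N a M b P \<Longrightarrow> sim N b P a M"
  unfolding sim_def by metis

lemma sim_kemb: "kemb h M P \<Longrightarrow> (\<And>x. x \<in> univ N \<Longrightarrow> h x = x) \<Longrightarrow> sim N a M (h a) P"
  unfolding sim_def using kemb_id[OF prec_refl[of P]] kemb_K[of h M P]
  by (intro exI[of _ P] exI[of _ h] exI[of _ id]) auto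

lemma sim_prec: "prec M P \<Longrightarrow> sim N a M a P"
  using sim_kemb[OF kemb_id, of M P N a] by simp

end

locale aec_ap = aec \<tau> K prec \<theta>
  for \<tau> :: "('f, 'r) vocabulary"
    and K :: "('u, 'f, 'r) struc set"
    and prec :: "('u, 'f, 'r) struc \<Rightarrow> ('u, 'f, 'r) struc \<Rightarrow> bool"
    and \<theta> :: "'t rel" +
  assumes ap: "amalgamation_property \<tau> K prec"
begin

text \<open>The amalgamation axiom speaks of a literal common submodel. Here
  \<open>M\<^sub>2\<close> is renamed so that its copy of \<open>M\<^sub>0\<close> becomes the copy
  inside \<open>M\<^sub>1\<close>; \<open>room\<close> provides places for its remaining
  elements.\<close>

lemma amalgam_emb_aux:
  assumes f: "kemb f M\<^sub>0 M\<^sub>1" and g: "kemb g M\<^sub>0 M\<^sub>2"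
    and room: "|- (g ` univ M\<^sub>0)| \<le>o |- (f ` univ M\<^sub>0)|"
  shows "\<exists>N h\<^sub>1 h\<^sub>2. kemb h\<^sub>1 M\<^sub>1 N \<and> kemb h\<^sub>2 M\<^sub>2 N \<and> (\<forall>x\<in>univ M\<^sub>0. h\<^sub>1 (f x) = h\<^sub>2 (g x))"
proof -
  let ?A = "univ M\<^sub>0"
  have inj: "inj_on f ?A" "inj_on g ?A" using kemb_inj f g by auto
  have K: "M\<^sub>0 \<in> K" "M\<^sub>1 \<in> K" "M\<^sub>2 \<in> K" using kemb_K f g by auto
  have sub: "g ` ?A \<subseteq> univ M\<^sub>2" using kemb_into[OF g] by auto
  let ?k0 = "f \<circ> inv_into ?A g"
  have k0: "?k0 (g x) = f x" if "x \<in> ?A" for x using that inj(2) by simp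
  have "inj_on ?k0 (g ` ?A)"
    using inj by (auto simp: inj_on_def)
  moreover have "|univ M\<^sub>2 - g ` ?A| \<le>o |- (f ` ?A)|"
    by (rule ordLeq_transitive[OF card_of_mono1 room]) auto
  moreover have "- (f ` ?A) \<inter> ?k0 ` g ` ?A = {}" using k0 by auto
  ultimately obtain k where k: "inj_on k (univ M\<^sub>2)" "\<forall>x\<in>g ` ?A. k x = ?k0 x"
    using inj_on_extend[OF sub, of ?k0 "- (f ` ?A)"] by blast
  have kg: "k (g x) = f x" if "x \<in> ?A" for x using k(2) that k0 by simp
  have "prec (img \<tau> f M\<^sub>0) (img \<tau> k M\<^sub>2)"
  proof -
    have "img \<tau> f M\<^sub>0 = img \<tau> (k \<circ> g) M\<^sub>0"
      by (rule img_cong[symmetric, OF structures[OF K(1)] inj(1)]) (simp add: kg)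
    also have "\<dots> = img \<tau> k (img \<tau> g M\<^sub>0)"
      using inj_on_subset[OF k(1) sub] by (intro img_comp[OF iso_imgK[OF K(1) inj(2)]]) simp
    finally show ?thesis using prec_img[OF kemb_prec_img[OF g] k(1)] by simp
  qed
  then obtain N h\<^sub>1 h\<^sub>2 where N: "kemb h\<^sub>1 M\<^sub>1 N" "kemb h\<^sub>2 (img \<tau> k M\<^sub>2) N"
    "\<forall>x\<in>univ (img \<tau> f M\<^sub>0). h\<^sub>1 x = h\<^sub>2 x"
    using ap kemb_prec_img[OF f] unfolding amalgamation_property_def by blast
  have "kemb (h\<^sub>2 \<circ> k) M\<^sub>2 N" using kemb_comp[OF kemb_img[OF K(3) k(1)] N(2)] .
  moreover have "\<forall>x\<in>?A. h\<^sub>1 (f x) = (h\<^sub>2 \<circ> k) (g x)" using N(3) kg by simp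
  ultimately show ?thesis using N(1) by blast
qed

text \<open>Either the first or the second extension can be moved onto the other copy of \<open>M\<^sub>0\<close>, depending on
  which copy has the larger complement in the universe.\<close>

lemma amalgam_emb:
  assumes f: "kemb f M\<^sub>0 M\<^sub>1" and g: "kemb g M\<^sub>0 M\<^sub>2"
  shows "\<exists>N h\<^sub>1 h\<^sub>2. kemb h\<^sub>1 M\<^sub>1 N \<and> kemb h\<^sub>2 M\<^sub>2 N \<and> (\<forall>x\<in>univ M\<^sub>0. h\<^sub>1 (f x) = h\<^sub>2 (g x))"
proof -
  have "|- (g ` univ M\<^sub>0)| \<le>o |- (f ` univ M\<^sub>0)| \<or> |- (f ` univ M\<^sub>0)| \<le>o |- (g ` univ M\<^sub>0)|"
    by (rule ordLeq_total) (auto simp: card_of_Well_order)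
  then show ?thesis
    using amalgam_emb_aux[OF f g] amalgam_emb_aux[OF g f] by metis
qed

text \<open>Both witnessing amalgams receive \<open>P\<close>, so they are amalgamated over
  \<open>P\<close>. The result identifies the two images of \<open>P\<close>, which contains
  \<open>N\<close> and \<open>b\<close>.\<close>

lemma sim_trans:
  assumes 1: "sim N a M b P" and 2: "sim N b P c Q" and N: "univ N \<subseteq> univ P" and b: "b \<in> univ P"
  shows "sim N a M c Q"
proof -
  obtain C h h' where C: "kemb h M C" "kemb h' P C" "\<forall>x\<in>univ N. h x = h' x" "h a = h' b"
    using 1 unfolding sim_def by blast
  obtain D k k' where D: "kemb k P D" "kemb k' Q D" "\<forall>x\<in>univ N. k x = k' x" "k b = k' c"
    using 2 unfolding sim_def by blast
  obtain E i j where E: "kemb i C E" "kemb j D E" "\<forall>x\<in>univ P. i (h' x) = j (k x)"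
    using amalgam_emb[OF C(2) D(1)] by blast
  have "(i \<circ> h) x = (j \<circ> k') x" if "x \<in> univ N" for x
    using that N C(3) D(3) E(3) by auto
  moreover have "(i \<circ> h) a = (j \<circ> k') c" using C(4) D(4) E(3) b by simp
  moreover have "kemb (i \<circ> h) M E" "kemb (j \<circ> k') Q E" using kemb_comp[OF C(1) E(1)] kemb_comp[OF D(2) E(2)] by auto
  ultimately show ?thesis unfolding sim_def by blast
qed

text \<open>In \<open>gtp\<close> the embeddings fix \<open>N\<close>. As \<open>N\<close> is
  smaller than the type, its complement has full size, and the amalgam can be renamed so that the
  copy of \<open>N\<close> returns to \<open>N\<close> while everything else goes to the
  complement.\<close>

lemma gtp_iff_sim:
  assumes inf: "infinite (UNIV :: 'u set)" and N: "|univ N| <o |UNIV :: 'u set|"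
    and NM: "prec N M" and a: "a \<in> univ M"
  shows "(b, P) \<in> gtp \<tau> K prec a N M \<longleftrightarrow> prec N P \<and> b \<in> univ P \<and> sim N a M b P"
proof
  assume "(b, P) \<in> gtp \<tau> K prec a N M"
  then show "prec N P \<and> b \<in> univ P \<and> sim N a M b P"
    unfolding gtp_def sim_def by fastforce
next
  assume asm: "prec N P \<and> b \<in> univ P \<and> sim N a M b P"
  then obtain C h h' where C: "kemb h M C" "kemb h' P C" "\<forall>x\<in>univ N. h x = h' x" "h a = h' b"
    unfolding sim_def by blast
  let ?A = "univ N"
  have hN: "inj_on h ?A" using inj_on_subset[OF kemb_inj[OF C(1)] prec_univ[OF NM]] .
  have sub: "h ` ?A \<subseteq> univ C" using kemb_into[OF C(1)] prec_univ[OF NM] by auto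
  have "|univ C - h ` ?A| \<le>o |UNIV :: 'u set|" by (rule card_of_mono1) auto
  then have "|univ C - h ` ?A| \<le>o |UNIV - ?A|"
    using infinite_ordLeq_Diff[OF inf N] ordLeq_transitive by blast
  moreover have "inj_on (inv_into ?A h) (h ` ?A)" by (simp add: inj_on_inv_into)
  moreover have "(UNIV - ?A) \<inter> inv_into ?A h ` h ` ?A = {}" using hN by auto
  ultimately obtain k where k: "inj_on k (univ C)" "\<forall>x\<in>h ` ?A. k x = inv_into ?A h x"
    using inj_on_extend[OF sub, of "inv_into ?A h" "UNIV - ?A"] by blast
  have kh: "k (h x) = x" if "x \<in> ?A" for x using k(2) hN that by simp
  have CK: "C \<in> K" using kemb_K[OF C(1)] by simp
  have kC: "kemb k C (img \<tau> k C)" using kemb_img[OF CK k(1)] .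
  have "kemb (k \<circ> h) M (img \<tau> k C)" "kemb (k \<circ> h') P (img \<tau> k C)"
    using kemb_comp[OF C(1) kC] kemb_comp[OF C(2) kC] by auto
  moreover have "\<forall>x\<in>?A. (k \<circ> h) x = x \<and> (k \<circ> h') x = x" using kh C(3) by auto
  moreover have "(k \<circ> h) a = (k \<circ> h') b" using C(4) by simp
  moreover have "img \<tau> k C \<in> K" using img_K[OF CK k(1)] .
  ultimately show "(b, P) \<in> gtp \<tau> K prec a N M"
    unfolding gtp_def using asm by blast
qed

lemma gtp_eq_iff_sim:
  assumes inf: "infinite (UNIV :: 'u set)" and N: "|univ N| <o |UNIV :: 'u set|"
    and M: "prec N M" "a \<in> univ M" and P: "prec N P" "b \<in> univ P"
  shows "gtp \<tau> K prec a N M = gtp \<tau> K prec b N P \<longleftrightarrow> sim N a M b P"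
proof
  assume eq: "gtp \<tau> K prec a N M = gtp \<tau> K prec b N P"
  have "prec P P" using prec_refl prec_K[OF P(1)] by blast
  then have "(b, P) \<in> gtp \<tau> K prec b N P"
    using gtp_iff_sim[OF inf N P] P sim_prec by blast
  then show "sim N a M b P" using eq gtp_iff_sim[OF inf N M] by blast
next
  assume s: "sim N a M b P"
  have "(c, Q) \<in> gtp \<tau> K prec a N M \<longleftrightarrow> (c, Q) \<in> gtp \<tau> K prec b N P" for c Q
    using gtp_iff_sim[OF inf N M] gtp_iff_sim[OF inf N P] s sim_sym[OF s]
      sim_trans[OF sim_sym[OF s] _ prec_univ[OF M(1)] M(2), of c Q]
      sim_trans[OF s _ prec_univ[OF P(1)] P(2), of c Q] by blast
  then show "gtp \<tau> K prec a N M = gtp \<tau> K prec b N P" by auto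
qed

lemma sim_mono:
  assumes "sim N b M a P" "prec M M'" "univ N \<subseteq> univ M" "b \<in> univ M"
  shows "sim N b M' a P"
  using sim_trans[OF sim_sym[OF sim_prec[OF assms(2)]] assms(1,3,4)] .

text \<open>A task \<open>(N, P, a)\<close> for \<open>M\<close> is carried to \<open>M'\<close>.
  The isomorphism gives no copy of \<open>P\<close>, which need not lie in \<open>M\<close>, so
  \<open>g\<close> restricted to \<open>N\<close> is extended to an injection \<open>k\<close> of
  \<open>P\<close>, with room outside the image of \<open>N\<close>.\<close>

lemma rich_iso:
  assumes inf: "infinite (UNIV :: 'u set)" and \<kappa>: "\<kappa> \<le>o |UNIV :: 'u set|"
    and g: "is_iso \<tau> g M M'" and MK: "M \<in> K" and r: "rich \<kappa> M'"
  shows "rich \<kappa> M"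
  unfolding rich_def
proof (intro allI impI, elim conjE)
  fix N P a assume N: "prec N M" "prec N P" and P: "|univ P| <o \<kappa>" and a: "a \<in> univ P"
  let ?A = "univ N"
  have gi: "inj_on g (univ M)" "univ M' = g ` univ M" "M' = img \<tau> g M"
    using iso_inj[OF g] iso_univ[OF g] iso_eq_img[OF g] by auto
  have gA: "inj_on g ?A" using inj_on_subset[OF gi(1) prec_univ[OF N(1)]] .
  have "|univ P| <o |UNIV :: 'u set|" using P \<kappa> ordLess_ordLeq_trans by blast
  moreover have "|g ` ?A| \<le>o |univ P|"
    using card_of_image card_of_mono1[OF prec_univ[OF N(2)]] ordLeq_transitive by blast
  ultimately have "|g ` ?A| <o |UNIV :: 'u set|" using ordLeq_ordLess_trans by blast
  moreover have "|univ P - ?A| \<le>o |UNIV :: 'u set|" by (rule card_of_mono1) auto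
  ultimately have "|univ P - ?A| \<le>o |UNIV - g ` ?A|"
    using infinite_ordLeq_Diff[OF inf] ordLeq_transitive by blast
  then obtain k where k: "inj_on k (univ P)" "\<forall>x\<in>?A. k x = g x"
    using inj_on_extend[OF prec_univ[OF N(2)] gA, of "UNIV - g ` ?A"] by blast
  have K: "N \<in> K" "P \<in> K" using prec_K[OF N(2)] by auto
  have "img \<tau> k N = img \<tau> g N"
    using k(2) by (intro img_cong[OF structures[OF K(1)] gA]) auto
  then have "prec (img \<tau> g N) M'" "prec (img \<tau> g N) (img \<tau> k P)"
    using prec_img[OF N(1) gi(1)] prec_img[OF N(2) k(1)] gi(3) by auto
  moreover have "|univ (img \<tau> k P)| <o \<kappa>"
    using card_of_image[of k "univ P"] P ordLeq_ordLess_trans by auto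
  moreover have "k a \<in> univ (img \<tau> k P)" using a by simp
  ultimately obtain b' where b': "b' \<in> univ M'" "sim (img \<tau> g N) b' M' (k a) (img \<tau> k P)"
    using r unfolding rich_def by blast
  obtain b where b: "b \<in> univ M" "b' = g b" using b'(1) gi(2) by auto
  obtain C h h' where C: "kemb h M' C" "kemb h' (img \<tau> k P) C"
    "\<forall>x\<in>univ (img \<tau> g N). h x = h' x" "h b' = h' (k a)"
    using b'(2) unfolding sim_def by blast
  have "kemb (h \<circ> g) M C" "kemb (h' \<circ> k) P C"
    using kemb_comp[OF kemb_iso[OF g MK] C(1)] kemb_comp[OF kemb_img[OF K(2) k(1)] C(2)] by auto
  moreover have "\<forall>x\<in>?A. (h \<circ> g) x = (h' \<circ> k) x" using C(3) k(2) by auto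
  moreover have "(h \<circ> g) b = (h' \<circ> k) a" using C(4) b(2) by simp
  ultimately have "sim N b M a P" unfolding sim_def by blast
  then show "\<exists>b\<in>univ M. sim N b M a P" using b(1) by blast
qed

text \<open>The type is given in some \<open>P\<close> of unknown size. Loewenheim--Skolem cuts
  \<open>P\<close> down to \<open>Q\<close> around \<open>N\<close> and \<open>a\<close>, of size
  below \<open>\<kappa>\<close> because \<open>LS <o \<kappa>\<close>, and \<open>rich\<close>
  applies to \<open>Q\<close>.\<close>

lemma rich_imp_saturated:
  assumes inf: "infinite (UNIV :: 'u set)" and \<kappa>: "Card_order \<kappa>" "\<kappa> \<le>o |UNIV :: 'u set|"
    and LS: "LS_property \<tau> K prec LS" "LS <o \<kappa>" and r: "rich \<kappa> M"
  shows "saturated \<tau> K prec \<kappa> M"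
  unfolding saturated_def
proof (intro allI impI ballI, elim conjE)
  fix N p assume N: "prec N M" "|univ N| <o \<kappa>" and "p \<in> gtypes \<tau> K prec N"
  then obtain a P where P: "p = gtp \<tau> K prec a N P" "prec N P" "a \<in> univ P"
    unfolding gtypes_def by blast
  have LSi: "Cinfinite LS"
    using LS(1) natLeq_Cinfinite cinfinite_mono unfolding LS_property_def by blast
  have \<kappa>i: "Cinfinite \<kappa>" using LS(2) LSi \<kappa>(1) cinfinite_mono ordLess_imp_ordLeq by blast
  have "P \<in> K" "univ N \<union> {a} \<subseteq> univ P"
    using prec_K[OF P(2)] prec_univ[OF P(2)] P(3) by auto
  then obtain Q where Q: "prec Q P" "univ N \<union> {a} \<subseteq> univ Q" "|univ Q| \<le>o |univ N \<union> {a}| +c LS"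
    using LS(1) unfolding LS_property_def by blast
  have "|{a}| <o \<kappa>"
    using \<kappa>i by (intro Cfinite_ordLess_Cinfinite) (auto simp: cfinite_def Field_card_of card_of_card_order_on)
  then have "|univ N \<union> {a}| <o \<kappa>" using N(2) Un_Cinfinite_bound_strict \<kappa>i by blast
  then have "|univ N \<union> {a}| +c LS <o \<kappa>"
    using csum_ordLess[OF \<kappa>i card_of_Card_order] LSi LS(2) by blast
  then have Qs: "|univ Q| <o \<kappa>" using Q(3) ordLeq_ordLess_trans by blast
  have NQ: "prec N Q" using prec_between[OF P(2) Q(1)] Q(2) by blast
  obtain b where b: "b \<in> univ M" "sim N b M a Q"
    using r N(1) NQ Qs Q(2) unfolding rich_def by blast
  have "sim N b M a P"
    using sim_trans[OF b(2) sim_prec[OF Q(1)]] prec_univ[OF NQ] Q(2) by blast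
  then have "gtp \<tau> K prec b N M = p"
    using gtp_eq_iff_sim[OF inf ordLess_ordLeq_trans[OF N(2) \<kappa>(2)] N(1) b(1) P(2,3)] P(1) by blast
  then show "\<exists>b\<in>univ M. gtp \<tau> K prec b N M = p" using b(1) by blast
qed

end

section \<open>A saturated model in the categoricity cardinal\<close>

lemma Times_Cinfinite_bound: "\<lbrakk>|A| \<le>o r; |B| \<le>o r; Cinfinite r\<rbrakk> \<Longrightarrow> |A \<times> B| \<le>o r"
  by (intro card_of_Times_ordLeq_infinite_Field) (auto simp: cinfinite_def)

lemma Plus_Cinfinite_bound: "\<lbrakk>|A| \<le>o r; |B| \<le>o r; Cinfinite r\<rbrakk> \<Longrightarrow> |A <+> B| \<le>o r"
  by (intro card_of_Plus_ordLeq_infinite_Field) (auto simp: cinfinite_def)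

lemma image_bound: "|A| \<le>o r \<Longrightarrow> |f ` A| \<le>o r"
  using card_of_image ordLeq_transitive by blast

lemma subset_bound: "|B| \<le>o r \<Longrightarrow> A \<subseteq> B \<Longrightarrow> |A| \<le>o r"
  using card_of_mono1 ordLeq_transitive by blast

lemma finite_bound: "finite A \<Longrightarrow> Cinfinite r \<Longrightarrow> |A| \<le>o r"
  by (intro ordLess_imp_ordLeq Cfinite_ordLess_Cinfinite)
    (auto simp: cfinite_def Field_card_of card_of_card_order_on)

lemma lists_Cinfinite_bound:
  assumes "|A| \<le>o r" "Cinfinite r"
  shows "|lists A| \<le>o r"
proof -
  have *: "|{xs \<in> lists A. length xs = n}| \<le>o r" for n
  proof (induction n)
    case 0
    have "finite {xs \<in> lists A. length xs = 0}"
      by (rule finite_subset[of _ "{[]}"]) auto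
    then show ?case using assms(2) finite_bound by blast
  next
    case (Suc n)
    have "{xs \<in> lists A. length xs = Suc n} \<subseteq>
        (\<lambda>(x, xs). x # xs) ` (A \<times> {xs \<in> lists A. length xs = n})"
      by (force simp: length_Suc_conv)
    then show ?case
      using image_bound[OF Times_Cinfinite_bound[OF assms(1) Suc assms(2)]] subset_bound by blast
  qed
  have "|UNIV :: nat set| \<le>o r"
    using assms(2) natLeq_ordLeq_cinfinite card_of_nat ordIso_ordLeq_trans by blast
  then have "|\<Union>n. {xs \<in> lists A. length xs = n}| \<le>o r"
    using * assms(2) by (intro UNION_Cinfinite_bound) auto
  moreover have "lists A = (\<Union>n. {xs \<in> lists A. length xs = n})" by auto
  ultimately show ?thesis by simp
qed

lemma Fpow_Cinfinite_bound:
  assumes "|A| \<le>o r" "Cinfinite r"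
  shows "|Fpow A| \<le>o r"
proof -
  have "Fpow A \<subseteq> set ` lists A"
  proof
    fix B assume "B \<in> Fpow A"
    then obtain xs where "set xs = B" "xs \<in> lists A"
      using finite_list[of B] by (auto simp: Fpow_def)
    then show "B \<in> set ` lists A" by blast
  qed
  then show ?thesis using subset_bound[OF image_bound[OF lists_Cinfinite_bound[OF assms]]] by blast
qed

text \<open>A nonempty set of size below \<open>\<kappa>\<close> is the image of a proper initial
  segment of \<open>\<kappa>\<close>. There are at most \<open>lam\<close> segments, and at most
  \<open>lam\<close> functions on each by the hypothesis on powers.\<close>

lemma small_subsets_bound:
  assumes lam: "Cinfinite lam" and \<kappa>: "Card_order \<kappa>" "\<kappa> \<le>o lam"
    and pow: "\<And>\<mu>. \<mu> \<in> cards_below \<kappa> \<Longrightarrow> lam ^c \<mu> \<le>o lam" and X: "|X| \<le>o lam"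
  shows "|{Y. Y \<subseteq> X \<and> |Y| <o \<kappa>}| \<le>o lam"
proof -
  define F where "F i = (\<lambda>g. g ` underS \<kappa> i) ` Func (underS \<kappa> i) X" for i
  have "|F i| \<le>o lam" if i: "i \<in> Field \<kappa>" for i
  proof -
    let ?\<mu> = "|underS \<kappa> i|"
    have "?\<mu> \<in> cards_below \<kappa>"
      using card_of_underS[OF \<kappa>(1) i] by (simp add: cards_below_def card_of_Card_order)
    moreover have "|X| ^c ?\<mu> \<le>o lam ^c ?\<mu>" by (rule cexp_mono1[OF X card_of_Card_order])
    ultimately have "|X| ^c ?\<mu> \<le>o lam" using pow ordLeq_transitive by blast
    then show ?thesis unfolding F_def cexp_def Field_card_of by (rule image_bound)
  qed
  moreover have "|Field \<kappa>| \<le>o lam"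
    using card_of_Field_ordIso[OF \<kappa>(1)] \<kappa>(2) ordIso_ordLeq_trans by blast
  ultimately have "|\<Union>i\<in>Field \<kappa>. F i| \<le>o lam" using lam UNION_Cinfinite_bound by blast
  then have "|{{}} \<union> (\<Union>i\<in>Field \<kappa>. F i)| \<le>o lam"
    using lam by (intro Un_Cinfinite_bound[OF finite_bound]) auto
  moreover have "{Y. Y \<subseteq> X \<and> |Y| <o \<kappa>} \<subseteq> {{}} \<union> (\<Union>i\<in>Field \<kappa>. F i)"
  proof clarify
    fix Y assume Y: "Y \<subseteq> X" "|Y| <o \<kappa>" and "Y \<notin> (\<Union>i\<in>Field \<kappa>. F i)"
    obtain i where i: "i \<in> Field \<kappa>" "|Y| =o Restr \<kappa> (underS \<kappa> i)"
      using Y(2) ordLess_iff_ordIso_Restr[OF _ card_of_Well_order, of \<kappa> Y] \<kappa>(1)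
      by (auto simp: card_order_on_def)
    have "|Y| \<le>o |Field (Restr \<kappa> (underS \<kappa> i))|"
      using card_of_mono2[OF ordIso_imp_ordLeq[OF i(2)]] by (simp add: Field_card_of)
    also have "|Field (Restr \<kappa> (underS \<kappa> i))| \<le>o |underS \<kappa> i|"
      by (rule card_of_mono1) (auto simp: Field_def)
    finally have le: "|Y| \<le>o |underS \<kappa> i|" .
    show "Y = {}"
    proof (rule ccontr)
      assume "Y \<noteq> {}"
      then obtain g where g: "g ` underS \<kappa> i = Y" using card_of_ordLeq2[of Y "underS \<kappa> i"] le by auto
      let ?g = "\<lambda>x. if x \<in> underS \<kappa> i then g x else undefined"
      have "?g \<in> Func (underS \<kappa> i) X" using g Y(1) by (force simp: Func_def)
      moreover have "Y = ?g ` underS \<kappa> i" using g by auto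
      ultimately have "Y \<in> F i" unfolding F_def by blast
      then show False using i(1) \<open>Y \<notin> _\<close> by blast
    qed
  qed
  ultimately show ?thesis using subset_bound by blast
qed

text \<open>Otherwise \<open>lam\<close> is itself an admissible exponent, copied to the type of
  \<open>\<kappa>\<close> as \<open>|B|\<close>, and a power of \<open>lam\<close> to itself bounded
  by \<open>lam\<close> contradicts Cantor's theorem.\<close>

lemma weak_power_ge:
  fixes lam :: "'l rel" and \<kappa> :: "'k rel"
  assumes lam: "Cinfinite lam" and \<kappa>: "Card_order \<kappa>"
    and pow: "\<And>\<mu>. \<mu> \<in> cards_below \<kappa> \<Longrightarrow> lam ^c \<mu> \<le>o lam"
  shows "\<kappa> \<le>o lam"
proof (rule ccontr)
  assume "\<not> \<kappa> \<le>o lam"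
  then have "lam <o \<kappa>" using lam \<kappa> by (simp add: card_order_on_def flip: not_ordLeq_iff_ordLess)
  then have "|Field lam| <o \<kappa>" using card_of_Field_ordIso lam ordIso_ordLess_trans by blast
  then obtain B :: "'k set" where B: "|Field lam| =o |B|" "|B| <o \<kappa>" using internalize_card_of_ordLess[of "Field lam" \<kappa>] by blast
  then have "lam ^c |B| \<le>o lam" by (intro pow) (simp add: cards_below_def card_of_Card_order)
  moreover have "lam =o |B|"
    using B(1) card_of_Field_ordIso lam ordIso_symmetric ordIso_transitive by blast
  moreover have "ctwo ^c |B| \<le>o lam ^c |B|"
    using ctwo_ordLeq_Cinfinite[OF lam] by (intro cexp_mono1 card_of_Card_order)
  moreover have "|B| <o ctwo ^c |B|" by (rule ordLess_ctwo_cexp[OF card_of_Card_order])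
  ultimately have "|B| <o |B|"
    using ordLess_ordLeq_trans ordLeq_transitive ordLeq_ordIso_trans by blast
  then show False using ordLess_irreflexive by blast
qed

text \<open>A structure coded as a set of elements and facts. The coding is injective on structures,
  so they can be counted as subsets of a fixed set; elements are listed separately so that the
  universe can be read off.\<close>

definition diagram ::
  "('f, 'r) vocabulary \<Rightarrow> ('u, 'f, 'r) struc \<Rightarrow> ('u + ('f \<times> 'u list \<times> 'u) + ('r \<times> 'u list)) set" where
  "diagram \<tau> M = Inl ` univ M \<union>
     Inr ` Inl ` {(f, xs, fint M f xs) | f xs. f \<in> fsyms \<tau> \<and> xs \<in> fargs \<tau> f (univ M)} \<union>
     Inr ` Inr ` {(R, xs). rint M R xs}"

lemma diagram_eqD:
  fixes M N :: "('u, 'f, 'r) struc"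
  assumes M: "structure_of \<tau> M" and N: "structure_of \<tau> N" and eq: "diagram \<tau> M = diagram \<tau> N"
  shows "M = N"
proof -
  have "Inl x \<in> diagram \<tau> P \<longleftrightarrow> x \<in> univ P" for x and P :: "('u, 'f, 'r) struc"
    by (auto simp: diagram_def)
  then have u: "univ M = univ N" using eq by (metis set_eqI)
  have f: "Inr (Inl (f, xs, y)) \<in> diagram \<tau> P \<longleftrightarrow>
      f \<in> fsyms \<tau> \<and> xs \<in> fargs \<tau> f (univ P) \<and> y = fint P f xs"
    for f xs y and P :: "('u, 'f, 'r) struc"
    by (auto simp: diagram_def)
  have r: "Inr (Inr (R, xs)) \<in> diagram \<tau> P \<longleftrightarrow> rint P R xs" for R xs and P :: "('u, 'f, 'r) struc"
    by (auto simp: diagram_def)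
  show ?thesis
  proof (rule struc_eqI[OF M N u])
    show "fint M f xs = fint N f xs" if "f \<in> fsyms \<tau>" "xs \<in> fargs \<tau> f (univ M)" for f xs
      using f[of f xs "fint M f xs" M] f[of f xs "fint M f xs" N] eq that by simp
    show "rint M R xs = rint N R xs" for R xs
      using r[of R xs M] r[of R xs N] eq by simp
  qed
qed

lemma diagram_subset:
  assumes M: "structure_of \<tau> M" and "univ M \<subseteq> A"
  shows "diagram \<tau> M \<subseteq> A <+> (fsyms \<tau> \<times> lists A \<times> A) <+> (rsyms \<tau> \<times> lists A)"
proof -
  have "fint M f xs \<in> univ M \<and> xs \<in> lists (univ M)" if "f \<in> fsyms \<tau>" "xs \<in> fargs \<tau> f (univ M)" for f xs
    using M that unfolding structure_of_def by (auto simp: fargs_def)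
  moreover have "R \<in> rsyms \<tau> \<and> xs \<in> lists (univ M)" if "rint M R xs" for R xs
    using structure_rint[OF M that] by (auto simp: rargs_def)
  moreover have "lists (univ M) \<subseteq> lists A" using assms(2) by (rule lists_mono)
  ultimately show ?thesis using assms(2) unfolding diagram_def by blast
qed

lemma diagram_bound:
  assumes M: "structure_of \<tau> M" and A: "univ M \<subseteq> A" "|A| \<le>o r" and r: "Cinfinite r"
    and syms: "|fsyms \<tau> <+> rsyms \<tau>| \<le>o r"
  shows "|A <+> (fsyms \<tau> \<times> lists A \<times> A) <+> (rsyms \<tau> \<times> lists A)| \<le>o r"
proof -
  have "|fsyms \<tau>| \<le>o r" "|rsyms \<tau>| \<le>o r"
    using syms card_of_Plus1 card_of_Plus2 ordLeq_transitive by blast+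
  then show ?thesis
    using A(2) r by (intro Plus_Cinfinite_bound Times_Cinfinite_bound lists_Cinfinite_bound)
qed

text \<open>A structure of size below \<open>\<kappa>\<close> has a diagram of size at most
  \<open>|univ M| +c LS\<close>, still below \<open>\<kappa>\<close>, so the count of small subsets
  applies to diagrams.\<close>

lemma small_structures_bound:
  assumes lam: "Cinfinite lam" and \<kappa>: "Card_order \<kappa>" "\<kappa> \<le>o lam"
    and pow: "\<And>\<mu>. \<mu> \<in> cards_below \<kappa> \<Longrightarrow> lam ^c \<mu> \<le>o lam"
    and LS: "Cinfinite LS" "LS <o \<kappa>" "|fsyms \<tau> <+> rsyms \<tau>| \<le>o LS" and U: "|U| \<le>o lam"
  shows "|{M. structure_of \<tau> M \<and> univ M \<subseteq> U \<and> |univ M| <o \<kappa>}| \<le>o lam"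
proof -
  let ?S = "{M. structure_of \<tau> M \<and> univ M \<subseteq> U \<and> |univ M| <o \<kappa>}"
  let ?X = "U <+> (fsyms \<tau> \<times> lists U \<times> U) <+> (rsyms \<tau> \<times> lists U)"
  have \<kappa>i: "Cinfinite \<kappa>" using LS \<kappa>(1) cinfinite_mono ordLess_imp_ordLeq by blast
  show ?thesis
  proof (cases "?S = {}")
    case True
    then show ?thesis using finite_bound[OF finite.emptyI lam] by (simp only:)
  next
    case False
    then obtain M where "structure_of \<tau> M" "univ M \<subseteq> U" by blast
    moreover have "|fsyms \<tau> <+> rsyms \<tau>| \<le>o lam"
      using LS(2,3) \<kappa>(2) ordLeq_transitive ordLess_imp_ordLeq by metis
    ultimately have X: "|?X| \<le>o lam" using diagram_bound U lam by blast
    have "inj_on (diagram \<tau>) ?S" by (intro inj_onI) (use diagram_eqD in blast)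
    moreover have "diagram \<tau> M \<in> {Y. Y \<subseteq> ?X \<and> |Y| <o \<kappa>}" if "M \<in> ?S" for M
    proof -
      have M: "structure_of \<tau> M" "univ M \<subseteq> U" "|univ M| <o \<kappa>" using that by auto
      let ?r = "|univ M| +c LS"
      let ?Y = "univ M <+> (fsyms \<tau> \<times> lists (univ M) \<times> univ M) <+> (rsyms \<tau> \<times> lists (univ M))"
      have r: "Cinfinite ?r" "|univ M| \<le>o ?r" "LS \<le>o ?r" "?r <o \<kappa>"
        using Cinfinite_csum[of "|univ M|" LS] ordLeq_csum1[OF card_of_Card_order] LS(1,2)
          ordLeq_csum2[of LS] csum_ordLess[OF \<kappa>i card_of_Card_order _ M(3), of LS] by auto
      have "|?Y| \<le>o ?r"
        using LS(3) r ordLeq_transitive by (intro diagram_bound[OF M(1)]) blast+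
      then have "|diagram \<tau> M| \<le>o ?r" using subset_bound diagram_subset[OF M(1)] by blast
      then have "|diagram \<tau> M| <o \<kappa>" using r(4) ordLeq_ordLess_trans by blast
      then show ?thesis using diagram_subset[OF M(1,2)] by blast
    qed
    ultimately have "|?S| \<le>o |{Y. Y \<subseteq> ?X \<and> |Y| <o \<kappa>}|" by (rule card_of_ordLeqI)
    then show ?thesis
      using small_subsets_bound[OF lam \<kappa> pow X] ordLeq_transitive by blast
  qed
qed

text \<open>An injection of \<open>T \<times> U\<close> into \<open>U\<close> sends its columns to
  disjoint sets of full size. In \<open>exists_rich\<close> these are the places for the elements
  added for each task.\<close>

lemma disjoint_rooms:
  assumes "infinite U" "|T| \<le>o |U|"
  shows "\<exists>V. \<forall>t\<in>T. V t \<subseteq> U \<and> |U| \<le>o |V t| \<and> (\<forall>s\<in>T. s \<noteq> t \<longrightarrow> V s \<inter> V t = {})"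
proof -
  have "|T \<times> U| \<le>o |U|"
    using assms by (intro Times_Cinfinite_bound)
      (auto simp: cinfinite_def Field_card_of card_of_card_order_on ordLeq_refl[OF card_of_Card_order])
  then obtain b where b: "inj_on b (T \<times> U)" "b ` (T \<times> U) \<subseteq> U" using card_of_ordLeq by metis
  let ?V = "\<lambda>t. b ` ({t} \<times> U)"
  show ?thesis
  proof (intro exI[of _ ?V] ballI conjI impI)
    fix t assume t: "t \<in> T"
    show "?V t \<subseteq> U" using b(2) t by auto
    have "inj_on (\<lambda>u. b (t, u)) U"
      using b(1) t by (auto simp: inj_on_def)
    then show "|U| \<le>o |?V t|" by (rule card_of_ordLeqI) auto
    fix s assume "s \<in> T" "s \<noteq> t"
    then show "?V s \<inter> ?V t = {}" using b(1) t by (auto simp: inj_on_def)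
  qed
qed

section \<open>Existence of a rich model of size \<open>lam\<close>\<close>

context aec_ap
begin

text \<open>A maximal pair \<open>(M, S)\<close>, where \<open>M\<close> realizes all types in \<open>S\<close> and lies in the rooms reserved for
  \<open>S\<close>, realizes every type over a small \<open>N \<prec> M\<close>: otherwise there is an unused room for extending \<open>M\<close>.
  This replaces a transfinite chain with bookkeeping.\<close>

lemma exists_rich:
  fixes lam :: "'l rel" and \<kappa> :: "'k rel"
  assumes lam: "Cinfinite lam" and M00: "M\<^sub>0\<^sub>0 \<in> K" "|univ M\<^sub>0\<^sub>0| =o lam"
    and \<kappa>: "Card_order \<kappa>" and pow: "\<And>\<mu>. \<mu> \<in> cards_below \<kappa> \<Longrightarrow> lam ^c \<mu> \<le>o lam"
    and LS: "LS_property \<tau> K prec LS" "LS <o \<kappa>"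
  shows "\<exists>M\<in>K. |univ M| =o lam \<and> rich \<kappa> M"
proof -
  define U where "U = univ M\<^sub>0\<^sub>0"
  have \<kappa>lam: "\<kappa> \<le>o lam" using weak_power_ge[OF lam \<kappa> pow] .
  have LSi: "Cinfinite LS" "|fsyms \<tau> <+> rsyms \<tau>| \<le>o LS"
    using LS(1) natLeq_Cinfinite cinfinite_mono unfolding LS_property_def by blast+
  have LSlam: "LS \<le>o lam" using LS(2) \<kappa>lam ordLess_imp_ordLeq ordLeq_transitive by blast
  have Ulam: "|U| \<le>o lam" "lam \<le>o |U|"
    using M00(2) ordIso_imp_ordLeq ordIso_symmetric by (auto simp: U_def)
  have Uinf: "infinite U"
    using cinfinite_mono[OF Ulam(2)] lam by (simp add: cinfinite_def Field_card_of)
  have U\<theta>: "|A| <o \<theta>" if "A \<subseteq> U" for A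
    using small[OF M00(1)] card_of_mono1[OF that] ordLeq_ordLess_trans by (auto simp: U_def)
  \<comment> \<open>Tasks: all small extensions inside \<open>U\<close> with an element to be
    realized. \<open>N\<close> is not tied to a particular model, so the list can be fixed before
    \<open>M\<close> exists.\<close>
  define T where "T = {(N, P, a). prec N P \<and> univ P \<subseteq> U \<and> |univ P| <o \<kappa> \<and> a \<in> univ P}"
  have "|T| \<le>o lam"
  proof -
    let ?S = "{M. structure_of \<tau> M \<and> univ M \<subseteq> U \<and> |univ M| <o \<kappa>}"
    have "|?S| \<le>o lam" by (rule small_structures_bound[OF lam \<kappa> \<kappa>lam pow LSi(1) LS(2) LSi(2) Ulam(1)])
    then have "|?S \<times> ?S \<times> U| \<le>o lam" using Ulam(1) lam by (intro Times_Cinfinite_bound)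
    moreover have "T \<subseteq> ?S \<times> ?S \<times> U"
    proof
      fix t assume "t \<in> T"
      then obtain N P a where teq: "t = (N, P, a)" and t: "prec N P" "univ P \<subseteq> U" "|univ P| <o \<kappa>" "a \<in> univ P" by (auto simp: T_def)
      have "N \<in> K" "P \<in> K" "univ N \<subseteq> univ P" using prec_K[OF t(1)] prec_univ[OF t(1)] by auto
      moreover have "|univ N| <o \<kappa>"
        using t(3) card_of_mono1[OF \<open>univ N \<subseteq> univ P\<close>] ordLeq_ordLess_trans by blast
      ultimately show "t \<in> ?S \<times> ?S \<times> U" using t structures by (auto simp: teq)
    qed
    ultimately show ?thesis using subset_bound by blast
  qed
  then have "|{None} \<union> Some ` T| \<le>o lam"
    using lam by (intro Un_Cinfinite_bound[OF finite_bound] image_bound) auto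
  then have "|insert None (Some ` T)| \<le>o |U|" using Ulam(2) ordLeq_transitive by auto
  \<comment> \<open>\<open>None\<close> reserves the room of the starting model,
    \<open>Some t\<close> that of task \<open>t\<close>.\<close>
  then obtain V where V: "\<And>t. t \<in> insert None (Some ` T) \<Longrightarrow> V t \<subseteq> U"
    "\<And>t. t \<in> insert None (Some ` T) \<Longrightarrow> |U| \<le>o |V t|"
    "\<And>s t. s \<in> insert None (Some ` T) \<Longrightarrow> t \<in> insert None (Some ` T) \<Longrightarrow> s \<noteq> t \<Longrightarrow> V s \<inter> V t = {}"
    using disjoint_rooms[OF Uinf] by metis
  obtain f where f: "inj_on f U" "f ` U \<subseteq> V None"
    using V(2)[of None] card_of_ordLeq[of U "V None"] by auto
  define M\<^sub>0 where "M\<^sub>0 = img \<tau> f M\<^sub>0\<^sub>0"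
  have M0: "M\<^sub>0 \<in> K" "univ M\<^sub>0 = f ` U" using img_K[OF M00(1)] f(1) by (auto simp: M\<^sub>0_def U_def)
  define room where "room S = V None \<union> (\<Union>t\<in>S. V (Some t))" for S
  have roomU: "room S \<subseteq> U" if "S \<subseteq> T" for S
    using that V(1) by (auto simp: room_def)
  define R where "R = (\<lambda>(N, P, a) M. prec N M \<and> (\<exists>b\<in>univ M. sim N b M a P))"
  have Rmono: "R t M'" if Rt: "R t M" and MM: "prec M M'" for t M M'
  proof -
    obtain N P a where t: "t = (N, P, a)" by (cases t)
    then obtain b where b: "prec N M" "b \<in> univ M" "sim N b M a P" using Rt by (auto simp: R_def)
    then have "sim N b M' a P" using sim_mono[OF b(3) MM prec_univ[OF b(1)] b(2)] by simp
    moreover have "prec N M'" "b \<in> univ M'" using prec_trans[OF b(1) MM] prec_univ[OF MM] b(2) by auto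
    ultimately show ?thesis by (auto simp: R_def t)
  qed
  \<comment> \<open>The bound \<open>univ M \<subseteq> room S\<close> keeps the rooms of the tasks
    outside \<open>S\<close> empty.\<close>
  define A where "A = {(M, S). prec M\<^sub>0 M \<and> S \<subseteq> T \<and> univ M \<subseteq> room S \<and> (\<forall>t\<in>S. R t M)}"
  define le where "le = (\<lambda>(M, S) (M', S'). prec M M' \<and> (S :: (('u, 'f, 'r) struc \<times> ('u, 'f, 'r) struc \<times> 'u) set) \<subseteq> S')"
  have "\<exists>m\<in>A. \<forall>a\<in>A. le m a \<longrightarrow> a = m"
  proof (rule predicate_Zorn)
    show "partial_order_on A (relation_of le A)"
    proof (rule partial_order_on_relation_ofI)
      show "le a a" if a: "a \<in> A" for a
      proof -
        obtain M S where "a = (M, S)" "prec M\<^sub>0 M" using a by (auto simp: A_def)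
        then show ?thesis using prec_refl[of M] prec_K[of "M\<^sub>0" M] by (simp add: le_def)
      qed
      fix a b c :: "('u, 'f, 'r) struc \<times> (('u, 'f, 'r) struc \<times> ('u, 'f, 'r) struc \<times> 'u) set"
      obtain M S M' S' M'' S'' where [simp]: "a = (M, S)" "b = (M', S')" "c = (M'', S'')"
        by (metis prod.exhaust)
      show "le a c" if "le a b" "le b c"
        using that prec_trans[of M M' M''] by (auto simp: le_def)
      show "a = b" if "le a b" "le b a"
        using that prec_antisym[of M M'] by (auto simp: le_def)
    qed
    fix C assume C: "C \<in> Chains (relation_of le A)"
    then have CA: "C \<subseteq> A" by (auto simp: Chains_def relation_of_def)
    have lin: "le a b \<or> le b a" if "a \<in> C" "b \<in> C" for a b
      using C that by (auto simp: Chains_def relation_of_def)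
    show "\<exists>u\<in>A. \<forall>a\<in>C. le a u"
    proof (cases "C = {}")
      case True
      have "(M\<^sub>0, {}) \<in> A"
        using prec_refl[OF M0(1)] M0(2) f(2) by (auto simp: A_def room_def)
      then show ?thesis using True by blast
    next
      case False
      let ?S = "\<Union>(snd ` C)"
      have CA': "prec M\<^sub>0 M" "S \<subseteq> T" "univ M \<subseteq> room S" "\<And>t. t \<in> S \<Longrightarrow> R t M" if "(M, S) \<in> C" for M S
        using CA that by (auto simp: A_def)
      have "univ (fst c) \<subseteq> U" if "c \<in> C" for c
        using CA'(2,3)[of "fst c" "snd c"] roomU[of "snd c"] that by (metis prod.collapse subset_trans)
      then have "|\<Union>(univ ` fst ` C)| <o \<theta>" by (intro U\<theta>) auto
      moreover have "prec M M' \<or> prec M' M" if m: "M \<in> fst ` C" "M' \<in> fst ` C" for M M'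
      proof -
        obtain S S' where "(M, S) \<in> C" "(M', S') \<in> C" using m by auto
        then show ?thesis using lin[of "(M, S)" "(M', S')"] by (auto simp: le_def)
      qed
      ultimately obtain W where W: "W \<in> K" "univ W = \<Union>(univ ` fst ` C)" "\<forall>M\<in>fst ` C. prec M W"
        using linear_union[of "fst ` C"] False by blast
      have MW: "prec M W" if "(M, S) \<in> C" for M S using W(3) that by (metis fst_conv image_eqI)
      obtain M S where MS: "(M, S) \<in> C" using False by auto
      have "(W, ?S) \<in> A"
        unfolding A_def
      proof (intro CollectI case_prodI conjI ballI)
        show "prec M\<^sub>0 W" using prec_trans[OF CA'(1)[OF MS] MW[OF MS]] .
        show "?S \<subseteq> T"
        proof (rule Union_least)
          fix S assume "S \<in> snd ` C"
          then obtain M where "(M, S) \<in> C" by auto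
          then show "S \<subseteq> T" by (rule CA'(2))
        qed
        show "univ W \<subseteq> room ?S"
        proof
          fix x assume "x \<in> univ W"
          then obtain M S where x: "(M, S) \<in> C" "x \<in> univ M" using W(2) by auto
          then have "x \<in> room S" using CA'(3) by blast
          moreover have "S \<subseteq> ?S" using x(1) by (metis Sup_upper image_eqI snd_conv)
          ultimately show "x \<in> room ?S" unfolding room_def by blast
        qed
        fix t assume "t \<in> ?S"
        then obtain M S where x: "(M, S) \<in> C" "t \<in> S" by auto
        then show "R t W" using Rmono[OF CA'(4) MW] by blast
      qed
      moreover have "le a (W, ?S)" if a: "a \<in> C" for a
      proof -
        have "snd a \<subseteq> ?S" using a by auto
        then show ?thesis using MW[of "fst a" "snd a"] a by (simp add: le_def case_prod_unfold)
      qed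
      ultimately show ?thesis by blast
    qed
  qed
  then obtain M S where MS: "(M, S) \<in> A" and max: "\<And>M' S'. (M', S') \<in> A \<Longrightarrow> le (M, S) (M', S') \<Longrightarrow> S' = S"
    by force
  have M: "prec M\<^sub>0 M" "S \<subseteq> T" "univ M \<subseteq> room S" "\<And>t. t \<in> S \<Longrightarrow> R t M" using MS by (auto simp: A_def)
  have MK: "M \<in> K" using prec_K[OF M(1)] by simp
  have MU: "univ M \<subseteq> U" using M(3) roomU[OF M(2)] by blast
  have real: "R (N, P, a) M" if t: "(N, P, a) \<in> T" and NM: "prec N M" for N P a
  proof (rule ccontr)
    assume nR: "\<not> R (N, P, a) M"
    let ?t = "(N, P, a)"
    have tS: "?t \<notin> S" using nR M(4) by blast
    have P: "prec N P" "a \<in> univ P" using t by (auto simp: T_def)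
    obtain C h\<^sub>1 h\<^sub>2 where C: "kemb h\<^sub>1 M C" "kemb h\<^sub>2 P C" "\<forall>x\<in>univ N. h\<^sub>1 (id x) = h\<^sub>2 (id x)"
      using amalgam_emb[OF kemb_id[OF NM] kemb_id[OF P(1)]] by blast
    have CK: "C \<in> K" using kemb_K[OF C(1)] by simp
    let ?B = "h\<^sub>1 ` univ M \<union> {h\<^sub>2 a}"
    have "?B \<subseteq> univ C" using kemb_into[OF C(1)] kemb_into[OF C(2) P(2)] by auto
    \<comment> \<open>The amalgam may be larger than the room, so it is cut down to a model of size
      at most \<open>lam\<close> containing the copy of \<open>M\<close> and the
      realization.\<close>
    then obtain D where D: "prec D C" "?B \<subseteq> univ D" "|univ D| \<le>o |?B| +c LS"
      using LS(1) CK unfolding LS_property_def by blast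
    have "|?B| \<le>o lam"
      using lam subset_bound[OF Ulam(1) MU]
      by (intro Un_Cinfinite_bound image_bound) (auto intro: finite_bound)
    then have "|?B| +c LS \<le>o lam"
      using LSlam lam LSi(1) by (intro csum_cinfinite_bound) (auto simp: card_of_card_order_on Field_card_of)
    then have "|univ D| \<le>o lam" using D(3) ordLeq_transitive by blast
    then have "|univ D - h\<^sub>1 ` univ M| \<le>o lam" by (rule subset_bound) auto
    then have "|univ D - h\<^sub>1 ` univ M| \<le>o |V (Some ?t)|"
      using ordLeq_transitive[OF ordLeq_transitive[OF _ Ulam(2)] V(2)[of "Some ?t"]] t by simp
    moreover have "V (Some ?t) \<inter> univ M = {}"
    proof -
      have "V (Some ?t) \<inter> V None = {}" using V(3)[of "Some ?t" None] t by auto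
      moreover have "V (Some ?t) \<inter> V (Some s) = {}" if "s \<in> S" for s
      proof -
        have "s \<in> T" "Some ?t \<noteq> Some s" using that tS M(2) by auto
        then show ?thesis using t by (intro V(3)) auto
      qed
      ultimately show ?thesis using M(3) unfolding room_def by blast
    qed
    moreover define g where "g = inv_into (univ M) h\<^sub>1"
    have h1: "inj_on h\<^sub>1 (univ M)" using kemb_inj[OF C(1)] .
    then have gh: "g (h\<^sub>1 x) = x" if "x \<in> univ M" for x using that by (simp add: g_def)
    then have "g ` h\<^sub>1 ` univ M = univ M" by force
    moreover have "inj_on g (h\<^sub>1 ` univ M)" by (simp add: g_def inj_on_inv_into)
    moreover have hD: "h\<^sub>1 ` univ M \<subseteq> univ D" using D(2) by simp
    ultimately obtain k where k: "inj_on k (univ D)" "\<forall>x\<in>h\<^sub>1 ` univ M. k x = g x"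
        "k ` (univ D - h\<^sub>1 ` univ M) \<subseteq> V (Some ?t)"
      using inj_on_extend[of "h\<^sub>1 ` univ M" "univ D" g "V (Some ?t)"] by auto
    have kh: "k (h\<^sub>1 x) = x" if "x \<in> univ M" for x using k(2) gh that by simp
    define M' where "M' = img \<tau> k D"
    have "prec (img \<tau> h\<^sub>1 M) D"
      using prec_between[OF kemb_prec_img[OF C(1)] D(1)] hD by simp
    then have "prec (img \<tau> k (img \<tau> h\<^sub>1 M)) M'" unfolding M'_def using k(1) by (rule prec_img)
    moreover have "img \<tau> k (img \<tau> h\<^sub>1 M) = img \<tau> (k \<circ> h\<^sub>1) M"
      using inj_on_subset[OF k(1) hD] by (intro img_comp[OF iso_imgK[OF MK h1], symmetric]) simp
    moreover have "img \<tau> (k \<circ> h\<^sub>1) M = M" using kh by (intro img_id structures[OF MK]) simp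
    ultimately have MM': "prec M M'" by simp
    have "kemb (inv_into (univ D) k) M' D"
      unfolding M'_def using kemb_img[OF _ k(1)] prec_K[OF D(1)] k(1) by (intro kemb_inv_img) auto
    then have e: "kemb (inv_into (univ D) k) M' C" using kemb_extend D(1) by blast
    have inv: "inv_into (univ D) k (k y) = y" if "y \<in> univ D" for y using k(1) that by simp
    have "sim N (k (h\<^sub>2 a)) M' a P"
      unfolding sim_def
    proof (intro exI conjI ballI)
      show "kemb (inv_into (univ D) k) M' C" "kemb h\<^sub>2 P C" using e C(2) by auto
      show "inv_into (univ D) k (k (h\<^sub>2 a)) = h\<^sub>2 a" using D(2) by (intro inv) simp
      fix x assume "x \<in> univ N"
      then have x: "x \<in> univ M" "h\<^sub>1 x = h\<^sub>2 x" using prec_univ[OF NM] C(3) by auto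
      then have "inv_into (univ D) k (k (h\<^sub>1 x)) = h\<^sub>1 x" using hD by (intro inv) auto
      then show "inv_into (univ D) k x = h\<^sub>2 x" using x(2) kh[OF x(1)] by simp
    qed
    moreover have "k (h\<^sub>2 a) \<in> univ M'" using D(2) by (simp add: M'_def)
    ultimately have Rt: "R ?t M'" using prec_trans[OF NM MM'] by (auto simp: R_def)
    have "univ M' \<subseteq> univ M \<union> V (Some ?t)"
    proof
      fix z assume "z \<in> univ M'"
      then obtain y where y: "y \<in> univ D" "z = k y" by (auto simp: M'_def)
      show "z \<in> univ M \<union> V (Some ?t)"
      proof (cases "y \<in> h\<^sub>1 ` univ M")
        case True
        then show ?thesis using kh y(2) by auto
      next
        case False
        then show ?thesis using k(3) y by blast
      qed
    qed
    then have "univ M' \<subseteq> room (insert ?t S)" using M(3) by (auto simp: room_def)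
    then have "(M', insert ?t S) \<in> A"
      using prec_trans[OF M(1) MM'] M(2) t Rt Rmono[OF M(4) MM'] by (auto simp: A_def)
    then have "insert ?t S = S" using MM' by (intro max) (auto simp: le_def)
    then show False using tS by blast
  qed
  have "rich \<kappa> M"
    unfolding rich_def
  proof (intro allI impI, elim conjE)
    fix N P a assume N: "prec N M" "prec N P" and P: "|univ P| <o \<kappa>" and a: "a \<in> univ P"
    have "|univ N| \<le>o |univ P|" using card_of_mono1[OF prec_univ[OF N(2)]] .
    moreover have PU: "|univ P| <o |U|"
      by (rule ordLess_ordLeq_trans[OF ordLess_ordLeq_trans[OF P \<kappa>lam] Ulam(2)])
    ultimately have "|univ N| <o |U|" by (rule ordLeq_ordLess_trans)
    then have room: "|U| \<le>o |U - univ N|" using infinite_ordLeq_Diff[OF Uinf] by blast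
    have "|univ P - univ N| \<le>o |U - univ N|"
      using subset_bound[OF ordLeq_transitive[OF ordLess_imp_ordLeq[OF PU] room]] by blast
    \<comment> \<open>An arbitrary \<open>P\<close> need not lie in \<open>U\<close> and so need not
      be on the list of tasks; it is renamed over \<open>N\<close> into \<open>U\<close>.\<close>
    then obtain k where k: "inj_on k (univ P)" "\<forall>x\<in>univ N. k x = id x"
      "k ` (univ P - univ N) \<subseteq> U - univ N"
      using inj_on_extend[OF prec_univ[OF N(2)], of id "U - univ N"] by auto
    have PK: "P \<in> K" "N \<in> K" using prec_K[OF N(2)] by auto
    have "img \<tau> k N = N" using k(2) by (intro img_id structures PK) auto
    then have "prec N (img \<tau> k P)" using prec_img[OF N(2) k(1)] by simp
    moreover have "|univ (img \<tau> k P)| <o \<kappa>"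
      using card_of_image[of k "univ P"] P ordLeq_ordLess_trans by auto
    moreover have "univ (img \<tau> k P) \<subseteq> U"
    proof
      fix z assume "z \<in> univ (img \<tau> k P)"
      then obtain y where y: "y \<in> univ P" "z = k y" by auto
      show "z \<in> U"
        using y k(2,3) prec_univ[OF N(1)] MU by (cases "y \<in> univ N") auto
    qed
    ultimately have "(N, img \<tau> k P, k a) \<in> T" using a by (auto simp: T_def)
    from real[OF this N(1)] obtain b where b: "b \<in> univ M" "sim N b M (k a) (img \<tau> k P)"
      by (auto simp: R_def)
    have "sim N a P (k a) (img \<tau> k P)"
      using kemb_img[OF PK(1) k(1)] k(2) by (intro sim_kemb) auto
    then have "sim N b M a P"
      using sim_trans[OF b(2) sim_sym] prec_univ[OF \<open>prec N (img \<tau> k P)\<close>] a by auto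
    then show "\<exists>b\<in>univ M. sim N b M a P" using b(1) by blast
  qed
  moreover have "|univ M| =o lam"
  proof -
    have "|U| \<le>o |univ M|"
      using f(1) prec_univ[OF M(1)] M0(2) by (intro card_of_ordLeqI[of f]) auto
    then have "lam \<le>o |univ M|" using Ulam(2) ordLeq_transitive by blast
    moreover have "|univ M| \<le>o lam" using subset_bound[OF Ulam(1) MU] .
    ultimately show ?thesis using ordIso_iff_ordLeq by blast
  qed
  ultimately show ?thesis using MK by blast
qed

end

section \<open>The Erdos--Rado theorem and coherent colours\<close>

lemma card_of_Pow_mono:
  assumes "|X| \<le>o |B|"
  shows "|Pow X| \<le>o |Pow B|"
proof -
  obtain h where h: "inj_on h X" "h ` X \<subseteq> B" using assms card_of_ordLeq[of X B] by blast
  show ?thesis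
  proof (rule card_of_ordLeqI)
    show "inj_on ((`) h) (Pow X)" using h(1) by (rule inj_on_image_Pow)
    show "h ` Y \<in> Pow B" if "Y \<in> Pow X" for Y using that h(2) by auto
  qed
qed

section \<open>Long branches of the Erdos--Rado tree\<close>

locale strict_wellorder =
  fixes lt :: "'a \<Rightarrow> 'a \<Rightarrow> bool" (infix \<open>\<sqsubset>\<close> 50)
  assumes wf: "wfp (\<sqsubset>)" and trans: "x \<sqsubset> y \<Longrightarrow> y \<sqsubset> z \<Longrightarrow> x \<sqsubset> z"
    and total: "x \<sqsubset> y \<or> x = y \<or> y \<sqsubset> x"
begin

lemma irrefl: "\<not> x \<sqsubset> x"
  using wf wf_not_refl[of "{(x, y). x \<sqsubset> y}" x] by (simp add: wfp_def)

lemma finite_has_max: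
  assumes "finite s" "s \<noteq> {}"
  shows "\<exists>x\<in>s. \<forall>y\<in>s. y \<noteq> x \<longrightarrow> y \<sqsubset> x"
  using assms
proof (induction s rule: finite_ne_induct)
  case (insert x s)
  then obtain m where m: "m \<in> s" "\<forall>y\<in>s. y \<noteq> m \<longrightarrow> y \<sqsubset> m" by auto
  show ?case
  proof (cases "x \<sqsubset> m")
    case True
    then show ?thesis using m by (intro bexI[of _ m]) auto
  next
    case False
    then have "m \<sqsubset> x" using total[of x m] m(1) insert by auto
    then have "y \<sqsubset> x" if "y \<in> s" for y using m(2) trans[of y m x] that by (cases "y = m") auto
    then show ?thesis by blast
  qed
qed simp

text \<open>The elements chosen greedily below \<open>a\<close> that are indiscernible from \<open>a\<close> over the earlier chosen
  ones.\<close>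

definition branch :: "'a set \<Rightarrow> ('a set \<Rightarrow> 'c) \<Rightarrow> 'a \<Rightarrow> 'a set" where
  "branch A f a = {x. wfrec {(x, y). x \<sqsubset> y} (\<lambda>g x. x \<in> A \<and> x \<sqsubset> a \<and>
     (\<forall>s. finite s \<and> (\<forall>y\<in>s. y \<sqsubset> x \<and> g y) \<longrightarrow> f (insert x s) = f (insert a s))) x}"

lemma branch_iff:
  "x \<in> branch A f a \<longleftrightarrow> x \<in> A \<and> x \<sqsubset> a \<and>
    (\<forall>s\<in>Fpow (branch A f a). (\<forall>y\<in>s. y \<sqsubset> x) \<longrightarrow> f (insert x s) = f (insert a s))"
proof -
  have w: "wf {(x, y). x \<sqsubset> y}" using wf by (simp add: wfp_def)
  show ?thesis
    unfolding branch_def Fpow_def mem_Collect_eq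
    by (subst wfrec[OF w]) (auto simp: cut_def subset_iff)
qed

text \<open>The branch, its order and the colours over it determine its top. By induction
  \<open>p\<close> is the identity: if \<open>x\<close> and \<open>p x\<close> differed, the smaller
  of the two would meet the membership condition of the other branch and so be fixed already. With
  equal branches, the smaller of \<open>a\<close> and \<open>a'\<close> would belong to its own
  branch, which lies strictly below it.\<close>

lemma branch_code_inj:
  assumes a: "a \<in> A" "a' \<in> A"
    and p: "bij_betw p (branch A f a) (branch A f a')"
    and mono: "\<And>x y. x \<in> branch A f a \<Longrightarrow> y \<in> branch A f a \<Longrightarrow> p x \<sqsubset> p y \<longleftrightarrow> x \<sqsubset> y"
    and col: "\<And>s. s \<in> Fpow (branch A f a) \<Longrightarrow> f (insert a s) = f (insert a' (p ` s))"
  shows "a = a'"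
proof -
  let ?P = "branch A f a" and ?P' = "branch A f a'"
  have inj: "inj_on p ?P" and im: "p ` ?P = ?P'" using p by (auto simp: bij_betw_def)
  have fix_p: "x \<in> ?P \<longrightarrow> p x = x" for x
  proof (induction x rule: wfp_induct_rule[OF wf])
    case (1 x)
    show ?case
    proof
      assume x: "x \<in> ?P"
      then have x': "p x \<in> ?P'" using im by auto
      have xi: "x \<in> A" "x \<sqsubset> a" "\<And>s. s \<in> Fpow ?P \<Longrightarrow> \<forall>y\<in>s. y \<sqsubset> x \<Longrightarrow> f (insert x s) = f (insert a s)"
        using branch_iff[of x A f a] x by blast+
      have xi': "p x \<in> A" "p x \<sqsubset> a'"
        "\<And>s. s \<in> Fpow ?P' \<Longrightarrow> \<forall>y\<in>s. y \<sqsubset> p x \<Longrightarrow> f (insert (p x) s) = f (insert a' s)"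
        using branch_iff[of "p x" A f a'] x' by blast+
      have below: "y \<in> ?P \<and> p y = y" if y: "y \<in> ?P'" "y \<sqsubset> p x" for y
      proof -
        obtain z where z: "z \<in> ?P" "y = p z" using y(1) im by auto
        then have "z \<sqsubset> x" using mono[OF z(1) x] y(2) by simp
        then show ?thesis using 1 z by auto
      qed
      have below': "y \<in> ?P' \<and> p y = y" if y: "y \<in> ?P" "y \<sqsubset> x" for y
        using 1 y im by (metis imageI)
      consider "p x = x" | "x \<sqsubset> p x" | "p x \<sqsubset> x" using total by blast
      then show "p x = x"
      proof cases
        case 2
        have "x \<in> ?P'"
        proof (subst branch_iff, intro conjI ballI impI)
          show "x \<in> A" "x \<sqsubset> a'" using xi(1) trans[OF 2 xi'(2)] by auto
          fix s assume s: "s \<in> Fpow ?P'" "\<forall>y\<in>s. y \<sqsubset> x"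
          then have *: "y \<in> ?P \<and> p y = y" if "y \<in> s" for y
            using that s trans[OF _ 2, of y] by (intro below) (auto simp: Fpow_def)
          then have "s \<in> Fpow ?P" using s(1) by (auto simp: Fpow_def)
          moreover have "p ` s = s" using * by auto
          ultimately show "f (insert x s) = f (insert a' s)" using xi(3)[of s] s(2) col[of s] by simp
        qed
        then have "p x = x" using below[of x] 2 by blast
        then show ?thesis .
      next
        case 3
        have "p x \<in> ?P"
        proof (subst branch_iff, intro conjI ballI impI)
          show "p x \<in> A" "p x \<sqsubset> a" using xi'(1) trans[OF 3 xi(2)] by auto
          fix s assume s: "s \<in> Fpow ?P" "\<forall>y\<in>s. y \<sqsubset> p x"
          then have *: "y \<in> ?P' \<and> p y = y" if "y \<in> s" for y
            using that s trans[OF _ 3, of y] by (intro below') (auto simp: Fpow_def)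
          then have "s \<in> Fpow ?P'" using s(1) by (auto simp: Fpow_def)
          moreover have "p ` s = s" using * by auto
          ultimately show "f (insert (p x) s) = f (insert a s)" using xi'(3)[of s] s col[of s] by simp
        qed
        then show ?thesis using below'[of "p x"] 3 inj x by (auto dest: inj_onD)
      qed
    qed
  qed
  then have eq: "?P = ?P'" using im by force
  have pim: "p ` s = s" if "s \<in> Fpow ?P" for s
    using that fix_p by (force simp: Fpow_def)
  consider "a = a'" | "a \<sqsubset> a'" | "a' \<sqsubset> a" using total by blast
  then show ?thesis
  proof cases
    case 2
    have "a \<in> ?P'"
      using 2 a col pim eq by (subst branch_iff) auto
    then show ?thesis using branch_iff[of a A f a] eq irrefl by auto
  next
    case 3
    have "a' \<in> ?P"
      using 3 a col pim eq by (subst branch_iff) auto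
    then show ?thesis using branch_iff[of a' A f a'] eq irrefl by auto
  qed
qed

text \<open>If all branches had size at most \<open>|B|\<close>, each could be copied into
  \<open>B\<close>. By \<open>branch_code_inj\<close> the copy with its order and colours determines
  the top, and there are at most \<open>|Pow B|\<close> such codes, fewer than elements of
  \<open>A\<close>.\<close>

lemma exists_long_branch:
  fixes B :: "'b set" and C :: "'c set"
  assumes B: "infinite B" "|Pow B| <o |A|" and C: "|C| \<le>o |Pow B|"
    and f: "\<And>s. s \<in> Fpow A \<Longrightarrow> f s \<in> C"
  shows "\<exists>a\<in>A. |B| <o |branch A f a|"
proof (rule ccontr)
  assume "\<not> ?thesis"
  then have "|branch A f a| \<le>o |B|" if "a \<in> A" for a
    using that by (simp add: card_of_Well_order not_ordLess_iff_ordLeq)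
  then have "\<forall>a\<in>A. \<exists>e. inj_on e (branch A f a) \<and> e ` branch A f a \<subseteq> B"
    using card_of_ordLeq by blast
  then obtain e where e: "\<And>a. a \<in> A \<Longrightarrow> inj_on (e a) (branch A f a)"
    "\<And>a. a \<in> A \<Longrightarrow> e a ` branch A f a \<subseteq> B" by metis
  obtain g where g: "inj_on g C" "g ` C \<subseteq> Pow B" using C card_of_ordLeq[of C "Pow B"] by blast
  have PA: "branch A f a \<subseteq> A" for a using branch_iff by blast
  \<comment> \<open>The three parts of the code: the copied branch, its order, and the colour of
    each finite subset together with the top. \<open>g\<close> writes a colour as a subset of
    \<open>B\<close>, so the last part is a relation.\<close>
  define c\<^sub>1 where "c\<^sub>1 a = e a ` branch A f a" for a
  define c\<^sub>2 where "c\<^sub>2 a = {(e a x, e a y) | x y. x \<in> branch A f a \<and> y \<in> branch A f a \<and> x \<sqsubset> y}" for a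
  define c\<^sub>3 where "c\<^sub>3 a = {(e a ` s, b) | s b. s \<in> Fpow (branch A f a) \<and> b \<in> g (f (insert a s))}" for a
  have ins: "f (insert a s) \<in> C" if "a \<in> A" "s \<in> Fpow (branch A f a)" for a s
    using that PA[of a] by (intro f) (auto simp: Fpow_def)
  have "inj_on (\<lambda>a. (c\<^sub>1 a, c\<^sub>2 a, c\<^sub>3 a)) A"
  proof (rule inj_onI)
    fix a a' assume a: "a \<in> A" "a' \<in> A" and "(c\<^sub>1 a, c\<^sub>2 a, c\<^sub>3 a) = (c\<^sub>1 a', c\<^sub>2 a', c\<^sub>3 a')"
    then have eq: "c\<^sub>1 a = c\<^sub>1 a'" "c\<^sub>2 a = c\<^sub>2 a'" "c\<^sub>3 a = c\<^sub>3 a'" by auto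
    let ?P = "branch A f a" and ?P' = "branch A f a'"
    define p where "p x = inv_into ?P' (e a') (e a x)" for x
    have ep: "p x \<in> ?P'" "e a' (p x) = e a x" if "x \<in> ?P" for x
    proof -
      have "e a x \<in> e a' ` ?P'" using eq(1) that by (auto simp: c\<^sub>1_def)
      then show "p x \<in> ?P'" "e a' (p x) = e a x"
        unfolding p_def by (auto intro: inv_into_into f_inv_into_f)
    qed
    have inj: "inj_on p ?P" using ep e(1)[OF a(1)] by (metis inj_onI inj_onD)
    have surj: "?P' \<subseteq> p ` ?P"
    proof
      fix y assume y: "y \<in> ?P'"
      then have "e a' y \<in> e a ` ?P" using eq(1) by (auto simp: c\<^sub>1_def)
      then obtain x where x: "x \<in> ?P" "e a' y = e a x" by auto
      then have "p x = y" using y e(1)[OF a(2)] by (simp add: p_def flip: x(2))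
      then show "y \<in> p ` ?P" using x(1) by auto
    qed
    show "a = a'"
    proof (rule branch_code_inj[OF a])
      show "bij_betw p ?P ?P'" using inj surj ep(1) by (auto simp: bij_betw_def)
      show "p x \<sqsubset> p y \<longleftrightarrow> x \<sqsubset> y" if xy: "x \<in> ?P" "y \<in> ?P" for x y
      proof -
        have "x \<sqsubset> y \<longleftrightarrow> (e a x, e a y) \<in> c\<^sub>2 a"
          using xy inj_onD[OF e(1)[OF a(1)]] by (auto simp: c\<^sub>2_def)
        also have "\<dots> \<longleftrightarrow> (e a' (p x), e a' (p y)) \<in> c\<^sub>2 a'" using ep xy eq(2) by simp
        also have "\<dots> \<longleftrightarrow> p x \<sqsubset> p y"
          using ep(1)[OF xy(1)] ep(1)[OF xy(2)] inj_onD[OF e(1)[OF a(2)]] by (auto simp: c\<^sub>2_def)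
        finally show ?thesis by simp
      qed
      fix s assume s: "s \<in> Fpow ?P"
      have ps: "p ` s \<in> Fpow ?P'" "e a' ` p ` s = e a ` s"
        using s ep by (auto simp: Fpow_def image_image subset_iff)
      have code: "b \<in> g (f (insert a'' t)) \<longleftrightarrow> (e a'' ` t, b) \<in> c\<^sub>3 a''"
        if t: "a'' \<in> A" "t \<in> Fpow (branch A f a'')" for a'' t b
      proof -
        have "t' = t" if "e a'' ` t = e a'' ` t'" "t' \<in> Fpow (branch A f a'')" for t'
          using inj_on_image_eq_iff[OF e(1)[OF t(1)], of t' t] that t(2) by (auto simp: Fpow_def)
        then show ?thesis using t by (auto simp: c\<^sub>3_def)
      qed
      have "g (f (insert a s)) = g (f (insert a' (p ` s)))"
        using code[OF a(1) s] code[OF a(2) ps(1)] ps(2) eq(3) by auto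
      then show "f (insert a s) = f (insert a' (p ` s))"
        using inj_onD[OF g(1)] ins[OF a(1) s] ins[OF a(2) ps(1)] by blast
    qed
  qed
  moreover have "(c\<^sub>1 a, c\<^sub>2 a, c\<^sub>3 a) \<in> Pow B \<times> Pow (B \<times> B) \<times> Pow (Fpow B \<times> B)" if a: "a \<in> A" for a
  proof -
    have "c\<^sub>1 a \<subseteq> B" using e(2)[OF a] by (simp add: c\<^sub>1_def)
    moreover have "c\<^sub>2 a \<subseteq> B \<times> B" using e(2)[OF a] by (auto simp: c\<^sub>2_def)
    moreover have "c\<^sub>3 a \<subseteq> Fpow B \<times> B"
    proof
      fix z assume "z \<in> c\<^sub>3 a"
      then obtain s b where z: "z = (e a ` s, b)" "s \<in> Fpow (branch A f a)" "b \<in> g (f (insert a s))"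
        by (auto simp: c\<^sub>3_def)
      then have "g (f (insert a s)) \<subseteq> B" using ins[OF a z(2)] g(2) by auto
      moreover have "e a ` s \<in> Fpow B" using z(2) e(2)[OF a] by (auto simp: Fpow_def)
      ultimately show "z \<in> Fpow B \<times> B" using z by auto
    qed
    ultimately show ?thesis by blast
  qed
  ultimately have le: "|A| \<le>o |Pow B \<times> Pow (B \<times> B) \<times> Pow (Fpow B \<times> B)|" by (rule card_of_ordLeqI)
  have Bi: "Cinfinite |B|" "Cinfinite |Pow B|"
    using B(1) by (auto simp: cinfinite_def Field_card_of card_of_card_order_on)
  have refl: "|B| \<le>o |B|" "|Pow B| \<le>o |Pow B|" by (auto intro: ordLeq_refl card_of_Card_order)
  have "|Pow B \<times> Pow (B \<times> B) \<times> Pow (Fpow B \<times> B)| \<le>o |Pow B|"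
    using Bi refl by (intro Times_Cinfinite_bound card_of_Pow_mono Fpow_Cinfinite_bound)
  then have "|A| \<le>o |Pow B|" using le ordLeq_transitive by blast
  then show False using B(2) not_ordLess_ordLeq by blast
qed

end

section \<open>Sets of beth size, indexed by a well-order\<close>

lemma Well_order_simps:
  assumes "Well_order r"
  shows "trans r" "antisym r" "total_on (Field r) r" "refl_on (Field r) r"
  using assms by (auto simp: well_order_on_def linear_order_on_def partial_order_on_def
      preorder_on_def)

lemma underS_mono:
  assumes "Well_order r" "(i, j) \<in> r"
  shows "underS r i \<subseteq> underS r j"
  using assms(2) Well_order_simps(1,2)[OF assms(1)]
  unfolding underS_def by (auto dest: transD antisymD)

lemma underS_Field: "j \<in> underS r i \<Longrightarrow> j \<in> Field r"
  by (auto simp: underS_def Field_def)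

lemma Field_Restr_underS:
  assumes "Well_order r"
  shows "Field (Restr r (underS r i)) = underS r i"
proof
  show "underS r i \<subseteq> Field (Restr r (underS r i))"
  proof
    fix j assume "j \<in> underS r i"
    then have "(j, j) \<in> Restr r (underS r i)"
      using refl_onD[OF Well_order_simps(4)[OF assms] underS_Field[of j r i]] by simp
    then show "j \<in> Field (Restr r (underS r i))" by (rule FieldI1)
  qed
qed (auto simp: Field_def)

text \<open>\<open>Big r i A\<close> says that the cardinality of \<open>A\<close> is at least \<open>\<beth>\<close> at the order type of the initial
  segment of \<open>r\<close> below \<open>i\<close>.\<close>

inductive Big :: "'i rel \<Rightarrow> 'i \<Rightarrow> 'a set \<Rightarrow> bool" for r where
  "infinite A \<Longrightarrow> \<forall>j\<in>underS r i. \<exists>B :: 'a set. Big r j B \<and> |Pow B| \<le>o |A| \<Longrightarrow> Big r i A"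

lemma Big_infinite: "Big r i A \<Longrightarrow> infinite A"
  by (auto elim: Big.cases)

lemma Big_below:
  fixes A :: "'a set"
  shows "Big r i A \<Longrightarrow> j \<in> underS r i \<Longrightarrow> \<exists>B :: 'a set. Big r j B \<and> |Pow B| \<le>o |A|"
  by (erule Big.cases) simp

lemma Big_mono:
  fixes A A' :: "'a set"
  assumes "Big r i A" "|A| \<le>o |A'|"
  shows "Big r i A'"
proof (rule Big.intros)
  show "infinite A'" using card_of_ordLeq_infinite[OF assms(2) Big_infinite[OF assms(1)]] .
  show "\<forall>j\<in>underS r i. \<exists>B :: 'a set. Big r j B \<and> |Pow B| \<le>o |A'|"
    using Big_below[OF assms(1)] ordLeq_transitive[OF _ assms(2)] by blast
qed

lemma Big_antimono:
  fixes A :: "'a set"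
  assumes r: "Well_order r" and A: "Big r i A" and "(j, i) \<in> r"
  shows "Big r j A"
proof (rule Big.intros)
  show "infinite A" using Big_infinite[OF A] .
  have "underS r j \<subseteq> underS r i" by (rule underS_mono[OF r assms(3)])
  then show "\<forall>k\<in>underS r j. \<exists>B :: 'a set. Big r k B \<and> |Pow B| \<le>o |A|"
    using Big_below[OF A] by blast
qed

text \<open>The inequality between an ordinal and \<beth> at that ordinal. If \<open>A\<close> were
  smaller than the segment below \<open>i\<close>, then \<open>|A| \<le>o |underS r j|\<close> for
  some \<open>j\<close> below \<open>i\<close>; induction gives \<open>B\<close> with
  \<open>|underS r j| \<le>o |B|\<close> and \<open>|Pow B| \<le>o |A|\<close>, contradicting
  Cantor's theorem.\<close>

lemma Big_ge_index:
  fixes A :: "'a set"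
  assumes r: "Well_order r"
  shows "Big r i A \<Longrightarrow> |underS r i| \<le>o |A|"
proof (induction rule: Big.induct)
  case (1 A i)
  show ?case
  proof (rule ccontr)
    assume "\<not> |underS r i| \<le>o |A|"
    then have lt: "|A| <o |underS r i|" by (simp add: card_of_Well_order flip: not_ordLeq_iff_ordLess)
    let ?q = "Restr r (underS r i)"
    have q: "Well_order ?q" using r by (rule Well_order_Restr)
    have "|underS r i| \<le>o ?q"
      using card_of_least[of "underS r i" ?q] q Field_Restr_underS[OF r, of i] by simp
    then have "|A| <o ?q" using ordLess_ordLeq_trans[OF lt] by blast
    then obtain j where j: "j \<in> Field ?q" "|A| =o Restr ?q (underS ?q j)"
      using ordLess_iff_ordIso_Restr[OF q card_of_Well_order, of A] by blast
    have "|A| \<le>o |Field (Restr ?q (underS ?q j))|"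
      using card_of_mono2[OF ordIso_imp_ordLeq[OF j(2)]] by (simp add: Field_card_of)
    moreover have "Field (Restr ?q (underS ?q j)) \<subseteq> underS r j"
      by (auto simp: Field_def underS_def)
    ultimately have Aj: "|A| \<le>o |underS r j|" using ordLeq_transitive[OF _ card_of_mono1] by blast
    have "j \<in> underS r i" using j(1) Field_Restr_underS[OF r] by simp
    then obtain B :: "'a set" where B: "|underS r j| \<le>o |B|" "|Pow B| \<le>o |A|" using 1 by blast
    then have "|A| <o |A|"
      using ordLeq_ordLess_trans[OF ordLeq_transitive[OF Aj B(1)]
          ordLess_ordLeq_trans[OF card_of_Pow B(2)]] by simp
    then show False using ordLess_irreflexive by blast
  qed
qed

lemma exists_subset_card:
  assumes "Card_order d" "d \<le>o |A|"
  shows "\<exists>B\<subseteq>A. |B| =o d"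
proof -
  have "|Field d| \<le>o |A|" by (rule ordIso_ordLeq_trans[OF card_of_Field_ordIso[OF assms(1)] assms(2)])
  then obtain B where "B \<subseteq> A" "|Field d| =o |B|" using internalize_card_of_ordLeq2[of "Field d" A] by auto
  then show ?thesis
    using ordIso_transitive[OF ordIso_symmetric card_of_Field_ordIso[OF assms(1)]] by blast
qed

lemma Restr_Restr_underS:
  assumes "Well_order r" "j \<in> underS r i"
  shows "Restr (Restr r (underS r i)) (underS (Restr r (underS r i)) j) = Restr r (underS r j)"
proof -
  have T: "trans r" "antisym r" using Well_order_simps[OF assms(1)] by auto
  have "underS (Restr r (underS r i)) j = underS r j"
    using assms(2) T by (auto simp: underS_def dest: transD antisymD)
  moreover have "underS r j \<subseteq> underS r i"
    using assms(2) T by (auto simp: underS_def dest: transD antisymD)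
  ultimately show ?thesis by auto
qed

lemma is_beth_Card_order: "is_beth r c \<Longrightarrow> Card_order c"
  by (erule is_beth.cases) (auto simp: is_card_Sup_def)

text \<open>\<open>is_beth\<close> descends to new well-orders and speaks of cardinals on another
  type; \<open>Big\<close> keeps \<open>r\<close> fixed, moves the index and speaks of sets over the
  type to be coloured. In the successor case \<open>d\<close> is realized by a subset of
  \<open>A\<close> at the greatest index \<open>j\<close>, and the other indices follow by
  monotonicity.\<close>

lemma is_beth_imp_Big:
  fixes A :: "'a set"
  assumes "is_beth r' c" and r: "Well_order r" and "i \<in> Field r" and "r' = Restr r (underS r i)"
    and "c \<le>o |A|"
  shows "Big r i A"
  using assms(1,3-)
proof (induction r' c arbitrary: i A rule: is_beth.induct)
  case (zero r' c)
  have "underS r i = {}" using zero Field_Restr_underS[OF r, of i] by simp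
  moreover have "natLeq \<le>o |A|"
    by (rule ordIso_ordLeq_trans[OF ordIso_symmetric[OF zero(4)] zero(7)])
  then have "infinite A" using infinite_iff_natLeq_ordLeq[of A] by blast
  ultimately show ?case by (intro Big.intros) auto
next
  case (succ r' j d c)
  have j: "j \<in> underS r i" using succ.hyps(2) succ.prems(2) Field_Restr_underS[OF r, of i] by simp
  have jF: "j \<in> Field r" using j by (rule underS_Field)
  have d: "Card_order d" using is_beth_Card_order[OF succ.hyps(4)] .
  have cA: "ctwo ^c d \<le>o |A|"
    by (rule ordIso_ordLeq_trans[OF ordIso_symmetric[OF succ.hyps(6)] succ.prems(3)])
  then have "d \<le>o |A|"
    by (rule ordLeq_transitive[OF ordLess_imp_ordLeq[OF ordLess_ctwo_cexp[OF d]]])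
  then obtain B where B: "B \<subseteq> A" "|B| =o d" using exists_subset_card[OF d] by blast
  have Bj: "Big r j B"
  proof (rule succ.IH[OF jF])
    show "Restr r' (underS r' j) = Restr r (underS r j)"
      using succ.prems(2) Restr_Restr_underS[OF r j] by simp
    show "d \<le>o |B|" using ordIso_imp_ordLeq[OF ordIso_symmetric[OF B(2)]] .
  qed
  have "|Pow B| =o ctwo ^c |B|" unfolding ctwo_def cexp_def Field_card_of by (rule card_of_Pow_Func)
  moreover have BD: "ctwo ^c |B| =o ctwo ^c d"
    using B(2) d by (intro cexp_cong2) (auto simp: Card_order_ctwo card_of_Card_order)
  ultimately have PB: "|Pow B| \<le>o |A|"
    using ordIso_ordLeq_trans[OF _ ordIso_ordLeq_trans[OF BD cA]] by blast
  show ?case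
  proof (rule Big.intros)
    show "infinite A"
      using Big_infinite[OF Bj] B(1) finite_subset by blast
    show "\<forall>k\<in>underS r i. \<exists>B :: 'a set. Big r k B \<and> |Pow B| \<le>o |A|"
    proof
      fix k assume k: "k \<in> underS r i"
      then have "k \<in> Field r'" using succ.prems(2) Field_Restr_underS[OF r, of i] by simp
      then have "(k, j) \<in> r" using succ.hyps(3) succ.prems(2) by blast
      then show "\<exists>B :: 'a set. Big r k B \<and> |Pow B| \<le>o |A|" using Big_antimono[OF r Bj] PB by blast
    qed
  qed
next
  case (limit r' F c)
  have above: "Big r k A" if k: "k \<in> Field r'" for k
  proof -
    have ku: "k \<in> underS r i" using k limit.prems(2) Field_Restr_underS[OF r, of i] by simp
    have "F k \<le>o c" using limit.hyps k by (auto simp: is_card_Sup_def)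
    then have "F k \<le>o |A|" using ordLeq_transitive[OF _ limit.prems(3)] by blast
    moreover have "k \<in> Field r" using ku by (rule underS_Field)
    moreover have "Restr r' (underS r' k) = Restr r (underS r k)"
      using limit.prems(2) Restr_Restr_underS[OF r ku] by simp
    ultimately show ?thesis using limit.IH k by blast
  qed
  show ?case
  proof (rule Big.intros)
    show "infinite A" using limit.hyps(2) Big_infinite[OF above] by blast
    show "\<forall>k\<in>underS r i. \<exists>B :: 'a set. Big r k B \<and> |Pow B| \<le>o |A|"
    proof
      fix k assume k: "k \<in> underS r i"
      then have "k \<in> Field r'" using limit.prems(2) Field_Restr_underS[OF r, of i] by simp
      then obtain l where l: "l \<in> Field r'" "(k, l) \<in> r'" "k \<noteq> l" using limit.hyps(3) by blast
      then have "k \<in> underS r l" using limit.prems(2) by (auto simp: underS_def)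
      then show "\<exists>B :: 'a set. Big r k B \<and> |Pow B| \<le>o |A|" using Big_below[OF above[OF l(1)]] by blast
    qed
  qed
qed

text \<open>The order type of all of \<open>r\<close> has no index in \<open>r\<close>, so \<beth>
  at that order type is expressed as being \<open>Big\<close> at every index. With no greatest
  element and a nonempty field only the limit clause can apply.\<close>

lemma is_beth_limit_Big:
  fixes A :: "'a set"
  assumes b: "is_beth r c" and lim: "\<forall>i\<in>Field r. \<exists>j\<in>Field r. (i, j) \<in> r \<and> i \<noteq> j"
    and r: "Well_order r" and "c \<le>o |A|" and i: "i \<in> Field r"
  shows "Big r i A"
  using b
proof cases
  case zero
  then show ?thesis using i by blast
next
  case (succ j d)
  obtain k where k: "k \<in> Field r" "(j, k) \<in> r" "j \<noteq> k" using lim succ by blast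
  moreover have "(k, j) \<in> r" using succ k(1) by blast
  ultimately have False
    using Well_order_simps(2)[OF r] by (auto dest: antisymD)
  then show ?thesis ..
next
  case (limit F)
  then have "F i \<le>o c" using i by (auto simp: is_card_Sup_def)
  then have "F i \<le>o |A|" using ordLeq_transitive[OF _ assms(4)] by blast
  then show ?thesis using is_beth_imp_Big[OF _ r i refl, of "F i" A] limit(4) i by blast
qed

section \<open>Homogeneous sets and coherent colours\<close>

context strict_wellorder
begin

text \<open>Induction on \<open>n\<close>: on a long branch with top \<open>a\<close>, the colour of
  a set of \<open>Suc n\<close> elements does not change when its greatest element is replaced by
  \<open>a\<close>, so homogeneity of \<open>f (insert a s)\<close> for \<open>n\<close> elements
  suffices. The level \<open>k\<close> is found uniformly, before \<open>A\<close> and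
  \<open>f\<close>; each step costs two levels. From \<open>i\<^sub>0\<close> on there are few
  enough colours for \<open>exists_long_branch\<close>.\<close>

lemma Erdos_Rado_Big:
  fixes C :: "'c set" and r :: "'i rel"
  assumes r: "Well_order r" and lim: "\<forall>i\<in>Field r. \<exists>j\<in>Field r. (i, j) \<in> r \<and> i \<noteq> j"
    and C: "\<And>A :: 'a set. Big r i\<^sub>0 A \<Longrightarrow> |C| \<le>o |Pow A|"
    and i: "i \<in> Field r" "(i\<^sub>0, i) \<in> r"
  shows "\<exists>k\<in>Field r. (i, k) \<in> r \<and> (\<forall>A :: 'a set. \<forall>f. Big r k A \<and> f ` Fpow A \<subseteq> C \<longrightarrow>
    (\<exists>H\<subseteq>A. Big r i H \<and> (\<exists>c. \<forall>s\<in>Fpow H. card s = n \<longrightarrow> f s = c)))"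
proof (induction n)
  case 0
  have "(i, i) \<in> r" using Well_order_simps(4)[OF r] i(1) by (auto dest: refl_onD)
  moreover have "\<forall>s\<in>Fpow A. card s = 0 \<longrightarrow> f s = f {}" for A :: "'a set" and f :: "'a set \<Rightarrow> 'c"
    by (auto simp: Fpow_def)
  ultimately show ?case using i(1) by blast
next
  case (Suc n)
  have T: "trans r" by (rule Well_order_simps[OF r])
  obtain k where k: "k \<in> Field r" "(i, k) \<in> r"
    and hom: "\<And>(A :: 'a set) f. Big r k A \<Longrightarrow> f ` Fpow A \<subseteq> C \<Longrightarrow>
      \<exists>H\<subseteq>A. Big r i H \<and> (\<exists>c. \<forall>s\<in>Fpow H. card s = n \<longrightarrow> f s = c)"
    using Suc by blast
  obtain k\<^sub>1 where k1: "k\<^sub>1 \<in> Field r" "(k, k\<^sub>1) \<in> r" "k \<noteq> k\<^sub>1" using lim k(1) by blast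
  obtain k\<^sub>2 where k2: "k\<^sub>2 \<in> Field r" "(k\<^sub>1, k\<^sub>2) \<in> r" "k\<^sub>1 \<noteq> k\<^sub>2" using lim k1(1) by blast
  have "\<exists>H\<subseteq>A. Big r i H \<and> (\<exists>c. \<forall>s\<in>Fpow H. card s = Suc n \<longrightarrow> f s = c)"
    if A: "Big r k\<^sub>2 A" and f: "f ` Fpow A \<subseteq> C" for A :: "'a set" and f
  proof -
    \<comment> \<open>One level gives only \<open>|Pow B\<^sub>1| \<le>o |A|\<close>; the second,
      through Cantor's theorem, gives the strict inequality that a long branch requires.\<close>
    obtain B\<^sub>1 :: "'a set" where B1: "Big r k\<^sub>1 B\<^sub>1" "|Pow B\<^sub>1| \<le>o |A|"
      using Big_below[OF A, of k\<^sub>1] k2 by (auto simp: underS_def)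
 obtain B :: "'a set" where B: "Big r k B" "|Pow B| \<le>o |B\<^sub>1|"
      using Big_below[OF B1(1), of k] k1 by (auto simp: underS_def)
    have "|Pow B| <o |A|"
      using ordLeq_ordLess_trans[OF B(2) ordLess_ordLeq_trans[OF card_of_Pow B1(2)]] .
    moreover have "Big r i\<^sub>0 B" using Big_antimono[OF r B(1) transD[OF T i(2) k(2)]] .
    ultimately obtain a where a: "a \<in> A" "|B| <o |branch A f a|"
      using exists_long_branch[of B A C f] Big_infinite[OF B(1)] C f by blast
    let ?H = "branch A f a"
    have HA: "?H \<subseteq> A" using branch_iff by blast
    have "Big r k ?H" using Big_mono[OF B(1) ordLess_imp_ordLeq[OF a(2)]] .
    moreover have "(\<lambda>s. f (insert a s)) ` Fpow ?H \<subseteq> C"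
      using f a(1) HA by (auto simp: Fpow_def)
    ultimately obtain H c where H: "H \<subseteq> ?H" "Big r i H"
      "\<forall>s\<in>Fpow H. card s = n \<longrightarrow> f (insert a s) = c"
      using hom[of ?H "\<lambda>s. f (insert a s)"] by blast
    have "f t = c" if t: "t \<in> Fpow H" "card t = Suc n" for t
    proof -
      have "finite t" "t \<noteq> {}" using t by (auto simp: Fpow_def)
      then obtain x where x: "x \<in> t" "\<forall>y\<in>t. y \<noteq> x \<longrightarrow> y \<sqsubset> x" using finite_has_max by blast
      let ?s = "t - {x}"
      have s: "?s \<in> Fpow H" "card ?s = n" using t x(1) by (auto simp: Fpow_def)
      then have "?s \<in> Fpow ?H" using H(1) by (auto simp: Fpow_def)
      moreover have "x \<in> ?H" using x(1) t(1) H(1) by (auto simp: Fpow_def)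
      ultimately have "f (insert x ?s) = f (insert a ?s)"
        using branch_iff[of x A f a] x(2) by auto
      moreover have "insert x ?s = t" using x(1) by auto
      ultimately show ?thesis using H(3) s by auto
    qed
    then have "\<forall>s\<in>Fpow H. card s = Suc n \<longrightarrow> f s = c" by simp
    then show ?thesis using H(2) subset_trans[OF H(1) HA] by (intro exI[of _ H] conjI exI[of _ c])
  qed
  moreover have "(i, k\<^sub>2) \<in> r" using transD[OF T transD[OF T k(2) k1(2)] k2(2)] .
  ultimately show ?case using k2(1) by (intro bexI[of _ k\<^sub>2] conjI allI impI) auto
qed

text \<open>The colours are chosen one length at a time, keeping homogeneous sets at every level of
  \<open>r\<close>. At each level some colour works for the next length. If no colour worked at all
  levels, each would fail from some level on; by regularity of the successor of \<open>m\<close>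
  these at most \<open>m\<close> levels have a common bound, where no colour works.\<close>

lemma coherent_colours:
  fixes m :: "'m rel" and C :: "'c set" and A :: "'a set"
  assumes m: "Cinfinite m" and C: "|C| \<le>o m" and A: "\<And>i. i \<in> Field (cardSuc m) \<Longrightarrow> Big (cardSuc m) i A"
    and f: "f ` Fpow A \<subseteq> C"
  shows "\<exists>t. \<forall>n. \<exists>H\<subseteq>A. infinite H \<and> (\<forall>s\<in>Fpow H. card s \<le> n \<longrightarrow> f s = t (card s))"
proof -
  define r where "r = cardSuc m"
  have r: "Cinfinite r" "Well_order r" "m <o r"
    using m Cinfinite_cardSuc cardSuc_greater by (auto simp: r_def cardSuc_Well_order)
  have T: "trans r" "refl_on (Field r) r" "total_on (Field r) r"
    using Well_order_simps[OF r(2)] by auto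
  have lim: "\<forall>i\<in>Field r. \<exists>j\<in>Field r. (i, j) \<in> r \<and> i \<noteq> j"
    using infinite_Card_order_limit[of r] r(1) by (auto simp: cinfinite_def)
  \<comment> \<open>The level whose segment has order type \<open>m\<close>: a set that is
    \<open>Big\<close> there has at least \<open>m\<close> elements, so the colours inject into its
    power set.\<close>
  obtain i\<^sub>0 where i0: "i\<^sub>0 \<in> Field r" "m =o Restr r (underS r i\<^sub>0)"
    using ordLess_iff_ordIso_Restr[OF r(2), of m] m r(3) by (auto simp: card_order_on_def)
  have Ci: "|C| \<le>o |Pow B|" if B: "Big r i\<^sub>0 B" for B :: "'a set"
  proof -
    have "|C| \<le>o |Field m|"
      using ordLeq_ordIso_trans[OF C ordIso_symmetric[OF card_of_Field_ordIso]] m by blast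
    also have "|Field m| \<le>o |Field (Restr r (underS r i\<^sub>0))|"
      using card_of_mono2[OF ordIso_imp_ordLeq[OF i0(2)]] .
    also have "|Field (Restr r (underS r i\<^sub>0))| \<le>o |underS r i\<^sub>0|"
      by (rule card_of_mono1) (simp add: Field_Restr_underS[OF r(2)])
    also have "|underS r i\<^sub>0| \<le>o |B|" by (rule Big_ge_index[OF r(2) B])
    also have "|B| \<le>o |Pow B|" by (rule ordLess_imp_ordLeq[OF card_of_Pow])
    finally show ?thesis .
  qed
  \<comment> \<open>The list \<open>l\<close> holds the colours of sets with fewer than
    \<open>length l\<close> elements, so the next entry concerns sets of exactly
    \<open>length l\<close> elements.\<close>
  define Q where "Q l \<longleftrightarrow> (\<forall>i\<in>Field r. \<exists>H\<subseteq>A. Big r i H \<and>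
    (\<forall>s\<in>Fpow H. card s < length l \<longrightarrow> f s = l ! card s))" for l :: "'c list"
  have step: "\<exists>c. Q (l @ [c])" if Q: "Q l" for l
  proof -
    define W where "W i c \<longleftrightarrow> (\<exists>H\<subseteq>A. Big r i H \<and>
      (\<forall>s\<in>Fpow H. card s < Suc (length l) \<longrightarrow> f s = (l @ [c]) ! card s))" for i c
    have Wmono: "W j c" if "W i c" "(j, i) \<in> r" for i j c
      using that Big_antimono[OF r(2)] unfolding W_def by blast
    have "\<exists>c\<in>C. W i c" if i: "i \<in> Field r" "(i\<^sub>0, i) \<in> r" for i
    proof -
      obtain k where k: "k \<in> Field r" "(i, k) \<in> r"
        and hom: "\<And>(A :: 'a set) f. Big r k A \<Longrightarrow> f ` Fpow A \<subseteq> C \<Longrightarrow>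
          \<exists>H\<subseteq>A. Big r i H \<and> (\<exists>c. \<forall>s\<in>Fpow H. card s = length l \<longrightarrow> f s = c)"
        using Erdos_Rado_Big[OF r(2) lim Ci i, of "length l"] by blast
      obtain H where H: "H \<subseteq> A" "Big r k H" "\<forall>s\<in>Fpow H. card s < length l \<longrightarrow> f s = l ! card s"
        using Q k(1) unfolding Q_def by blast
      have "f ` Fpow H \<subseteq> C" using f H(1) by (auto simp: Fpow_def)
      then obtain H' c where H': "H' \<subseteq> H" "Big r i H'" "\<forall>s\<in>Fpow H'. card s = length l \<longrightarrow> f s = c"
        using hom[OF H(2), of f] by blast
      obtain s where s: "finite s" "card s = length l" "s \<subseteq> H'"
        using infinite_arbitrarily_large[OF Big_infinite[OF H'(2)]] by blast
      then have "s \<in> Fpow H'" "s \<in> Fpow A" using H'(1) H(1) by (auto simp: Fpow_def)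
      then have "c \<in> C" using H'(3) s(2) f by auto
      moreover have "W i c"
        unfolding W_def
      proof (intro exI[of _ H'] conjI ballI impI)
        show "H' \<subseteq> A" "Big r i H'" using H' H(1) by auto
        fix s assume "s \<in> Fpow H'" "card s < Suc (length l)"
        moreover then have "s \<in> Fpow H" using H'(1) by (auto simp: Fpow_def)
        ultimately show "f s = (l @ [c]) ! card s"
          using H(3) H'(3) by (auto simp: nth_append less_Suc_eq)
      qed
      ultimately show ?thesis by blast
    qed
    \<comment> \<open>Levels below \<open>i\<^sub>0\<close> are reached from higher ones, since
      \<open>W\<close> is inherited downwards.\<close>
    moreover have "\<exists>j\<in>Field r. (i, j) \<in> r \<and> (i\<^sub>0, j) \<in> r" if "i \<in> Field r" for i
      using that i0(1) T(2,3) unfolding total_on_def refl_on_def by metis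
    ultimately have ex: "\<exists>c\<in>C. W i c" if "i \<in> Field r" for i
      using that Wmono by meson
    have "\<exists>c\<in>C. \<forall>i\<in>Field r. W i c"
    proof (rule ccontr)
      assume "\<not> ?thesis"
      then have "\<forall>c\<in>C. \<exists>i\<in>Field r. \<not> W i c" by blast
      then obtain b where b: "\<And>c. c \<in> C \<Longrightarrow> b c \<in> Field r" "\<And>c. c \<in> C \<Longrightarrow> \<not> W (b c) c" by metis
      define As where "As i = {j. (j, i) \<in> r}" for i
      have "\<exists>i\<in>Field (cardSuc m). b ` C \<subseteq> As i"
      proof (rule cardSuc_UNION)
        show "Card_order m" "infinite (Field m)" using m by (auto simp: cinfinite_def)
        show "relChain (cardSuc m) As"
          using T(1) by (auto simp: relChain_def As_def r_def dest: transD)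
        show "|b ` C| \<le>o m" by (rule image_bound[OF C])
        show "b ` C \<subseteq> (\<Union>i\<in>Field (cardSuc m). As i)"
          using b(1) T(2) by (auto simp: As_def r_def refl_on_def)
      qed
      then obtain i where i: "i \<in> Field r" "\<And>c. c \<in> C \<Longrightarrow> (b c, i) \<in> r"
        by (auto simp: As_def r_def)
      obtain c where "c \<in> C" "W i c" using ex[OF i(1)] by blast
      then show False using Wmono i(2) b(2) by blast
    qed
    then show ?thesis unfolding W_def Q_def by auto
  qed
  then obtain nx where nx: "\<And>l. Q l \<Longrightarrow> Q (l @ [nx l])" by metis
  define L where "L n = ((\<lambda>l. l @ [nx l]) ^^ n) []" for n
  have L0: "L 0 = []" and LS: "L (Suc n) = L n @ [nx (L n)]" for n by (auto simp: L_def)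
  have Q0: "Q []" unfolding Q_def using A by (auto simp: r_def)
  have QL: "Q (L n)" for n
    by (induction n) (auto simp: L0 LS Q0 nx)
  have len: "length (L n) = n" for n
    by (induction n) (auto simp: L0 LS)
  \<comment> \<open>\<open>L (Suc k)\<close> is the first list long enough to have an entry
    \<open>k\<close>, and later lists keep it.\<close>
  have nth: "k < n \<Longrightarrow> L n ! k = L (Suc k) ! k" for k n
  proof (induction n)
    case (Suc n)
    then show ?case by (cases "k = n") (auto simp: LS[of n] nth_append len)
  qed simp
  obtain i where i: "i \<in> Field r" using i0(1) by blast
  have "\<exists>H\<subseteq>A. infinite H \<and> (\<forall>s\<in>Fpow H. card s \<le> n \<longrightarrow> f s = L (Suc (card s)) ! card s)" for n
  proof -
    obtain H where H: "H \<subseteq> A" "Big r i H" "\<forall>s\<in>Fpow H. card s < Suc n \<longrightarrow> f s = L (Suc n) ! card s"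
      using QL[of "Suc n"] i unfolding Q_def len by blast
    have "f s = L (Suc (card s)) ! card s" if "s \<in> Fpow H" "card s \<le> n" for s
      using H(3) nth[of "card s" "Suc n"] that by auto
    then show ?thesis using H(1) Big_infinite[OF H(2)] by blast
  qed
  then show ?thesis by (intro exI[of _ "\<lambda>k. L (Suc k) ! k"]) blast
qed

end

section \<open>Ehrenfeucht--Mostowski models\<close>

context strict_wellorder
begin

definition increasing :: "('a \<Rightarrow> 'a) \<Rightarrow> 'a set \<Rightarrow> bool" where
  "increasing \<sigma> w \<longleftrightarrow> (\<forall>x\<in>w. \<forall>y\<in>w. x \<sqsubset> y \<longrightarrow> \<sigma> x \<sqsubset> \<sigma> y)"

lemma increasing_iff: "increasing \<sigma> w \<Longrightarrow> x \<in> w \<Longrightarrow> y \<in> w \<Longrightarrow> \<sigma> x \<sqsubset> \<sigma> y \<longleftrightarrow> x \<sqsubset> y"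
  unfolding increasing_def using total[of x y] irrefl trans by metis

lemma increasing_inj: "increasing \<sigma> w \<Longrightarrow> inj_on \<sigma> w"
  unfolding increasing_def using total irrefl by (metis inj_onI)

lemma increasing_subset: "increasing \<sigma> w \<Longrightarrow> u \<subseteq> w \<Longrightarrow> increasing \<sigma> u"
  unfolding increasing_def by blast

lemma exists_increasing:
  "finite w \<Longrightarrow> finite s \<Longrightarrow> card s = card w \<Longrightarrow> \<exists>\<sigma>. increasing \<sigma> w \<and> \<sigma> ` w = s"
proof (induction "card w" arbitrary: w s)
  case 0
  then show ?case by (auto simp: increasing_def)
next
  case (Suc n)
  then have ne: "w \<noteq> {}" "s \<noteq> {}" by auto
  obtain x where x: "x \<in> w" "\<forall>y\<in>w. y \<noteq> x \<longrightarrow> y \<sqsubset> x"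
    using finite_has_max[OF Suc.prems(1) ne(1)] by blast
  obtain z where z: "z \<in> s" "\<forall>y\<in>s. y \<noteq> z \<longrightarrow> y \<sqsubset> z"
    using finite_has_max[OF Suc.prems(2) ne(2)] by blast
  have "\<exists>\<sigma>. increasing \<sigma> (w - {x}) \<and> \<sigma> ` (w - {x}) = s - {z}"
    using Suc x(1) z(1) by (intro Suc.hyps(1)) auto
  then obtain \<sigma> where \<sigma>: "increasing \<sigma> (w - {x})" "\<sigma> ` (w - {x}) = s - {z}" by blast
  let ?\<sigma> = "\<sigma>(x := z)"
  have "?\<sigma> ` w = insert z (\<sigma> ` (w - {x}))" using x(1) by auto
  then have im: "?\<sigma> ` w = s" using \<sigma>(2) z(1) by auto
  have "?\<sigma> a \<sqsubset> ?\<sigma> b" if ab: "a \<in> w" "b \<in> w" "a \<sqsubset> b" for a b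
  proof (cases "b = x")
    case True
    then have "a \<noteq> x" using ab irrefl by auto
    then have "\<sigma> a \<in> s - {z}" using ab \<sigma>(2) by auto
    then show ?thesis using z(2) True \<open>a \<noteq> x\<close> by auto
  next
    case False
    then have "b \<sqsubset> x" using ab x by auto
    then have "a \<noteq> x" using ab trans irrefl by blast
    then show ?thesis using \<sigma>(1) False ab unfolding increasing_def by auto
  qed
  then show ?case using im unfolding increasing_def by blast
qed

definition pos :: "'a set \<Rightarrow> 'a \<Rightarrow> nat" where
  "pos s x = card {y \<in> s. y \<sqsubset> x}"

text \<open>Addresses a subset of \<open>s\<close> by ranks, so that corresponding subsets of two
  finite sets of the same size get the same name.\<close>

definition sel :: "'a set \<Rightarrow> nat set \<Rightarrow> 'a set" where
  "sel s v = {x \<in> s. pos s x \<in> v}"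

lemma pos_less: "finite s \<Longrightarrow> x \<in> s \<Longrightarrow> pos s x < card s"
  unfolding pos_def using irrefl by (intro psubset_card_mono) auto

lemma pos_mono:
  assumes "finite s" "x \<in> s" "x \<sqsubset> y"
  shows "pos s x < pos s y"
  unfolding pos_def
proof (rule psubset_card_mono)
  show "{z \<in> s. z \<sqsubset> x} \<subset> {z \<in> s. z \<sqsubset> y}"
    using assms(2,3) irrefl[of x] trans[OF _ assms(3)] by auto
qed (use assms(1) in simp)

lemma pos_inj: "finite s \<Longrightarrow> inj_on (pos s) s"
  using pos_mono total by (metis inj_onI less_irrefl)

lemma pos_increasing:
  assumes "increasing \<sigma> w" "x \<in> w"
  shows "pos (\<sigma> ` w) (\<sigma> x) = pos w x"
proof -
  have "{y \<in> \<sigma> ` w. y \<sqsubset> \<sigma> x} = \<sigma> ` {y \<in> w. y \<sqsubset> x}"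
    using increasing_iff[OF assms(1)] assms(2) by auto
  moreover have "inj_on \<sigma> {y \<in> w. y \<sqsubset> x}"
    using increasing_inj[OF assms(1)] by (rule inj_on_subset) auto
  ultimately show ?thesis by (simp add: pos_def card_image)
qed

lemma sel_increasing:
  assumes "finite w" "increasing \<sigma> w" "u \<subseteq> w"
  shows "sel (\<sigma> ` w) (pos w ` u) = \<sigma> ` u"
proof -
  have "sel (\<sigma> ` w) (pos w ` u) = \<sigma> ` {x \<in> w. pos w x \<in> pos w ` u}"
    using pos_increasing[OF assms(2)] by (auto simp: sel_def)
  also have "{x \<in> w. pos w x \<in> pos w ` u} = u"
    using inj_on_image_mem_iff[OF pos_inj[OF assms(1)] _ assms(3)] assms(3) by blast
  finally show ?thesis .
qed

end

text \<open>The models \<open>Ms s\<close> for finite sets \<open>s\<close> are enumerated by \<open>e s\<close> with codes from \<open>D\<close>. The colour of \<open>s\<close>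
  encodes the isomorphism type of the system of all \<open>Ms u\<close> with \<open>u \<subseteq> s\<close>: first the position of the
  smaller models, then functions and relations.\<close>

definition colour ::
  "('u \<Rightarrow> 'u \<Rightarrow> bool) \<Rightarrow> ('f, 'r) vocabulary \<Rightarrow> ('u set \<Rightarrow> ('u, 'f, 'r) struc) \<Rightarrow> 'd set \<Rightarrow>
    ('u set \<Rightarrow> 'd \<Rightarrow> 'u) \<Rightarrow> 'u set \<Rightarrow>
    ((nat set \<times> 'd \<times> 'd) + ('f \<times> 'd list \<times> 'd) + ('r \<times> 'd list)) set" where
  "colour lt \<tau> Ms D e s =
     Inl ` {(v, d, d'). v \<subseteq> {..<card s} \<and> d \<in> D \<and> d' \<in> D \<and>
       e (strict_wellorder.sel lt s v) d = e s d'} \<union>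
     Inr ` Inl ` {(f, ds, d). f \<in> fsyms \<tau> \<and> ds \<in> fargs \<tau> f D \<and> d \<in> D \<and>
       fint (Ms s) f (map (e s) ds) = e s d} \<union>
     Inr ` Inr ` {(R, ds). R \<in> rsyms \<tau> \<and> ds \<in> rargs \<tau> R D \<and> rint (Ms s) R (map (e s) ds)}"

text \<open>The code \<open>cst x\<close> names the element \<open>x\<close> of \<open>N\<close>, and the code \<open>d\<^sub>0\<close> names the generator.\<close>

locale ehrenfeucht_mostowski =
  aec \<tau> K prec \<theta> + strict_wellorder lt
  for \<tau> :: "('f, 'r) vocabulary"
    and K :: "('u, 'f, 'r) struc set"
    and prec :: "('u, 'f, 'r) struc \<Rightarrow> ('u, 'f, 'r) struc \<Rightarrow> bool"
    and \<theta> :: "'t rel" and lt :: "'u \<Rightarrow> 'u \<Rightarrow> bool" +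
  fixes I J :: "'u set" and N :: "('u, 'f, 'r) struc" and Ms :: "'u set \<Rightarrow> ('u, 'f, 'r) struc"
    and D :: "'d set" and e :: "'u set \<Rightarrow> 'd \<Rightarrow> 'u" and cst :: "'u \<Rightarrow> 'd" and d\<^sub>0 :: 'd
    and t :: "nat \<Rightarrow> ((nat set \<times> 'd \<times> 'd) + ('f \<times> 'd list \<times> 'd) + ('r \<times> 'd list)) set"
  assumes Ms_mono: "finite w \<Longrightarrow> w \<subseteq> I \<Longrightarrow> u \<subseteq> w \<Longrightarrow> prec (Ms u) (Ms w)"
    and e_surj: "finite w \<Longrightarrow> w \<subseteq> I \<Longrightarrow> e w ` D = univ (Ms w)"
    and cst_D: "x \<in> univ N \<Longrightarrow> cst x \<in> D"
    and e_cst: "x \<in> univ N \<Longrightarrow> finite w \<Longrightarrow> w \<subseteq> I \<Longrightarrow> e w (cst x) = x"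
    and N_prec: "prec N (Ms {})"
    and d0_D: "d\<^sub>0 \<in> D" and e_d0: "x \<in> I \<Longrightarrow> e {x} d\<^sub>0 = x"
    and homogeneous: "\<exists>H\<subseteq>I. infinite H \<and>
      (\<forall>s\<in>Fpow H. card s \<le> n \<longrightarrow> colour lt \<tau> Ms D e s = t (card s))"
    and room: "|Fpow J \<times> D| \<le>o |- univ N|"
    and bounded: "|Fpow J \<times> D| <o \<theta>"
begin

abbreviation "col \<equiv> colour lt \<tau> Ms D e"

lemma e_in: "finite w \<Longrightarrow> w \<subseteq> I \<Longrightarrow> d \<in> D \<Longrightarrow> e w d \<in> univ (Ms w)"
  using e_surj by blast

lemma e_in_mono: "finite w \<Longrightarrow> w \<subseteq> I \<Longrightarrow> u \<subseteq> w \<Longrightarrow> d \<in> D \<Longrightarrow> e u d \<in> univ (Ms w)"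
  using e_in[of u d] prec_univ[OF Ms_mono[of w u]] finite_subset[of u w] by blast

text \<open>The map sends the element with code \<open>d\<close> on one side to the element with
  code \<open>d\<close> on the other. The colour records which codes coincide, so this is well
  defined and injective; it records functions and relations, so this is an isomorphism; and it
  records how codes over subsets, addressed by rank, translate to codes over the whole set, so the
  smaller pieces correspond.\<close>

lemma colour_iso:
  assumes w: "finite w" and \<sigma>: "increasing \<sigma> w" "\<sigma> ` w \<subseteq> I" and \<rho>: "increasing \<rho> w" "\<rho> ` w \<subseteq> I"
    and c: "col (\<sigma> ` w) = col (\<rho> ` w)"
  shows "\<exists>h. is_iso \<tau> h (Ms (\<sigma> ` w)) (Ms (\<rho> ` w)) \<and>
    (\<forall>u\<subseteq>w. \<forall>d\<in>D. h (e (\<sigma> ` u) d) = e (\<rho> ` u) d)"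
proof -
  let ?s = "\<sigma> ` w" and ?s' = "\<rho> ` w"
  have fin: "finite ?s" "finite ?s'" using w by auto
  have crd: "card ?s = card w" "card ?s' = card w"
    using increasing_inj \<sigma>(1) \<rho>(1) card_image by blast+
  have st: "structure_of \<tau> (Ms ?s)" "structure_of \<tau> (Ms ?s')"
    using prec_K[OF Ms_mono[OF fin(1) \<sigma>(2) subset_refl]]
      prec_K[OF Ms_mono[OF fin(2) \<rho>(2) subset_refl]] structures by auto
  have E: "e (\<sigma> ` u) d = e ?s d' \<longleftrightarrow> e (\<rho> ` u) d = e ?s' d'"
    if "u \<subseteq> w" "d \<in> D" "d' \<in> D" for u d d'
  proof -
    have v: "pos w ` u \<subseteq> {..<card w}" using pos_less[OF w] that(1) by auto
    have "e (\<sigma> ` u) d = e ?s d' \<longleftrightarrow> Inl (pos w ` u, d, d') \<in> col ?s"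
      using v that sel_increasing[OF w \<sigma>(1) that(1)] by (auto simp: colour_def crd)
    also have "\<dots> \<longleftrightarrow> e (\<rho> ` u) d = e ?s' d'"
      using v that sel_increasing[OF w \<rho>(1) that(1)] unfolding c by (auto simp: colour_def crd)
    finally show ?thesis .
  qed
  define h where "h y = e ?s' (SOME d. d \<in> D \<and> e ?s d = y)" for y
  have h: "h (e ?s d) = e ?s' d" if d: "d \<in> D" for d
  proof -
    let ?d = "SOME d'. d' \<in> D \<and> e ?s d' = e ?s d"
    have "?d \<in> D \<and> e ?s ?d = e ?s d" using d by (intro someI_ex[of "\<lambda>d'. d' \<in> D \<and> e ?s d' = e ?s d"]) auto
    then have "e ?s' ?d = e ?s' d" using E[of w ?d d] d by simp
    then show ?thesis by (simp add: h_def)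
  qed
  have u: "univ (Ms ?s) = e ?s ` D" "univ (Ms ?s') = e ?s' ` D"
    using e_surj fin \<sigma>(2) \<rho>(2) by auto
  have hm: "map h (map (e ?s) ds) = map (e ?s') ds" if "set ds \<subseteq> D" for ds
    using that h by auto
  have "is_iso \<tau> h (Ms ?s) (Ms ?s')"
    unfolding is_iso_def
  proof (intro conjI ballI st)
    have "inj_on h (e ?s ` D)"
      using h E[of w] by (auto intro!: inj_onI)
    moreover have "h ` e ?s ` D = e ?s' ` D" using h by (auto simp: image_image)
    ultimately show "bij_betw h (univ (Ms ?s)) (univ (Ms ?s'))" by (simp add: bij_betw_def u)
  next
    fix f xs assume f: "f \<in> fsyms \<tau>" and xs: "xs \<in> fargs \<tau> f (univ (Ms ?s))"
    then obtain ds where ds: "ds \<in> fargs \<tau> f D" "xs = map (e ?s) ds" by (auto simp: u fargs_image)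
    have "fint (Ms ?s) f xs \<in> univ (Ms ?s)" using st(1) f xs unfolding structure_of_def by blast
    then obtain d where d: "d \<in> D" "fint (Ms ?s) f xs = e ?s d" by (auto simp: u)
    then have "Inr (Inl (f, ds, d)) \<in> col ?s" using f ds by (auto simp: colour_def)
    then have "fint (Ms ?s') f (map (e ?s') ds) = e ?s' d" unfolding c by (auto simp: colour_def)
    then show "h (fint (Ms ?s) f xs) = fint (Ms ?s') f (map h xs)"
      using d h hm[of ds] ds by (simp add: fargs_def del: map_map map_eq_conv)
  next
    fix R xs assume R: "R \<in> rsyms \<tau>" and xs: "xs \<in> rargs \<tau> R (univ (Ms ?s))"
    then obtain ds where ds: "ds \<in> rargs \<tau> R D" "xs = map (e ?s) ds" by (auto simp: u rargs_image)
    have "rint (Ms ?s) R (map (e ?s) ds) \<longleftrightarrow> Inr (Inr (R, ds)) \<in> col ?s"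
      using R ds by (auto simp: colour_def)
    also have "\<dots> \<longleftrightarrow> rint (Ms ?s') R (map (e ?s') ds)"
      using R ds unfolding c by (auto simp: colour_def)
    finally show "rint (Ms ?s) R xs \<longleftrightarrow> rint (Ms ?s') R (map h xs)"
      using hm[of ds] ds by (simp add: rargs_def del: map_map map_eq_conv)
  qed
  moreover have "h (e (\<sigma> ` u) d) = e (\<rho> ` u) d" if ud: "u \<subseteq> w" "d \<in> D" for u d
  proof -
    have "e (\<sigma> ` u) d \<in> univ (Ms ?s)" using ud by (intro e_in_mono[OF fin(1) \<sigma>(2)]) auto
    then obtain d' where d': "d' \<in> D" "e (\<sigma> ` u) d = e ?s d'" by (auto simp: u)
    then show ?thesis using E[OF ud d'(1)] h by simp
  qed
  ultimately show ?thesis by blast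
qed

text \<open>A placement of the abstract finite set \<open>w\<close> into \<open>I\<close> that gives
  every subset of \<open>w\<close> its canonical colour. All such placements yield isomorphic
  systems of structures (\<open>good_iso\<close>), and \<open>w\<close> itself need not lie in
  \<open>I\<close>.\<close>

definition good :: "('u \<Rightarrow> 'u) \<Rightarrow> 'u set \<Rightarrow> bool" where
  "good \<sigma> w \<longleftrightarrow> finite w \<and> increasing \<sigma> w \<and> \<sigma> ` w \<subseteq> I \<and> (\<forall>u\<subseteq>w. col (\<sigma> ` u) = t (card u))"

lemma good_subset: "good \<sigma> w \<Longrightarrow> u \<subseteq> w \<Longrightarrow> good \<sigma> u"
  unfolding good_def using increasing_subset[of \<sigma> w u] finite_subset[of u w] by auto

text \<open>Homogeneity up to the size of \<open>w\<close> is enough, so the homogeneous set may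
  vary with \<open>w\<close>.\<close>

lemma good_ex:
  assumes w: "finite w"
  shows "\<exists>\<sigma>. good \<sigma> w"
proof -
  obtain H where H: "H \<subseteq> I" "infinite H"
    "\<And>s. s \<in> Fpow H \<Longrightarrow> card s \<le> card w \<Longrightarrow> col s = t (card s)"
    using homogeneous[of "card w"] by blast
  obtain s where s: "finite s" "card s = card w" "s \<subseteq> H"
    using infinite_arbitrarily_large[OF H(2)] by blast
  obtain \<sigma> where \<sigma>: "increasing \<sigma> w" "\<sigma> ` w = s" using exists_increasing[OF w s(1,2)] by blast
  have "col (\<sigma> ` u) = t (card u)" if u: "u \<subseteq> w" for u
  proof -
    have "card (\<sigma> ` u) = card u"
      using card_image increasing_inj[OF increasing_subset[OF \<sigma>(1) u]] by blast
    moreover have "\<sigma> ` u \<in> Fpow H"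
      using u \<sigma>(2) s finite_subset[OF u w] by (auto simp: Fpow_def)
    ultimately show ?thesis using H(3)[of "\<sigma> ` u"] card_mono[OF w u] by simp
  qed
  then show ?thesis using w \<sigma> s(3) H(1) unfolding good_def by (intro exI[of _ \<sigma>]) auto
qed

lemma good_iso:
  assumes "good \<sigma> w" "good \<rho> w"
  shows "\<exists>h. is_iso \<tau> h (Ms (\<sigma> ` w)) (Ms (\<rho> ` w)) \<and>
    (\<forall>u\<subseteq>w. \<forall>d\<in>D. h (e (\<sigma> ` u) d) = e (\<rho> ` u) d)"
  using assms unfolding good_def by (intro colour_iso) auto

text \<open>Both placements restrict to the union of \<open>u\<close> and \<open>u'\<close>, where
  \<open>good_iso\<close> carries the elements named under \<open>\<sigma>\<close> to those named
  under \<open>\<rho>\<close>; an isomorphism preserves and reflects equality.\<close>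

lemma good_indep:
  assumes \<sigma>: "good \<sigma> w" and \<rho>: "good \<rho> w'" and u: "u \<union> u' \<subseteq> w" "u \<union> u' \<subseteq> w'" and d: "d \<in> D" "d' \<in> D"
  shows "e (\<sigma> ` u) d = e (\<sigma> ` u') d' \<longleftrightarrow> e (\<rho> ` u) d = e (\<rho> ` u') d'"
proof -
  let ?v = "u \<union> u'"
  have g: "good \<sigma> ?v" "good \<rho> ?v" using good_subset \<sigma> \<rho> u by blast+
  obtain h where h: "is_iso \<tau> h (Ms (\<sigma> ` ?v)) (Ms (\<rho> ` ?v))"
    "\<forall>x\<subseteq>?v. \<forall>d\<in>D. h (e (\<sigma> ` x) d) = e (\<rho> ` x) d"
    using good_iso[OF g] by blast
  have fin: "finite (\<sigma> ` ?v)" "\<sigma> ` ?v \<subseteq> I" using g(1) by (auto simp: good_def)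
  have "e (\<sigma> ` u) d \<in> univ (Ms (\<sigma> ` ?v))" "e (\<sigma> ` u') d' \<in> univ (Ms (\<sigma> ` ?v))"
    using e_in_mono[OF fin image_mono[OF Un_upper1] d(1)] e_in_mono[OF fin image_mono[OF Un_upper2] d(2)]
    by auto
  then have "e (\<sigma> ` u) d = e (\<sigma> ` u') d' \<longleftrightarrow> h (e (\<sigma> ` u) d) = h (e (\<sigma> ` u') d')"
    using inj_on_eq_iff[OF iso_inj[OF h(1)]] by auto
  moreover have "h (e (\<sigma> ` u) d) = e (\<rho> ` u) d" "h (e (\<sigma> ` u') d') = e (\<rho> ` u') d'"
    using h(2) d by auto
  ultimately show ?thesis by simp
qed

text \<open>The relation whose quotient is the limit of the pieces. For codes from \<open>D\<close>,
  naming the same element under one placement means doing so under every placement of a set large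
  enough (\<open>eqv_iff\<close>).\<close>

definition eqv :: "'u set \<times> 'd \<Rightarrow> 'u set \<times> 'd \<Rightarrow> bool" where
  "eqv p q \<longleftrightarrow> (\<exists>w \<sigma>. fst p \<union> fst q \<subseteq> w \<and> good \<sigma> w \<and> e (\<sigma> ` fst p) (snd p) = e (\<sigma> ` fst q) (snd q))"

lemma eqv_iff:
  assumes "good \<sigma> w" "u \<union> u' \<subseteq> w" "d \<in> D" "d' \<in> D"
  shows "eqv (u, d) (u', d') \<longleftrightarrow> e (\<sigma> ` u) d = e (\<sigma> ` u') d'"
  unfolding eqv_def fst_conv snd_conv using good_indep[OF assms(1) _ assms(2) _ assms(3,4)] assms(1,2)
  by blast

abbreviation codes :: "('u set \<times> 'd) set" where
  "codes \<equiv> Fpow J \<times> D"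

lemma eqv_refl: "p \<in> codes \<Longrightarrow> eqv p p"
  using good_ex[of "fst p"] unfolding eqv_def by (auto simp: Fpow_def)

lemma eqv_sym: "eqv p q \<Longrightarrow> eqv q p"
  unfolding eqv_def by (metis sup_commute)

lemma eqv_trans:
  assumes "p \<in> codes" "q \<in> codes" "r \<in> codes" "eqv p q" "eqv q r"
  shows "eqv p r"
proof -
  obtain u d u' d' u'' d'' where [simp]: "p = (u, d)" "q = (u', d')" "r = (u'', d'')"
    by (metis prod.exhaust)
  have D: "d \<in> D" "d' \<in> D" "d'' \<in> D" using assms by auto
  have fin: "finite (u \<union> u' \<union> u'')" using assms by (simp add: Fpow_def)
  from good_ex[OF fin] obtain \<sigma> where \<sigma>: "good \<sigma> (u \<union> u' \<union> u'')" ..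
  show ?thesis
  proof -
    have "e (\<sigma> ` u) d = e (\<sigma> ` u') d'"
      using assms(4) eqv_iff[OF \<sigma> _ D(1,2), of u u'] by fastforce
    moreover have "e (\<sigma> ` u') d' = e (\<sigma> ` u'') d''"
      using assms(5) eqv_iff[OF \<sigma> _ D(2,3), of u' u''] by fastforce
    moreover have "u \<union> u'' \<subseteq> u \<union> u' \<union> u''" by blast
    ultimately show ?thesis using eqv_iff[OF \<sigma> _ D(1,3), of u u''] by simp
  qed
qed

lemma eqv_cst: "x \<in> univ N \<Longrightarrow> y \<in> univ N \<Longrightarrow> eqv ({}, cst x) ({}, cst y) \<Longrightarrow> x = y"
  unfolding eqv_def using e_cst[of x "{}"] e_cst[of y "{}"] by auto

lemma cst_codes: "x \<in> univ N \<Longrightarrow> ({}, cst x) \<in> codes"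
  using cst_D by (auto simp: Fpow_def)

text \<open>The quotient must live on the element type and extend \<open>N\<close> literally: a
  class containing a constant receives that element of \<open>N\<close>, and the other classes go
  injectively into the complement of \<open>N\<close>, which has \<open>room\<close> for all
  codes.\<close>

lemma exists_naming:
  "\<exists>E. (\<forall>p\<in>codes. \<forall>q\<in>codes. E p = E q \<longleftrightarrow> eqv p q) \<and> (\<forall>x\<in>univ N. E ({}, cst x) = x)"
proof -
  obtain \<iota> where \<iota>: "inj_on \<iota> codes" "\<iota> ` codes \<subseteq> - univ N"
    using room card_of_ordLeq[of codes "- univ N"] by blast
  define rep where "rep p = (SOME q. q \<in> codes \<and> eqv p q)" for p
  have rep: "rep p \<in> codes" "eqv p (rep p)" if "p \<in> codes" for p
    using someI[of "\<lambda>q. q \<in> codes \<and> eqv p q" p] eqv_refl[OF that] that unfolding rep_def by auto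
  have rep_eq: "rep p = rep q \<longleftrightarrow> eqv p q" if pq: "p \<in> codes" "q \<in> codes" for p q
  proof
    assume "rep p = rep q"
    then show "eqv p q"
      using rep[OF pq(1)] rep[OF pq(2)] eqv_trans[OF pq(1) rep(1)[OF pq(1)] pq(2)] eqv_sym by metis
  next
    assume "eqv p q"
    then have "r \<in> codes \<and> eqv p r \<longleftrightarrow> r \<in> codes \<and> eqv q r" for r
      using eqv_trans[OF pq(1,2)] eqv_trans[OF pq(2,1)] eqv_sym[OF \<open>eqv p q\<close>] by blast
    then show "rep p = rep q" unfolding rep_def by simp
  qed
  define E where "E p = (if \<exists>x\<in>univ N. eqv p ({}, cst x) then SOME x. x \<in> univ N \<and> eqv p ({}, cst x)
    else \<iota> (rep p))" for p
  have EN: "E p = x" if p: "p \<in> codes" "x \<in> univ N" "eqv p ({}, cst x)" for p x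
  proof -
    have "(SOME x. x \<in> univ N \<and> eqv p ({}, cst x)) = x"
    proof (rule some_equality)
      fix y assume y: "y \<in> univ N \<and> eqv p ({}, cst y)"
      then have "eqv ({}, cst y) ({}, cst x)"
        using eqv_trans[OF cst_codes p(1) cst_codes] eqv_sym p by blast
      then show "y = x" using eqv_cst y p(2) by blast
    qed (use p in simp)
    then show ?thesis using p by (auto simp: E_def)
  qed
  have EO: "E p = \<iota> (rep p)" "E p \<notin> univ N"
    if p: "p \<in> codes" "\<not> (\<exists>x\<in>univ N. eqv p ({}, cst x))" for p
  proof -
    show "E p = \<iota> (rep p)" unfolding E_def using p(2) by (rule if_not_P)
    moreover have "\<iota> (rep p) \<in> \<iota> ` codes" using rep(1)[OF p(1)] by (rule imageI)
    ultimately show "E p \<notin> univ N" using \<iota>(2) by auto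
  qed
  have "E p = E q \<longleftrightarrow> eqv p q" if pq: "p \<in> codes" "q \<in> codes" for p q
  proof (cases "\<exists>x\<in>univ N. eqv p ({}, cst x)")
    case True
    then obtain x where x: "x \<in> univ N" "eqv p ({}, cst x)" by blast
    have Ep: "E p = x" using EN[OF pq(1) x] .
    show ?thesis
    proof
      assume "E p = E q"
      then have "E q \<in> univ N" using Ep x(1) by simp
      then obtain y where y: "y \<in> univ N" "eqv q ({}, cst y)" using EO(2)[OF pq(2)] by blast
      then have "y = x" using EN[OF pq(2) y] Ep \<open>E p = E q\<close> by simp
      then show "eqv p q" using eqv_trans[OF pq(1) cst_codes[OF x(1)] pq(2) x(2)] eqv_sym[OF y(2)] by simp
    next
      assume "eqv p q"
      then have "eqv q ({}, cst x)"
        using eqv_trans[OF pq(2,1) cst_codes[OF x(1)] _ x(2)] eqv_sym by blast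
      then show "E p = E q" using EN[OF pq(2) x(1)] Ep by simp
    qed
  next
    case False
    note Ep = EO[OF pq(1) False]
    show ?thesis
    proof
      assume eq: "E p = E q"
      then have "\<not> (\<exists>x\<in>univ N. eqv q ({}, cst x))" using EN[OF pq(2)] Ep(2) by auto
      then have "\<iota> (rep p) = \<iota> (rep q)" using EO(1)[OF pq(2)] Ep(1) eq by simp
      then have "rep p = rep q" by (rule inj_onD[OF \<iota>(1) _ rep(1)[OF pq(1)] rep(1)[OF pq(2)]])
      then show "eqv p q" using rep_eq[OF pq] by simp
    next
      assume pq': "eqv p q"
      have "\<not> eqv q ({}, cst x)" if x: "x \<in> univ N" for x
      proof
        assume "eqv q ({}, cst x)"
        from eqv_trans[OF pq cst_codes[OF x] pq' this] show False using False x by metis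
      qed
      then show "E p = E q" using EO(1)[OF pq(2)] Ep(1) rep_eq[OF pq] pq' by auto
    qed
  qed
  moreover have "E ({}, cst x) = x" if "x \<in> univ N" for x
    using EN[OF cst_codes[OF that] that eqv_refl[OF cst_codes[OF that]]] .
  ultimately show ?thesis by blast
qed

text \<open>The limit is the directed union, over finite subsets of \<open>J\<close>, of renamed
  pieces. The final conjunct, a piece around each element embedded over \<open>N\<close>, is what
  later carries the omission of a type from the pieces to the model.\<close>

lemma EM_model:
  "\<exists>U\<in>K. prec N U \<and> |J| \<le>o |univ U| \<and> |univ U| \<le>o |Fpow J \<times> D| \<and>
    (\<forall>b\<in>univ U. \<exists>s h y. finite s \<and> s \<subseteq> I \<and> kemb h (Ms s) U \<and> (\<forall>x\<in>univ N. h x = x) \<and>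
      y \<in> univ (Ms s) \<and> h y = b)"
proof -
  obtain E where E: "\<And>p q. p \<in> codes \<Longrightarrow> q \<in> codes \<Longrightarrow> E p = E q \<longleftrightarrow> eqv p q"
    and EN: "\<And>x. x \<in> univ N \<Longrightarrow> E ({}, cst x) = x"
    using exists_naming by blast
  have E_good: "E (u, d) = E (u', d') \<longleftrightarrow> e (\<sigma> ` u) d = e (\<sigma> ` u') d'"
    if "good \<sigma> w" "w \<subseteq> J" "u \<subseteq> w" "u' \<subseteq> w" "d \<in> D" "d' \<in> D" for \<sigma> w u u' d d'
  proof -
    have "finite w" using that(1) by (simp add: good_def)
    then have "(u, d) \<in> codes" "(u', d') \<in> codes"
      using that finite_subset[of _ w] by (auto simp: Fpow_def)
    then show ?thesis using E eqv_iff[OF that(1)] that by simp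
  qed
  \<comment> \<open>Renaming of a placed piece: pick a code of \<open>y\<close> and give
    \<open>y\<close> the name of that code over \<open>w\<close>. The choice of the code does not
    matter, and codes over smaller sets give the same name.\<close>
  define k where "k \<sigma> w y = E (w, SOME d. d \<in> D \<and> e (\<sigma> ` w) d = y)" for \<sigma> w y
  have top: "\<exists>d'\<in>D. e (\<sigma> ` u) d = e (\<sigma> ` w) d'" if "good \<sigma> w" "u \<subseteq> w" "d \<in> D" for \<sigma> u w d
  proof -
    have fin: "finite (\<sigma> ` w)" "\<sigma> ` w \<subseteq> I" using that(1) by (auto simp: good_def)
    have "e (\<sigma> ` u) d \<in> univ (Ms (\<sigma> ` w))" using that by (intro e_in_mono[OF fin]) auto
    then show ?thesis using e_surj[OF fin] by blast
  qed
  have k: "k \<sigma> w (e (\<sigma> ` u) d) = E (u, d)" if g: "good \<sigma> w" "w \<subseteq> J" "u \<subseteq> w" "d \<in> D" for \<sigma> w u d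
  proof -
    let ?d = "SOME d'. d' \<in> D \<and> e (\<sigma> ` w) d' = e (\<sigma> ` u) d"
    have "?d \<in> D \<and> e (\<sigma> ` w) ?d = e (\<sigma> ` u) d"
      using top[OF g(1,3,4)] by (intro someI_ex[of "\<lambda>d'. d' \<in> D \<and> e (\<sigma> ` w) d' = e (\<sigma> ` u) d"]) auto
    then have "E (w, ?d) = E (u, d)" using E_good[OF g(1,2) subset_refl g(3) _ g(4), of ?d] by simp
    then show ?thesis by (simp add: k_def)
  qed
  have Msg: "univ (Ms (\<sigma> ` w)) = e (\<sigma> ` w) ` D" "Ms (\<sigma> ` w) \<in> K"
    "u \<subseteq> w \<Longrightarrow> prec (Ms (\<sigma> ` u)) (Ms (\<sigma> ` w))" if "good \<sigma> w" for \<sigma> w u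
  proof -
    have fin: "finite (\<sigma> ` w)" "\<sigma> ` w \<subseteq> I" using that by (auto simp: good_def)
    show "univ (Ms (\<sigma> ` w)) = e (\<sigma> ` w) ` D" using e_surj[OF fin] by simp
    show "Ms (\<sigma> ` w) \<in> K" using prec_K[OF Ms_mono[OF fin subset_refl]] by simp
    show "u \<subseteq> w \<Longrightarrow> prec (Ms (\<sigma> ` u)) (Ms (\<sigma> ` w))" by (rule Ms_mono[OF fin]) auto
  qed
  have k_inj: "inj_on (k \<sigma> w) (univ (Ms (\<sigma> ` w)))" if g: "good \<sigma> w" "w \<subseteq> J" for \<sigma> w
  proof (rule inj_onI)
    fix x y assume xy: "x \<in> univ (Ms (\<sigma> ` w))" "y \<in> univ (Ms (\<sigma> ` w))" "k \<sigma> w x = k \<sigma> w y"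
    then obtain d d' where d: "d \<in> D" "d' \<in> D" "x = e (\<sigma> ` w) d" "y = e (\<sigma> ` w) d'"
      using Msg(1)[OF g(1)] by auto
    then have "E (w, d) = E (w, d')"
      using xy(3) k[OF g subset_refl d(1)] k[OF g subset_refl d(2)] by simp
    then show "x = y" using E_good[OF g subset_refl subset_refl d(1,2)] d by simp
  qed
  define S where "S w = (SOME \<sigma>. good \<sigma> w)" for w
  have S: "good (S w) w" if "finite w" for w
    using someI_ex[OF good_ex[OF that]] by (simp add: S_def)
  define G where "G w = img \<tau> (k (S w) w) (Ms (S w ` w))" for w
  \<comment> \<open>The renamed piece depends only on \<open>u\<close>, neither on the placement nor
    on the larger set through which it is renamed; this makes the pieces literally nested.\<close>
  have G: "img \<tau> (k \<sigma> w) (Ms (\<sigma> ` u)) = G u" if g: "good \<sigma> w" "w \<subseteq> J" "u \<subseteq> w" for \<sigma> w u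
  proof -
    have gu: "good \<sigma> u" "u \<subseteq> J" using good_subset[OF g(1,3)] g by auto
    have Su: "good (S u) u" using gu(1) by (intro S) (simp add: good_def)
    obtain h where h: "is_iso \<tau> h (Ms (S u ` u)) (Ms (\<sigma> ` u))"
      "\<forall>v\<subseteq>u. \<forall>d\<in>D. h (e (S u ` v) d) = e (\<sigma> ` v) d"
      using good_iso[OF Su gu(1)] by blast
    have inj: "inj_on (k \<sigma> w) (univ (Ms (\<sigma> ` u)))"
      using inj_on_subset[OF k_inj[OF g(1,2)] prec_univ[OF Msg(3)[OF g(1,3)]]] .
    have "img \<tau> (k \<sigma> w) (Ms (\<sigma> ` u)) = img \<tau> (k \<sigma> w \<circ> h) (Ms (S u ` u))"
      using img_comp[OF h(1) inj] by simp
    also have "\<dots> = G u"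
      unfolding G_def
    proof (rule img_cong[OF structures[OF Msg(2)[OF Su]] k_inj[OF Su gu(2)]])
      fix x assume "x \<in> univ (Ms (S u ` u))"
      then obtain d where d: "d \<in> D" "x = e (S u ` u) d" using Msg(1)[OF Su] by auto
      then show "(k \<sigma> w \<circ> h) x = k (S u) u x"
        using h(2)[rule_format, OF subset_refl d(1)] k[OF g d(1)] k[OF Su gu(2) subset_refl d(1)] by simp
    qed
    finally show ?thesis .
  qed
  have G_mono: "prec (G u) (G w)" if w: "finite w" "w \<subseteq> J" "u \<subseteq> w" for u w
    using prec_img[OF Msg(3)[OF S[OF w(1)] w(3)] k_inj[OF S[OF w(1)] w(2)]]
      G[OF S[OF w(1)] w(2,3)] G[OF S[OF w(1)] w(2) subset_refl] by simp
  have G_univ: "univ (G w) = (\<lambda>d. E (w, d)) ` D" if w: "finite w" "w \<subseteq> J" for w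
    using Msg(1)[OF S[OF w(1)]] k[OF S[OF w(1)] w(2) subset_refl]
    by (simp add: G_def image_image)
  define U where "U = Union_struc \<tau> (Fpow J) G"
  have uU: "univ U = (\<Union>w\<in>Fpow J. univ (G w))" by (simp add: U_def)
  have "univ U \<subseteq> E ` codes"
    using G_univ by (auto simp: uU Fpow_def)
  then have Ucard: "|univ U| \<le>o |codes|" by (rule surj_imp_ordLeq)
  then have "|univ U| <o \<theta>" using bounded by (rule ordLeq_ordLess_trans)
  then have U: "U \<in> K" "\<And>w. w \<in> Fpow J \<Longrightarrow> prec (G w) U"
    using finite_subset_union[of J G] G_mono uU unfolding U_def by auto
  have kN: "k \<sigma> w x = x" if g: "good \<sigma> w" "w \<subseteq> J" and x: "x \<in> univ N" for \<sigma> w x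
  proof -
    have "e (\<sigma> ` {}) (cst x) = x" using e_cst[OF x, of "{}"] by simp
    then show ?thesis using k[OF g empty_subsetI cst_D[OF x]] EN[OF x] by simp
  qed
  have kU: "kemb (k \<sigma> w) (Ms (\<sigma> ` w)) U" if g: "good \<sigma> w" "w \<subseteq> J" for \<sigma> w
  proof -
    have "w \<in> Fpow J" using g by (auto simp: Fpow_def good_def)
    then have "prec (img \<tau> (k \<sigma> w) (Ms (\<sigma> ` w))) U" using G[OF g subset_refl] U(2) by simp
    then show ?thesis using kemb_iff[OF Msg(2)[OF g(1)]] k_inj[OF g] by blast
  qed
  have NU: "prec N U"
  proof -
    have g: "good (S {}) {}" using S by blast
    have "kemb (k (S {}) {}) N U"
      using kemb_restrict[OF _ kU[OF g empty_subsetI], of N] N_prec by simp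
    then show ?thesis using kN[OF g empty_subsetI] by (rule kemb_prec)
  qed
  moreover have "|J| \<le>o |univ U|"
  proof (rule card_of_ordLeqI)
    \<comment> \<open>\<open>d\<^sub>0\<close> names the generator, so equal names mean equal
      generators under a placement of both, and placements are injective.\<close>
    show "inj_on (\<lambda>j. E ({j}, d\<^sub>0)) J"
    proof (rule inj_onI)
      fix i j assume ij: "i \<in> J" "j \<in> J" "E ({i}, d\<^sub>0) = E ({j}, d\<^sub>0)"
      let ?\<sigma> = "S {i, j}"
      have g: "good ?\<sigma> {i, j}" using S by simp
      then have "e (?\<sigma> ` {i}) d\<^sub>0 = e (?\<sigma> ` {j}) d\<^sub>0"
        using E_good[OF g, of "{i}" "{j}" d\<^sub>0 d\<^sub>0] ij d0_D by auto
      then have eq: "?\<sigma> i = ?\<sigma> j" using e_d0[of "?\<sigma> i"] e_d0[of "?\<sigma> j"] g by (auto simp: good_def)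
      have "inj_on ?\<sigma> {i, j}" using g unfolding good_def by (elim conjE) (rule increasing_inj)
      then show "i = j" using eq by (rule inj_onD) auto
    qed
    show "E ({j}, d\<^sub>0) \<in> univ U" if j: "j \<in> J" for j
    proof -
      have "E ({j}, d\<^sub>0) \<in> univ (G {j})" using G_univ[of "{j}"] j d0_D by simp
      moreover have "{j} \<in> Fpow J" using j by (simp add: Fpow_def)
      ultimately show ?thesis unfolding uU by blast
    qed
  qed
  moreover have "\<exists>s h y. finite s \<and> s \<subseteq> I \<and> kemb h (Ms s) U \<and> (\<forall>x\<in>univ N. h x = x) \<and>
      y \<in> univ (Ms s) \<and> h y = b" if b: "b \<in> univ U" for b
  proof -
    obtain w where w: "w \<in> Fpow J" "b \<in> univ (G w)" using b by (auto simp: uU)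
    have wJ: "finite w" "w \<subseteq> J" using w(1) by (auto simp: Fpow_def)
    have g: "good (S w) w" using S[OF wJ(1)] .
    obtain d where d: "d \<in> D" "b = E (w, d)" using w(2) G_univ[OF wJ] by auto
    show ?thesis
    proof (intro exI conjI ballI)
      show "finite (S w ` w)" "S w ` w \<subseteq> I" using g by (auto simp: good_def)
      show "kemb (k (S w) w) (Ms (S w ` w)) U" by (rule kU[OF g wJ(2)])
      show "k (S w) w x = x" if "x \<in> univ N" for x by (rule kN[OF g wJ(2) that])
      show "e (S w ` w) d \<in> univ (Ms (S w ` w))" using Msg(1)[OF g] d(1) by simp
      show "k (S w) w (e (S w ` w) d) = b" using k[OF g wJ(2) subset_refl d(1)] d(2) by simp
    qed
  qed
  ultimately show ?thesis using U(1) Ucard by blast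
qed

end

section \<open>Omitting a Galois type\<close>

context aec
begin

text \<open>By recursion on finite sets, \<open>Ms w\<close> is a hull in \<open>M\<close> of
  \<open>N\<close>, \<open>w\<close> and all \<open>Ms u\<close> for proper subsets
  \<open>u\<close>; these are finitely many, so the size stays within \<open>\<mu>\<close>.
  Inclusion of universes inside \<open>M\<close> then gives the strong substructure relation by
  coherence.\<close>

lemma exists_system:
  assumes M: "M \<in> K" and N: "prec N M" "|univ N| \<le>o \<mu>" and \<mu>: "Cinfinite \<mu>"
    and LS: "LS_property \<tau> K prec LS" "LS \<le>o \<mu>"
  shows "\<exists>Ms. (\<forall>u w. finite w \<longrightarrow> w \<subseteq> univ M \<longrightarrow> u \<subseteq> w \<longrightarrow> prec (Ms u) (Ms w)) \<and>
    (\<forall>w. finite w \<longrightarrow> w \<subseteq> univ M \<longrightarrow>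
      prec (Ms w) M \<and> univ N \<union> w \<subseteq> univ (Ms w) \<and> |univ (Ms w)| \<le>o \<mu>)"
proof -
  define hull where "hull A = (SOME P. prec P M \<and> A \<subseteq> univ P \<and> |univ P| \<le>o \<mu>)" for A
  have hull: "prec (hull A) M \<and> A \<subseteq> univ (hull A) \<and> |univ (hull A)| \<le>o \<mu>"
    if A: "A \<subseteq> univ M" "|A| \<le>o \<mu>" for A
  proof -
    obtain P where P: "prec P M" "A \<subseteq> univ P" "|univ P| \<le>o |A| +c LS"
      using LS(1) M A(1) unfolding LS_property_def by blast
    have "|A| +c LS \<le>o \<mu>"
      using A(2) LS \<mu> by (intro csum_cinfinite_bound) (auto simp: card_of_card_order_on Field_card_of LS_property_def)
    then have "|univ P| \<le>o \<mu>" by (rule ordLeq_transitive[OF P(3)])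
    then show ?thesis
      unfolding hull_def using P(1,2) by (intro someI[of "\<lambda>P. prec P M \<and> A \<subseteq> univ P \<and> |univ P| \<le>o \<mu>" P]) auto
  qed
  define Ms where "Ms = wfrec finite_psubset
    (\<lambda>g w. hull (univ N \<union> w \<union> (\<Union>u\<in>{u. u \<subset> w}. univ (g u))))"
  have Ms: "Ms w = hull (univ N \<union> w \<union> (\<Union>u\<in>{u. u \<subset> w}. univ (Ms u)))" if "finite w" for w
    unfolding Ms_def using that
    by (subst wfrec[OF wf_finite_psubset]) (auto simp: cut_def finite_psubset_def intro!: arg_cong[where f = hull])
  have *: "prec (Ms w) M \<and> univ N \<union> w \<union> (\<Union>u\<in>{u. u \<subset> w}. univ (Ms u)) \<subseteq> univ (Ms w) \<and>
      |univ (Ms w)| \<le>o \<mu>" if "finite w" "w \<subseteq> univ M" for w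
    using that
  proof (induction w rule: finite_psubset_induct)
    case (psubset w)
    have IH: "prec (Ms u) M" "|univ (Ms u)| \<le>o \<mu>" if "u \<subset> w" for u
      using psubset.IH[of u] that psubset.prems by auto
    have fin: "finite {u. u \<subset> w}"
      by (rule finite_subset[of _ "Pow w"]) (use psubset.hyps in auto)
    have "|\<Union>u\<in>{u. u \<subset> w}. univ (Ms u)| \<le>o \<mu>"
      using IH(2) by (intro UNION_Cinfinite_bound[OF finite_bound[OF fin \<mu>] _ \<mu>]) blast
    moreover have "|univ N \<union> w| \<le>o \<mu>"
      by (rule Un_Cinfinite_bound[OF N(2) finite_bound[OF psubset.hyps \<mu>] \<mu>])
    ultimately have "|univ N \<union> w \<union> (\<Union>u\<in>{u. u \<subset> w}. univ (Ms u))| \<le>o \<mu>"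
      using Un_Cinfinite_bound[OF _ _ \<mu>] by blast
    moreover have "univ N \<union> w \<union> (\<Union>u\<in>{u. u \<subset> w}. univ (Ms u)) \<subseteq> univ M"
      using prec_univ[OF N(1)] prec_univ[OF IH(1)] psubset.prems by (intro Un_least UN_least) auto
    ultimately show ?case unfolding Ms[OF psubset.hyps] by (rule hull[rotated])
  qed
  have mono: "prec (Ms u) (Ms w)" if w: "finite w" "w \<subseteq> univ M" "u \<subseteq> w" for u w
  proof -
    have fu: "finite u" "u \<subseteq> univ M" using w finite_subset by auto
    have sub: "univ (Ms u) \<subseteq> univ (Ms w)"
    proof (cases "u = w")
      case False
      then have "u \<subset> w" using w(3) by blast
      then show ?thesis using *[OF w(1,2)] by blast
    qed simp
    have "prec (Ms u) M" "prec (Ms w) M" using *[OF fu] *[OF w(1,2)] by auto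
    then show ?thesis using sub by (rule prec_between)
  qed
  show ?thesis
  proof (intro exI[of _ Ms] conjI allI impI)
    fix w assume w: "finite w" "w \<subseteq> univ M"
    note * = *[OF w]
    show "prec (Ms u) (Ms w)" if "u \<subseteq> w" for u by (rule mono[OF w that])
    show "prec (Ms w) M" using * by (elim conjE)
    show "|univ (Ms w)| \<le>o \<mu>" using * by (elim conjE)
    show "univ N \<union> w \<subseteq> univ (Ms w)" using * by (elim conjE) (rule subset_trans[OF Un_upper1])
  qed
qed

end

lemma exists_strict_wellorder: "\<exists>lt :: 'a \<Rightarrow> 'a \<Rightarrow> bool. strict_wellorder lt"
proof -
  have r: "Well_order |UNIV :: 'a set|" "Field |UNIV :: 'a set| = UNIV"
    by (rule card_of_Well_order, rule Field_card_of)
  let ?r = "|UNIV :: 'a set|"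
  have "strict_wellorder (\<lambda>x y. (x, y) \<in> ?r - Id)"
  proof
    show "wfp (\<lambda>x y. (x, y) \<in> ?r - Id)"
    proof -
      have "{(x, y). (x, y) \<in> ?r - Id} = ?r - Id" by blast
      then show ?thesis using r(1) unfolding wfp_def well_order_on_def by (elim conjE) metis
    qed
    show "(x, z) \<in> ?r - Id" if "(x, y) \<in> ?r - Id" "(y, z) \<in> ?r - Id" for x y z
      using that Well_order_simps(1,2)[OF r(1)] by (auto dest: transD antisymD)
    show "(x, y) \<in> ?r - Id \<or> x = y \<or> (y, x) \<in> ?r - Id" for x y
      using Well_order_simps(3)[OF r(1)] r(2) by (auto simp: total_on_def)
  qed
  then show ?thesis by blast
qed

text \<open>All colours are subsets of one set of size at most \<open>\<mu>\<close>. Rank sets are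
  drawn from the finite subsets of the naturals, of which there are only countably many, and not
  from all subsets.\<close>

lemma colour_bound:
  fixes \<mu> :: "'k rel" and D :: "'d set" and \<tau> :: "('f, 'r) vocabulary"
  assumes \<mu>: "Cinfinite \<mu>" and D: "|D| \<le>o \<mu>" and syms: "|fsyms \<tau> <+> rsyms \<tau>| \<le>o \<mu>"
  shows "\<exists>C :: ((nat set \<times> 'd \<times> 'd) + ('f \<times> 'd list \<times> 'd) + ('r \<times> 'd list)) set set.
    |C| \<le>o ctwo ^c \<mu> \<and> (\<forall>lt (Ms :: 'u set \<Rightarrow> ('u, 'f, 'r) struc) e s. colour lt \<tau> Ms D e s \<in> C)"
proof -
  let ?F = "(Fpow (UNIV :: nat set) \<times> D \<times> D) <+> (fsyms \<tau> \<times> lists D \<times> D) <+> (rsyms \<tau> \<times> lists D)"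
  have nat: "|UNIV :: nat set| \<le>o \<mu>"
    by (rule ordIso_ordLeq_trans[OF card_of_nat natLeq_ordLeq_cinfinite[OF \<mu>]])
  have s: "|fsyms \<tau>| \<le>o \<mu>" "|rsyms \<tau>| \<le>o \<mu>"
    using ordLeq_transitive[OF card_of_Plus1 syms] ordLeq_transitive[OF card_of_Plus2 syms] by auto
  have "|?F| \<le>o \<mu>"
    using nat s D \<mu>
    by (intro Plus_Cinfinite_bound Times_Cinfinite_bound lists_Cinfinite_bound Fpow_Cinfinite_bound)
  also have "\<mu> =o |Field \<mu>|"
    using ordIso_symmetric[OF card_of_Field_ordIso] \<mu> by blast
  finally have "|?F| \<le>o |Field \<mu>|" .
  then have "|Pow ?F| \<le>o |Pow (Field \<mu>)|" by (rule card_of_Pow_mono)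
  also have "|Pow (Field \<mu>)| =o ctwo ^c \<mu>"
    unfolding ctwo_def cexp_def Field_card_of by (rule card_of_Pow_Func)
  finally have "|Pow ?F| \<le>o ctwo ^c \<mu>" .
  moreover have "colour lt \<tau> Ms D e s \<in> Pow ?F"
    for lt e s and Ms :: "'u set \<Rightarrow> ('u, 'f, 'r) struc"
  proof -
    have "finite v" if "v \<subseteq> {..<card s}" for v using that finite_subset by blast
    then show ?thesis by (auto simp: colour_def Fpow_def fargs_def rargs_def)
  qed
  ultimately show ?thesis by blast
qed

section \<open>From omission in a large model to omission in size \<open>lam\<close>\<close>

context aec_ap
begin

lemma omit_in_size:
  fixes \<mu> :: "'k rel" and lam :: "'l rel"
  assumes M: "M \<in> K" and N: "prec N M" "|univ N| \<le>o \<mu>" and \<mu>: "Cinfinite \<mu>"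
    and LS: "LS_property \<tau> K prec LS" "LS \<le>o \<mu>"
    and big: "\<And>i. i \<in> Field (cardSuc (ctwo ^c \<mu>)) \<Longrightarrow> Big (cardSuc (ctwo ^c \<mu>)) i (univ M)"
    and omit: "\<And>b. b \<in> univ M \<Longrightarrow> \<not> sim N b M a P"
    and lam: "Cinfinite lam" "\<mu> <o lam" "lam \<le>o |UNIV :: 'u set|" "lam <o \<theta>"
  shows "\<exists>U\<in>K. |univ U| =o lam \<and> prec N U \<and> (\<forall>b\<in>univ U. \<not> sim N b U a P)"
proof -
  obtain Ms where Ms_mono: "\<And>u w. finite w \<Longrightarrow> w \<subseteq> univ M \<Longrightarrow> u \<subseteq> w \<Longrightarrow> prec (Ms u) (Ms w)"
    and Ms: "\<And>w. finite w \<Longrightarrow> w \<subseteq> univ M \<Longrightarrow>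
      prec (Ms w) M \<and> univ N \<union> w \<subseteq> univ (Ms w) \<and> |univ (Ms w)| \<le>o \<mu>"
    using exists_system[OF M N \<mu> LS] by auto
  have MsK: "Ms w \<in> K" if "finite w" "w \<subseteq> univ M" for w
    using prec_K[of "Ms w" M] Ms[OF that] by blast
  have Ms_ne: "univ (Ms w) \<noteq> {}" if "finite w" "w \<subseteq> univ M" for w
    using structures[OF MsK[OF that]] by (simp add: structure_of_def)
  have \<mu>F: "\<mu> =o |Field \<mu>|" using ordIso_symmetric[OF card_of_Field_ordIso] \<mu> by blast
  have "\<exists>g. g ` Field \<mu> = univ (Ms w)" if w: "finite w" "w \<subseteq> univ M" for w
  proof -
    have "|univ (Ms w)| \<le>o |Field \<mu>|" using ordLeq_ordIso_trans[OF _ \<mu>F] Ms[OF w] by blast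
    then show ?thesis using card_of_ordLeq2[OF Ms_ne[OF w]] by blast
  qed
  then obtain g where g: "\<And>w. finite w \<Longrightarrow> w \<subseteq> univ M \<Longrightarrow> g w ` Field \<mu> = univ (Ms w)" by metis
  \<comment> \<open>\<open>Inl x\<close> is the constant for \<open>x\<close> in \<open>N\<close>,
    \<open>Inr None\<close> the generator, and \<open>Inr (Some i)\<close> runs through an
    enumeration of each \<open>Ms w\<close> by \<open>\<mu>\<close>. The constants are separate
    because their codes must be the same for all \<open>w\<close>.\<close>
  define D :: "('u + 'k option) set" where
    "D = Inl ` univ N \<union> ({Inr None} \<union> Inr ` Some ` Field \<mu>)"
  \<comment> \<open>Only on singletons does \<open>Inr None\<close> have a prescribed value;
    elsewhere any element of \<open>Ms w\<close> will do.\<close>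
  define e where "e w = case_sum id (case_option
    (if is_singleton w then the_elem w else (SOME y. y \<in> univ (Ms w))) (g w))" for w
  have e_simps: "e w (Inl x) = x" "e w (Inr (Some i)) = g w i" "e {x} (Inr None) = x" for w x i
    by (auto simp: e_def)
  have e_None: "e w (Inr None) \<in> univ (Ms w)" if w: "finite w" "w \<subseteq> univ M" for w
  proof (cases "is_singleton w")
    case True
    then obtain x where "w = {x}" by (auto simp: is_singleton_def)
    then show ?thesis using Ms[OF w] e_simps(3) by simp
  next
    case False
    then show ?thesis using Ms_ne[OF w] some_in_eq[of "univ (Ms w)"] by (simp add: e_def)
  qed
  have e_surj: "e w ` D = univ (Ms w)" if w: "finite w" "w \<subseteq> univ M" for w
  proof -
    have "e w ` D = univ N \<union> ({e w (Inr None)} \<union> g w ` Field \<mu>)"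
      by (simp add: D_def image_Un image_image e_simps)
    then show ?thesis using g[OF w] e_None[OF w] Ms[OF w] by auto
  qed
  have refl\<mu>: "|Field \<mu>| \<le>o \<mu>" using ordIso_imp_ordLeq[OF ordIso_symmetric[OF \<mu>F]] .
  have D\<mu>: "|D| \<le>o \<mu>"
    unfolding D_def using \<mu> N(2) refl\<mu>
    by (intro Un_Cinfinite_bound image_bound) (auto intro: finite_bound)
  have syms: "|fsyms \<tau> <+> rsyms \<tau>| \<le>o \<mu>"
    using LS ordLeq_transitive[OF _ LS(2)] unfolding LS_property_def by blast
  obtain lt :: "'u \<Rightarrow> 'u \<Rightarrow> bool" where lt: "strict_wellorder lt"
    using exists_strict_wellorder by blast
  let ?m = "ctwo ^c \<mu>"
  have m: "Cinfinite ?m" using \<mu> by (intro Cinfinite_cexp ordLeq_refl Card_order_ctwo)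
  obtain C where C: "|C| \<le>o ?m" "\<And>s. colour lt \<tau> Ms D e s \<in> C"
    using colour_bound[OF \<mu> D\<mu> syms] by metis
  have "colour lt \<tau> Ms D e ` Fpow (univ M) \<subseteq> C" using C(2) by blast
  from strict_wellorder.coherent_colours[OF lt m C(1) big this]
  obtain t where t: "\<forall>n. \<exists>H\<subseteq>univ M. infinite H \<and>
      (\<forall>s\<in>Fpow H. card s \<le> n \<longrightarrow> colour lt \<tau> Ms D e s = t (card s))" ..
  \<comment> \<open>\<open>J\<close> serves only as a linear order of size \<open>lam\<close>; its
    finite subsets are placed into \<open>univ M\<close> by increasing maps.\<close>
  obtain J :: "'u set" where J: "|J| =o lam"
    using exists_subset_card[OF conjunct2[OF lam(1)] lam(3)] by blast
  have J': "|J| \<le>o lam" "lam \<le>o |J|"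
    using ordIso_imp_ordLeq[OF J] ordIso_imp_ordLeq[OF ordIso_symmetric[OF J]] by auto
  have codes: "|Fpow J \<times> D| \<le>o lam"
    using J'(1) lam(1) ordLeq_transitive[OF D\<mu> ordLess_imp_ordLeq[OF lam(2)]]
    by (intro Times_Cinfinite_bound Fpow_Cinfinite_bound)
  have inf: "infinite (UNIV :: 'u set)"
    using cinfinite_mono[OF lam(3)] lam(1) by (simp add: cinfinite_def Field_card_of)
  have "|univ N| <o |UNIV :: 'u set|"
    by (rule ordLeq_ordLess_trans[OF N(2) ordLess_ordLeq_trans[OF lam(2,3)]])
  then have "|UNIV :: 'u set| \<le>o |- univ N|" using infinite_ordLeq_Diff[OF inf] by (simp add: Compl_eq_Diff_UNIV)
  then have room: "|Fpow J \<times> D| \<le>o |- univ N|"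
    by (rule ordLeq_transitive[OF ordLeq_transitive[OF codes lam(3)]])
  have "ehrenfeucht_mostowski \<tau> K prec \<theta> lt (univ M) J N Ms D e Inl (Inr None) t"
  proof (intro ehrenfeucht_mostowski.intro ehrenfeucht_mostowski_axioms.intro)
    show "aec \<tau> K prec \<theta>" by (rule aec_axioms)
    show "strict_wellorder lt" by (rule lt)
    show "prec (Ms u) (Ms w)" if "finite w" "w \<subseteq> univ M" "u \<subseteq> w" for u w by (rule Ms_mono[OF that])
    show "e w ` D = univ (Ms w)" if "finite w" "w \<subseteq> univ M" for w by (rule e_surj[OF that])
    show "Inl x \<in> D" if "x \<in> univ N" for x using that by (simp add: D_def)
    show "e w (Inl x) = x" for w x by (rule e_simps(1))
    show "prec N (Ms {})" using Ms[of "{}"] by (intro prec_between[OF N(1)]) auto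
    show "Inr None \<in> D" by (simp add: D_def)
    show "e {x} (Inr None) = x" for x by (rule e_simps(3))
    show "\<exists>H\<subseteq>univ M. infinite H \<and>
        (\<forall>s\<in>Fpow H. card s \<le> n \<longrightarrow> colour lt \<tau> Ms D e s = t (card s))" for n
      by (rule t[THEN spec])
    show "|Fpow J \<times> D| \<le>o |- univ N|" by (rule room)
    show "|Fpow J \<times> D| <o \<theta>" by (rule ordLeq_ordLess_trans[OF codes lam(4)])
  qed
  from ehrenfeucht_mostowski.EM_model[OF this] obtain U where U: "U \<in> K" "prec N U"
    "|J| \<le>o |univ U|" "|univ U| \<le>o |Fpow J \<times> D|"
    and piece: "\<forall>b\<in>univ U. \<exists>s h y. finite s \<and> s \<subseteq> univ M \<and> kemb h (Ms s) U \<and>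
      (\<forall>x\<in>univ N. h x = x) \<and> y \<in> univ (Ms s) \<and> h y = b"
    by blast
  have "|univ U| =o lam"
    using ordLeq_transitive[OF U(4) codes] ordLeq_transitive[OF J'(2) U(3)]
    by (simp add: ordIso_iff_ordLeq)
  moreover have "\<not> sim N b U a P" if b: "b \<in> univ U" for b
  proof
    assume s: "sim N b U a P"
    obtain w h y where w: "finite w" "w \<subseteq> univ M" "kemb h (Ms w) U" "\<forall>x\<in>univ N. h x = x"
      "y \<in> univ (Ms w)" "h y = b" using bspec[OF piece b] by (elim exE conjE)
    have "sim N y (Ms w) b U" using sim_kemb[OF w(3), of N y] w(4,6) by simp
    then have "sim N y (Ms w) a P" using s prec_univ[OF U(2)] b by (rule sim_trans)
    moreover have MsM: "prec (Ms w) M" "univ N \<subseteq> univ (Ms w)" using Ms[OF w(1,2)] by auto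
    ultimately have "sim N y M a P" using w(5) by (intro sim_mono[of N y "Ms w" a P M])
    then show False using omit[of y] prec_univ[OF MsM(1)] w(5) by blast
  qed
  ultimately show ?thesis using U(1,2) by blast
qed

end

theorem theorem5p4:
  fixes \<tau> :: "('f, 'r) vocabulary"
    and K :: "('u, 'f, 'r) struc set"
    and prec :: "('u, 'f, 'r) struc \<Rightarrow> ('u, 'f, 'r) struc \<Rightarrow> bool"
    and \<theta> :: "'t rel" and LS :: "'s rel" and \<kappa> :: "'k rel" and lam \<chi> :: "'l rel"
  assumes "aec \<tau> K prec \<theta>"
    and "amalgamation_property \<tau> K prec"
    and "is_LS_number \<tau> K prec LS"
    and "Card_order \<kappa>" and "LS <o \<kappa>"
    and "Cinfinite lam"
    and "categorical_in \<tau> K lam"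
    and "is_weak_power lam \<kappa> lam"
    and "is_threshold \<kappa> lam \<chi>"
  shows "\<forall>M\<in>K. \<chi> \<le>o |univ M| \<longrightarrow> saturated \<tau> K prec \<kappa> M"
proof (intro ballI impI)
  fix M assume M: "M \<in> K" "\<chi> \<le>o |univ M|"
  interpret aec_ap \<tau> K prec \<theta>
    using assms(1,2) by (intro aec_ap.intro aec_ap_axioms.intro)
  note \<kappa> = assms(4) and lam = assms(6)
  have LS: "LS_property \<tau> K prec LS" "LS <o \<kappa>" using assms(3,5) by (auto simp: is_LS_number_def)
  have LSi: "Cinfinite LS"
    using LS(1) cinfinite_mono[of natLeq LS] natLeq_Cinfinite unfolding LS_property_def by blast
  have \<kappa>i: "Cinfinite \<kappa>" using cinfinite_mono[OF ordLess_imp_ordLeq[OF LS(2)]] LSi \<kappa> by blast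
  have pow: "lam ^c \<mu> \<le>o lam" if "\<mu> \<in> cards_below \<kappa>" for \<mu>
    using assms(8) that by (simp add: is_weak_power_def is_card_Sup_def)
  have \<kappa>lam: "\<kappa> \<le>o lam" by (rule weak_power_ge[OF lam \<kappa> pow])
  obtain M\<^sub>0 where M0: "M\<^sub>0 \<in> K" "|univ M\<^sub>0| =o lam"
    using assms(7) by (auto simp: categorical_in_def)
  have lam0: "lam =o |univ M\<^sub>0|" by (rule ordIso_symmetric[OF M0(2)])
  have lamU: "lam \<le>o |UNIV :: 'u set|" by (rule ordIso_ordLeq_trans[OF lam0 card_of_mono1]) simp
  have lam\<theta>: "lam <o \<theta>" by (rule ordIso_ordLess_trans[OF lam0 small[OF M0(1)]])
  have inf: "infinite (UNIV :: 'u set)"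
    using cinfinite_mono[OF lamU] lam by (simp add: cinfinite_def Field_card_of)
  have \<kappa>U: "\<kappa> \<le>o |UNIV :: 'u set|" by (rule ordLeq_transitive[OF \<kappa>lam lamU])
  obtain R where R: "R \<in> K" "|univ R| =o lam" "rich \<kappa> R"
    using exists_rich[OF lam M0 \<kappa> pow LS] by blast
  have lam_rich: "rich \<kappa> Q" if Q: "Q \<in> K" "|univ Q| =o lam" for Q
  proof -
    obtain h where "is_iso \<tau> h Q R"
      using assms(7) Q R(1,2) by (auto simp: categorical_in_def isomorphic_def)
    then show ?thesis using rich_iso[OF inf \<kappa>U _ Q(1) R(3)] by blast
  qed
  have "rich \<kappa> M"
    unfolding rich_def
  proof (intro allI impI, elim conjE, rule ccontr)
    fix N P a
    assume N: "prec N M" "prec N P" and P: "|univ P| <o \<kappa>" and a: "a \<in> univ P"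
      and no: "\<not> (\<exists>b\<in>univ M. sim N b M a P)"
    have NP: "|univ N| \<le>o |univ P|" by (rule card_of_mono1[OF prec_univ[OF N(2)]])
    from assms(9) consider (beth) "is_beth_Sup \<kappa> \<chi>" | (lam) "\<chi> = lam"
      by (auto simp: is_threshold_def)
    then show False
    proof cases
      case lam
      \<comment> \<open>\<open>A\<close> forces the hull \<open>Q\<close> to have size exactly
        \<open>lam\<close>, where categoricity applies.\<close>
      obtain A where A: "A \<subseteq> univ M" "|A| =o lam"
        using exists_subset_card[OF conjunct2[OF assms(6)]] M(2) lam by auto
      have Nlam: "|univ N| \<le>o lam"
        by (rule ordLeq_transitive[OF NP ordLeq_transitive[OF ordLess_imp_ordLeq[OF P] \<kappa>lam]])
      have "univ N \<union> A \<subseteq> univ M" using A(1) prec_univ[OF N(1)] by simp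
      then obtain Q where Q: "prec Q M" "univ N \<union> A \<subseteq> univ Q" "|univ Q| \<le>o |univ N \<union> A| +c LS"
        using LS(1) M(1) unfolding LS_property_def by blast
      have "|univ N \<union> A| \<le>o lam"
        by (rule Un_Cinfinite_bound[OF Nlam ordIso_imp_ordLeq[OF A(2)] assms(6)])
      then have "|univ N \<union> A| +c LS \<le>o lam"
        using ordLeq_transitive[OF ordLess_imp_ordLeq[OF LS(2)] \<kappa>lam] assms(6) LSi
        by (intro csum_cinfinite_bound) (auto simp: card_of_card_order_on Field_card_of)
      then have "|univ Q| \<le>o lam" by (rule ordLeq_transitive[OF Q(3)])
      moreover have "lam \<le>o |univ Q|"
        using Q(2) by (intro ordIso_ordLeq_trans[OF ordIso_symmetric[OF A(2)] card_of_mono1]) auto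
      ultimately have "|univ Q| =o lam" by (simp add: ordIso_iff_ordLeq)
      then have "rich \<kappa> Q" using lam_rich prec_K[OF Q(1)] by blast
      moreover have NQ: "prec N Q" using prec_between[OF N(1) Q(1)] Q(2) by simp
      ultimately obtain b where b: "b \<in> univ Q" "sim N b Q a P"
        using N(2) P a unfolding rich_def by blast
      then have "sim N b M a P" using sim_mono[OF b(2) Q(1) prec_univ[OF NQ] b(1)] by simp
      then show False using no b(1) prec_univ[OF Q(1)] by blast
    next
      case beth
      have "|univ P| +c LS <o \<kappa>" using csum_ordLess[OF \<kappa>i card_of_Card_order] LSi P LS(2) by blast
      then have "|univ P <+> Field LS| <o \<kappa>" by (simp add: csum_def Field_card_of)
      \<comment> \<open>The threshold ranges over cardinals on the type of \<open>\<kappa>\<close>,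
        so \<open>\<mu>\<close> must be represented there. It is taken large enough for
        \<open>P\<close>, hence for \<open>N\<close>, and for \<open>LS\<close>.\<close>
      then obtain X :: "'k set" where X: "|univ P <+> Field LS| =o |X|" "|X| <o \<kappa>"
        using internalize_card_of_ordLess[of "univ P <+> Field LS" \<kappa>] by blast
      let ?\<mu> = "|X|"
      have PX: "|univ P| \<le>o ?\<mu>" by (rule ordLeq_ordIso_trans[OF card_of_Plus1 X(1)])
      have "|Field LS| \<le>o ?\<mu>" by (rule ordLeq_ordIso_trans[OF card_of_Plus2 X(1)])
      then have LSX: "LS \<le>o ?\<mu>"
        using ordIso_ordLeq_trans[OF ordIso_symmetric[OF card_of_Field_ordIso]] LSi by blast
      have \<mu>i: "Cinfinite ?\<mu>" using cinfinite_mono[OF LSX] LSi card_of_Card_order by blast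
      have \<mu>b: "?\<mu> \<in> cards_below \<kappa>" using X(2) by (simp add: cards_below_def card_of_Card_order)
      obtain B where B: "is_beth (cardSuc (ctwo ^c ?\<mu>)) (B ?\<mu> :: 'l rel)" "B ?\<mu> \<le>o \<chi>"
        using beth \<mu>b by (auto simp: is_beth_Sup_def is_card_Sup_def)
      let ?r = "cardSuc (ctwo ^c ?\<mu>)"
      have m: "Cinfinite (ctwo ^c ?\<mu>)" using \<mu>i by (intro Cinfinite_cexp ordLeq_refl Card_order_ctwo)
      have r: "Cinfinite ?r" "Well_order ?r" using Cinfinite_cardSuc[OF m] m by (auto simp: cardSuc_Well_order)
      have "\<forall>i\<in>Field ?r. \<exists>j\<in>Field ?r. (i, j) \<in> ?r \<and> i \<noteq> j"
        using infinite_Card_order_limit[of ?r] r(1) by (auto simp: cinfinite_def)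
      \<comment> \<open>\<beth> at \<open>(2^\<mu>)^+\<close> is at most \<open>\<chi>\<close> and
        hence at most the size of \<open>M\<close>; its index order is an infinite cardinal and so
        has no greatest element.\<close>
      then have big: "Big ?r i (univ M)" if "i \<in> Field ?r" for i
        using is_beth_limit_Big[OF B(1) _ r(2) ordLeq_transitive[OF B(2) M(2)] that] by blast
      have "\<exists>U\<in>K. |univ U| =o lam \<and> prec N U \<and> (\<forall>b\<in>univ U. \<not> sim N b U a P)"
        using ordLeq_transitive[OF NP PX] big no ordLess_ordLeq_trans[OF X(2) \<kappa>lam]
        by (intro omit_in_size[OF M(1) N(1) _ \<mu>i LS(1) LSX _ _ assms(6) _ lamU lam\<theta>]) auto
      then obtain U where U: "U \<in> K" "|univ U| =o lam" "prec N U" "\<forall>b\<in>univ U. \<not> sim N b U a P"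
        by blast
      then show False using lam_rich[OF U(1,2)] N(2) P a unfolding rich_def by blast
    qed
  qed
  then show "saturated \<tau> K prec \<kappa> M" by (rule rich_imp_saturated[OF inf \<kappa> \<kappa>U LS])
qed

end
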